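(* For $i\in\{1,2\}$, let $(\rho_i,\xi_i)$ be a well-separated entropy solution of the Hughes initial-boundary value problem corresponding to the initial datum $\overline{\rho}_i$ and the cost parameter $\alpha_i\ge 0$. Assume moreover that $\rho_1$ is $\mathbf{BV}$-regular. Then for a.e. $t>0$ there exists a constant $C$ that depends, in a non-decreasing way, only on $t$ and $\max\{\alpha_1,\alpha_2\}$ (the model data $v$ and $\rho_{\max}$ being fixed), such that $$\|\rho_1(t,\cdot)-\rho_2(t,\cdot)\|_{L^1(\mathfrak C)}\le C\bigl(|\alpha_1-\alpha_2|+\|\overline{\rho}_1-\overline{\rho}_2\|_{L^1(\mathfrak C)}\bigr).$$ In particular, for any fixed cost parameter $\alpha$ and initial datum $\overline{\rho}$ there exists at most one $\mathbf{BV}$-regular well-separated entropy solution.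
   Context: Let $\mathfrak C=(-1,1)$ and $\rho_{\max}>0$. The velocity $v\in C^2([0,\rho_{\max}];[0,v_{\max}])$ satisfies $v_{\max}:=v(0)>0$, $v(\rho_{\max})=0$, $v$ is strictly decreasing on $[0,\rho_{\max}]$, and $2v'(\rho)+\rho v''(\rho)<0$ for all $\rho\in[0,\rho_{\max}]$. Set $f(\rho):=\rho\,v(\rho)$ and let $\rho_c$ be the unique maximizer of $f$ on $[0,\rho_{\max}]$. The cost function with parameter $\alpha\ge0$ is $c(\rho)=1+\alpha\rho$. Initial data are measurable functions $\overline\rho:\mathfrak C\to[0,\rho_{\max}]$ with $\|\overline\rho\|_{L^1(\mathfrak C)}>0$. Entropy solution: a couple $(\rho,\xi)$ with $\rho\in L^1_{\rm loc}([0,\infty)\times\mathfrak C;[0,\rho_{\max}])$ and $\xi\in\mathrm{Lip}([0,\infty);\mathfrak C)$ is an entropy solution of the Hughes initial-boundary value problem with initial datum $\overline\rho$ and cost $c$ if: (a) $\int_{-1}^{\xi(t)}c(\rho(t,y))\,dy=\int_{\xi(t)}^1c(\rho(t,y))\,dy$ for a.e. $t>0$; (b) for all $\kappa\in[0,\rho_{\max}]$ and all $\varphi\in C_c^\infty((0,\infty)\times\mathfrak C;[0,\infty))$, $$0\le\int_0^\infty\!\!\int_{\mathfrak C}\bigl(|\rho-\kappa|\varphi_t+\mathrm{sign}(x-\xi(t))\,\mathrm{sign}(\rho-\kappa)(f(\rho)-f(\kappa))\varphi_x\bigr)dx\,dt+2\int_0^\infty f(\kappa)\varphi(t,\xi(t))\,dt;$$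 (c) for a suitable representative, $\rho\in C^0([0,\infty);L^1(\mathfrak C))$ and $\rho(0,\cdot)=\overline\rho$; (d) the strong one-sided boundary traces satisfy $\rho(t,1^-)\in[0,\rho_c]$ and $\rho(t,-1^+)\in[0,\rho_c]$ for a.e. $t>0$. (Strong one-sided traces at $x=\pm1$ and along $x=\xi(t)$ exist because $f$ is strictly concave.) The solution is $\mathbf{BV}$-regular if $\rho\in L^\infty(0,T;BV(\mathfrak C))$ for all $T>0$. It is well-separated if the one-sided traces $\rho(t,\xi(t)^\pm)$ are equal to zero for a.e. $t>0$. *)

theory Defs
  imports "HOL-Analysis.Analysis"
begin

abbreviation corridor :: "real set" where
  "corridor \<equiv> {-1<..<1}"

fun C_k :: "nat \<Rightarrow> ('a::euclidean_space \<Rightarrow> real) \<Rightarrow> bool" where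
  "C_k 0 \<phi> \<longleftrightarrow> continuous_on UNIV \<phi>"
| "C_k (Suc k) \<phi> \<longleftrightarrow> \<phi> differentiable_on UNIV \<and>
     (\<forall>b\<in>Basis. C_k k (\<lambda>x. frechet_derivative \<phi> (at x) b))"

text \<open>Test functions on an open set \<open>U\<close> are represented by their extension by zero.\<close>

definition compact_support_in :: "'a::euclidean_space set \<Rightarrow> ('a \<Rightarrow> real) \<Rightarrow> bool" where
  "compact_support_in U \<phi> \<longleftrightarrow>
     compact (closure {x. \<phi> x \<noteq> 0}) \<and> closure {x. \<phi> x \<noteq> 0} \<subseteq> U"

definition L1_norm :: "(real \<Rightarrow> real) \<Rightarrow> real" where
  "L1_norm u = (LINT x:corridor|lebesgue. \<bar>u x\<bar>)"

definition total_variation :: "(real \<Rightarrow> real) \<Rightarrow> ereal" where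
  "total_variation u =
     (SUP \<phi>\<in>{\<phi>. C_k 1 \<phi> \<and> compact_support_in corridor \<phi> \<and> (\<forall>x. \<bar>\<phi> x\<bar> \<le> 1)}.
        ereal (LINT x:corridor|lebesgue. u x * deriv \<phi> x))"

definition BV_norm :: "(real \<Rightarrow> real) \<Rightarrow> ereal" where
  "BV_norm u = ereal (L1_norm u) + total_variation u"

definition flux :: "(real \<Rightarrow> real) \<Rightarrow> real \<Rightarrow> real" where
  "flux v r = r * v r"

text \<open>Derivatives are one-sided at the end points of the density interval.\<close>

definition admissible_velocity :: "real \<Rightarrow> (real \<Rightarrow> real) \<Rightarrow> bool" where
  "admissible_velocity \<rho>max v \<longleftrightarrow>
     v 0 > 0 \<and> v \<rho>max = 0 \<and> v ` {0..\<rho>max} \<subseteq> {0..v 0} \<and>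
     strict_antimono_on {0..\<rho>max} v \<and>
     (\<exists>v' v''.
        (\<forall>r\<in>{0..\<rho>max}. (v has_real_derivative v' r) (at r within {0..\<rho>max})) \<and>
        (\<forall>r\<in>{0..\<rho>max}. (v' has_real_derivative v'' r) (at r within {0..\<rho>max})) \<and>
        continuous_on {0..\<rho>max} v'' \<and>
        (\<forall>r\<in>{0..\<rho>max}. 2 * v' r + r * v'' r < 0))"

text \<open>The maximizer is unique for admissible velocities, as \<open>flux v\<close> is then strictly concave.\<close>

definition critical_density :: "real \<Rightarrow> (real \<Rightarrow> real) \<Rightarrow> real" where
  "critical_density \<rho>max v = arg_max_on (flux v) {0..\<rho>max}"

definition cost :: "real \<Rightarrow> real \<Rightarrow> real" where
  "cost \<alpha> r = 1 + \<alpha> * r"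

definition initial_datum :: "real \<Rightarrow> (real \<Rightarrow> real) \<Rightarrow> bool" where
  "initial_datum \<rho>max \<rho>0 \<longleftrightarrow>
     \<rho>0 \<in> borel_measurable (lebesgue_on corridor) \<and>
     \<rho>0 ` corridor \<subseteq> {0..\<rho>max} \<and> L1_norm \<rho>0 > 0"

text \<open>
  \<open>strong_trace \<rho> \<eta> \<sigma> \<gamma>\<close>: \<open>\<gamma>\<close> is the strong trace of \<open>\<rho>\<close> along the curve \<open>x = \<eta> t\<close>, from the
  right for \<open>\<sigma> = 1\<close> and from the left for \<open>\<sigma> = -1\<close>, i.e. \<open>\<rho> t (\<eta> t + \<sigma> * s)\<close> tends to \<open>\<gamma> t\<close>
  locally in \<open>L\<^sup>1\<close> with respect to \<open>t\<close> as an essential limit for \<open>s\<close> tending to 0 from above.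
  The essential limit makes this independent of the representative of \<open>\<rho>\<close>.
\<close>

definition strong_trace ::
  "(real \<Rightarrow> real \<Rightarrow> real) \<Rightarrow> (real \<Rightarrow> real) \<Rightarrow> real \<Rightarrow> (real \<Rightarrow> real) \<Rightarrow> bool" where
  "strong_trace \<rho> \<eta> \<sigma> \<gamma> \<longleftrightarrow>
     \<gamma> \<in> borel_measurable (lebesgue_on {0..}) \<and>
     (\<forall>T>0. \<forall>e>0. \<exists>d>0. AE s in lebesgue. 0 < s \<and> s < d \<longrightarrow>
        set_integrable lebesgue {0..T} (\<lambda>t. \<rho> t (\<eta> t + \<sigma> * s) - \<gamma> t) \<and>
        (LINT t:{0..T}|lebesgue. \<bar>\<rho> t (\<eta> t + \<sigma> * s) - \<gamma> t\<bar>) < e)"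

definition kruzhkov_integrand ::
  "(real \<Rightarrow> real) \<Rightarrow> (real \<Rightarrow> real \<Rightarrow> real) \<Rightarrow> (real \<Rightarrow> real) \<Rightarrow> real \<Rightarrow>
     (real \<times> real \<Rightarrow> real) \<Rightarrow> real \<times> real \<Rightarrow> real" where
  "kruzhkov_integrand v \<rho> \<xi> \<kappa> \<phi> = (\<lambda>(t, x).
     \<bar>\<rho> t x - \<kappa>\<bar> * frechet_derivative \<phi> (at (t, x)) (1, 0) +
     sgn (x - \<xi> t) * sgn (\<rho> t x - \<kappa>) * (flux v (\<rho> t x) - flux v \<kappa>) *
       frechet_derivative \<phi> (at (t, x)) (0, 1))"

definition entropy_inequality ::
  "real \<Rightarrow> (real \<Rightarrow> real) \<Rightarrow> (real \<Rightarrow> real \<Rightarrow> real) \<Rightarrow> (real \<Rightarrow> real) \<Rightarrow> bool" where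
  "entropy_inequality \<rho>max v \<rho> \<xi> \<longleftrightarrow>
     (\<forall>\<kappa>\<in>{0..\<rho>max}. \<forall>\<phi>.
        (\<forall>k. C_k k \<phi>) \<and> compact_support_in ({0<..} \<times> corridor) \<phi> \<and> (\<forall>p. 0 \<le> \<phi> p) \<longrightarrow>
        0 \<le> (LINT p:{0<..} \<times> corridor|lebesgue. kruzhkov_integrand v \<rho> \<xi> \<kappa> \<phi> p) +
             2 * (LINT t:{0<..}|lebesgue. flux v \<kappa> * \<phi> (t, \<xi> t)))"

definition continuous_L1_with_initial ::
  "(real \<Rightarrow> real \<Rightarrow> real) \<Rightarrow> (real \<Rightarrow> real) \<Rightarrow> bool" where
  "continuous_L1_with_initial \<rho> \<rho>0 \<longleftrightarrow>
     (\<exists>r. (AE p in lebesgue_on ({0..} \<times> corridor). r (fst p) (snd p) = \<rho> (fst p) (snd p)) \<and>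
          (\<forall>t\<ge>0. set_integrable lebesgue corridor (r t)) \<and>
          (\<forall>t\<^sub>0\<ge>0. ((\<lambda>t. L1_norm (\<lambda>x. r t x - r t\<^sub>0 x)) \<longlongrightarrow> 0) (at t\<^sub>0 within {0..})) \<and>
          (AE x in lebesgue_on corridor. r 0 x = \<rho>0 x))"

definition entropy_solution ::
  "real \<Rightarrow> (real \<Rightarrow> real) \<Rightarrow> real \<Rightarrow> (real \<Rightarrow> real) \<Rightarrow>
     (real \<Rightarrow> real \<Rightarrow> real) \<Rightarrow> (real \<Rightarrow> real) \<Rightarrow> bool" where
  "entropy_solution \<rho>max v \<alpha> \<rho>0 \<rho> \<xi> \<longleftrightarrow>
     (\<lambda>p. \<rho> (fst p) (snd p)) \<in> borel_measurable (lebesgue_on ({0..} \<times> corridor)) \<and>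
     (AE p in lebesgue_on ({0..} \<times> corridor). \<rho> (fst p) (snd p) \<in> {0..\<rho>max}) \<and>
     (\<exists>L. L-lipschitz_on {0..} \<xi>) \<and> \<xi> ` {0..} \<subseteq> corridor \<and>
     (AE t in lebesgue. 0 < t \<longrightarrow>
        (LINT y:{-1..\<xi> t}|lebesgue. cost \<alpha> (\<rho> t y)) =
        (LINT y:{\<xi> t..1}|lebesgue. cost \<alpha> (\<rho> t y))) \<and>
     entropy_inequality \<rho>max v \<rho> \<xi> \<and>
     continuous_L1_with_initial \<rho> \<rho>0 \<and>
     (\<exists>\<gamma>. strong_trace \<rho> (\<lambda>_. 1) (-1) \<gamma> \<and>
          (AE t in lebesgue. 0 < t \<longrightarrow> \<gamma> t \<in> {0..critical_density \<rho>max v})) \<and>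
     (\<exists>\<gamma>. strong_trace \<rho> (\<lambda>_. -1) 1 \<gamma> \<and>
          (AE t in lebesgue. 0 < t \<longrightarrow> \<gamma> t \<in> {0..critical_density \<rho>max v}))"

text \<open>
  \<open>L\<^sup>\<infinity>(0,T;BV)\<close> is understood in the usual sense that the BV norm is essentially bounded in time;
  strong measurability into the nonseparable space BV is not required.
\<close>

definition BV_regular :: "(real \<Rightarrow> real \<Rightarrow> real) \<Rightarrow> bool" where
  "BV_regular \<rho> \<longleftrightarrow>
     (\<forall>T>0. \<exists>M::real. AE t in lebesgue. 0 < t \<and> t < T \<longrightarrow>
        set_integrable lebesgue corridor (\<rho> t) \<and> BV_norm (\<rho> t) \<le> ereal M)"

definition well_separated :: "(real \<Rightarrow> real \<Rightarrow> real) \<Rightarrow> (real \<Rightarrow> real) \<Rightarrow> bool" where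
  "well_separated \<rho> \<xi> \<longleftrightarrow>
     (\<forall>\<sigma>\<in>{-1, 1}. \<exists>\<gamma>. strong_trace \<rho> \<xi> \<sigma> \<gamma> \<and> (AE t in lebesgue. 0 < t \<longrightarrow> \<gamma> t = 0))"

end

theory Submission
  imports Defs
begin

text \<open>
  Why the estimate holds: a well-separated solution carries no mass across its turning curve
  \<open>x = \<xi> t\<close>. The part of the density on the right of the curve, continued by zero, is therefore
  an ordinary Kruzhkov entropy solution of \<open>\<rho>\<^sub>t + f(\<rho>)\<^sub>x = 0\<close> in the whole corridor, and so is the
  reflection under \<open>x \<mapsto> -x\<close> of the part on the left. The nonlocal coupling through the curve has
  disappeared from the equations: it survives only in the way the initial datum is cut in two.

  Continuation by zero (\<open>kruzhkov_extend_by_zero\<close>, \<open>entropy_solution_outgoing\<close>). The test function is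
  cut off along the curve. The cut-off has gradient of order \<open>1/\<epsilon>\<close> on a strip of width of order \<open>\<epsilon>\<close>,
  and the zero trace says that the mean of the density on this strip tends to zero.

  Contraction (\<open>kruzhkov_doubling\<close>, \<open>outgoing_L1_contraction\<close>). Doubling of variables compares two
  continued parts. Near the wall behind them both vanish. At the exit the traces lie in \<open>[0, \<rho>\<^sub>c]\<close>,
  where the concave flux is nondecreasing, so that \<open>\<bar>\<rho>\<^sub>1 - \<rho>\<^sub>2\<bar>\<close> can only leave the corridor. Hence the
  \<open>L\<^sup>1\<close> distance of the two right parts does not increase in time, and likewise for the left parts.

  Initial time (\<open>side_difference\<close>, \<open>turning_point_stability\<close>). Cutting two data at different turning
  points costs at most \<open>\<rho>\<^sub>m\<^sub>a\<^sub>x\<close> times the distance of these points. The difference of the costs on both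
  sides of a point grows with slope at least 2 when the point moves to the right, so its zero, the
  turning point, is a Lipschitz function of the cost parameter and of the datum. Adding up gives the
  constant \<open>2 + \<rho>\<^sub>m\<^sub>a\<^sub>x \<alpha> + 2 \<rho>\<^sub>m\<^sub>a\<^sub>x\<^sup>2\<close> with \<open>\<alpha>\<close> the larger parameter; equal data and parameters give uniqueness.

  Two devices keep the analysis elementary. Test functions that are \<open>C\<^sup>1\<close> suffice after one mollification
  (\<open>kruzhkov_on_smooth_tests\<close>), so cut-offs can be piecewise quadratic and follow time averages of a
  Lipschitz curve. And no boundary term is ever computed as a limit: a trace is used only through the
  mean of the excess of the density over a level on thin strips (\<open>vanishes_near\<close>), which bounds the
  error caused by a cut-off.
\<close>

section \<open>A smooth bump function on the line\<close>

text \<open>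
  Functions of one variable with an explicit chain of derivatives; products and dilations are then
  simple inductions, and \<open>C_k\<close> in the plane is reached through convolution with products of such
  functions.
\<close>

primrec k_times_differentiable :: "nat \<Rightarrow> (real \<Rightarrow> real) \<Rightarrow> bool" where
  "k_times_differentiable 0 g \<longleftrightarrow> continuous_on UNIV g"
| "k_times_differentiable (Suc k) g \<longleftrightarrow>
     (\<exists>g'. (\<forall>x. (g has_real_derivative g' x) (at x)) \<and> k_times_differentiable k g')"

lemma k_times_differentiable_continuous:
  "k_times_differentiable k g \<Longrightarrow> continuous_on UNIV g"
  by (cases k) (auto intro: DERIV_continuous_on has_field_derivative_at_within)

lemma k_times_differentiable_SucD:
  "k_times_differentiable (Suc k) g \<Longrightarrow> k_times_differentiable k g"
proof (induction k arbitrary: g)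
  case 0
  then show ?case using k_times_differentiable_continuous[OF 0] by simp
next
  case (Suc k)
  then obtain g' where "\<forall>x. (g has_real_derivative g' x) (at x)" "k_times_differentiable (Suc k) g'"
    by (auto simp only: k_times_differentiable.simps(2)[of "Suc k"])
  with Suc.IH show ?case by auto
qed

lemma k_times_differentiable_add:
  "k_times_differentiable k f \<Longrightarrow> k_times_differentiable k g \<Longrightarrow>
    k_times_differentiable k (\<lambda>x. f x + g x)"
proof (induction k arbitrary: f g)
  case 0
  then show ?case by (simp add: continuous_on_add continuous_on_mult)
next
  case (Suc k)
  then obtain f' g' where "\<forall>x. (f has_real_derivative f' x) (at x)" "k_times_differentiable k f'"
    "\<forall>x. (g has_real_derivative g' x) (at x)" "k_times_differentiable k g'"
    by auto
  then have "k_times_differentiable k (\<lambda>x. f' x + g' x)"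
    "\<forall>x. ((\<lambda>x. f x + g x) has_real_derivative f' x + g' x) (at x)"
    using Suc.IH[of f' g'] by (auto intro: DERIV_add)
  then show ?case unfolding k_times_differentiable.simps
    by (intro exI[of _ "\<lambda>x. f' x + g' x"] conjI)
qed

lemma k_times_differentiable_mult:
  "k_times_differentiable k f \<Longrightarrow> k_times_differentiable k g \<Longrightarrow>
    k_times_differentiable k (\<lambda>x. f x * g x)"
proof (induction k arbitrary: f g)
  case 0
  then show ?case by (simp add: continuous_on_add continuous_on_mult)
next
  case (Suc k)
  then obtain f' g' where d: "\<forall>x. (f has_real_derivative f' x) (at x)" "k_times_differentiable k f'"
    "\<forall>x. (g has_real_derivative g' x) (at x)" "k_times_differentiable k g'"
    by auto
  have "k_times_differentiable k (\<lambda>x. f' x * g x + f x * g' x)"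
    using d(2,4) Suc.prems[THEN k_times_differentiable_SucD] by (intro k_times_differentiable_add Suc.IH)
  moreover have "\<forall>x. ((\<lambda>x. f x * g x) has_real_derivative f' x * g x + f x * g' x) (at x)"
    using DERIV_mult[of f "f' x" x UNIV g "g' x" for x] d by (simp add: mult.commute)
  ultimately show ?case unfolding k_times_differentiable.simps
    by (intro exI[of _ "\<lambda>x. f' x * g x + f x * g' x"] conjI)
qed

lemma k_times_differentiable_const: "k_times_differentiable k (\<lambda>_. c)"
  by (induction k arbitrary: c) (auto intro!: exI[of _ "\<lambda>_. 0"])

lemma k_times_differentiable_affine:
  "k_times_differentiable k g \<Longrightarrow> k_times_differentiable k (\<lambda>x. g (a * x + b))"
proof (induction k arbitrary: g)
  case 0
  then show ?case
    by (auto intro!: continuous_intros continuous_on_compose2[of UNIV g])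
next
  case (Suc k)
  then obtain g' where d: "\<forall>x. (g has_real_derivative g' x) (at x)" "k_times_differentiable k g'"
    by auto
  have "\<forall>x. ((\<lambda>x. g (a * x + b)) has_real_derivative g' (a * x + b) * a) (at x)"
  proof
    fix x
    have "((\<lambda>x. a * x + b) has_real_derivative a) (at x)" by (auto intro!: derivative_eq_intros)
    then show "((\<lambda>x. g (a * x + b)) has_real_derivative g' (a * x + b) * a) (at x)"
      using DERIV_chain2[of g "g' (a * x + b)" "\<lambda>x. a * x + b" x a UNIV] d(1) by simp
  qed
  then show ?case using k_times_differentiable_mult[OF Suc.IH[OF d(2)] k_times_differentiable_const[of k a]]
    unfolding k_times_differentiable.simps by (intro exI[of _ "\<lambda>x. g' (a * x + b) * a"] conjI)
qed

text \<open>
  The factor \<open>1 / x ^ n\<close> makes the family closed under differentiation up to linear combinations,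
  so that smoothness of \<open>exp (- 1 / x)\<close> at the origin needs only one limit for each \<open>n\<close>.
\<close>

definition flat_exp :: "nat \<Rightarrow> real \<Rightarrow> real" where
  "flat_exp n x = (if x \<le> 0 then 0 else exp (- (1 / x)) / x ^ n)"

lemma flat_exp_tendsto_0: "(flat_exp n \<longlongrightarrow> 0) (at 0)"
proof -
  have "((\<lambda>x. x ^ n / exp x) \<longlongrightarrow> (0::real)) at_top"
    by (rule tendsto_power_div_exp_0)
  then have "((\<lambda>x. inverse x ^ n / exp (inverse x)) \<longlongrightarrow> (0::real)) (at_right 0)"
    by (rule filterlim_compose[OF _ filterlim_inverse_at_top_right])
  then have r: "(flat_exp n \<longlongrightarrow> 0) (at_right 0)"
  proof (rule Lim_transform_eventually)
    show "\<forall>\<^sub>F x in at_right 0. inverse x ^ n / exp (inverse x) = flat_exp n x"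
      unfolding eventually_at_right_field
      by (intro exI[of _ 1]) (auto simp: flat_exp_def exp_minus field_simps)
  qed
  have l: "(flat_exp n \<longlongrightarrow> 0) (at_left 0)"
  proof (rule Lim_transform_eventually)
    show "\<forall>\<^sub>F x in at_left (0::real). 0 = flat_exp n x"
      unfolding eventually_at_left_field
      by (intro exI[of _ "-1"]) (auto simp: flat_exp_def)
  qed simp
  show ?thesis using l r by (simp add: filterlim_split_at)
qed

lemma flat_exp_has_derivative:
  "(flat_exp n has_real_derivative flat_exp (n + 2) x - real n * flat_exp (n + 1) x) (at x)"
proof -
  consider "x < 0" | "x > 0" | "x = 0" by linarith
  then show ?thesis
  proof cases
    case 1
    have "((\<lambda>_. 0) has_real_derivative 0) (at x)" by simp
    then have "(flat_exp n has_real_derivative 0) (at x)"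
      by (rule DERIV_cong_ev[THEN iffD1, rotated -1])
        (use 1 in \<open>auto simp: flat_exp_def intro: eventually_mono[OF eventually_nhds_in_open[of "{..<0}" x]]\<close>)
    then show ?thesis using 1 by (simp add: flat_exp_def)
  next
    case 2
    have "((\<lambda>x. exp (- (1 / x)) / x ^ n) has_real_derivative
        flat_exp (n + 2) x - real n * flat_exp (n + 1) x) (at x)"
    proof -
      have "x * x ^ (n - Suc 0) = x ^ n" if "n > 0" using that by (cases n) auto
      then show ?thesis
        using 2 by (cases "n = 0")
          (auto intro!: derivative_eq_intros simp: flat_exp_def field_simps power2_eq_square)
    qed
    then show ?thesis
      by (rule DERIV_cong_ev[THEN iffD1, rotated -1])
        (use 2 in \<open>auto simp: flat_exp_def intro: eventually_mono[OF eventually_nhds_in_open[of "{0<..}" x]]\<close>)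
  next
    case 3
    have "((\<lambda>h. (flat_exp n (0 + h) - flat_exp n 0) / h) \<longlongrightarrow> 0) (at 0)"
      by (rule Lim_transform_eventually[OF flat_exp_tendsto_0[of "n + 1"]])
        (auto simp: flat_exp_def field_simps intro!: eventuallyI)
    then show ?thesis using 3 by (simp add: DERIV_def flat_exp_def)
  qed
qed

lemma k_times_differentiable_flat_exp: "k_times_differentiable k (flat_exp n)"
proof (induction k arbitrary: n)
  case 0
  show ?case using DERIV_isCont[OF flat_exp_has_derivative[of n]]
    by (simp add: continuous_at_imp_continuous_on)
next
  case (Suc k)
  have "k_times_differentiable k (\<lambda>x. flat_exp (n + 2) x + (- real n) * flat_exp (n + 1) x)"
    by (rule k_times_differentiable_add k_times_differentiable_mult Suc.IH k_times_differentiable_const)+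
  moreover have "(flat_exp n has_real_derivative flat_exp (n + 2) x + (- real n) * flat_exp (n + 1) x) (at x)" for x
    using flat_exp_has_derivative[of n x] by simp
  ultimately show ?case unfolding k_times_differentiable.simps
    by (intro exI[of _ "\<lambda>x. flat_exp (n + 2) x + (- real n) * flat_exp (n + 1) x"] conjI allI)
qed

lemma integrable_bounded_support:
  fixes f :: "'a::euclidean_space \<Rightarrow> real"
  assumes [measurable]: "f \<in> borel_measurable borel"
    and "bounded K" "\<And>p. p \<notin> K \<Longrightarrow> f p = 0" "\<And>p. \<bar>f p\<bar> \<le> B"
  shows "integrable lborel f"
proof -
  obtain a b where ab: "K \<subseteq> cbox a b" using bounded_subset_cbox_symmetric[OF assms(2)] by blast
  have "integrable lborel (\<lambda>p. indicator (cbox a b) p * B)"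
    by (intro integrable_mult_left integrable_real_indicator) (auto simp: emeasure_lborel_cbox_eq)
  then show ?thesis
  proof (rule Bochner_Integration.integrable_bound)
    show "AE x in lborel. norm (f x) \<le> norm (indicator (cbox a b) x * B)"
      using assms(3,4) ab by (intro AE_I2) (force split: split_indicator intro: order_trans[OF _ abs_ge_self])
  qed simp
qed

lemma integrable_indicator_bounded:
  assumes "g \<in> borel_measurable borel" "\<And>p. \<bar>g p\<bar> \<le> B" "S \<in> sets borel" "bounded S"
  shows "integrable lborel (\<lambda>p::'a::euclidean_space. indicator S p * (g p :: real))"
proof (rule integrable_bounded_support[of _ S "max B 0"])
  show "(\<lambda>p. indicator S p * g p) \<in> borel_measurable borel" using assms by measurable
  show "\<bar>indicator S p * g p\<bar> \<le> max B 0" for p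
    using assms(2)[of p] by (auto split: split_indicator)
qed (use assms in auto)

lemma smooth_unit_bump_exists:
  obtains J :: "real \<Rightarrow> real" where
    "\<And>k. k_times_differentiable k J" "\<And>x. 0 \<le> J x" "\<And>x. \<bar>x\<bar> \<ge> 1 \<Longrightarrow> J x = 0"
    "integral\<^sup>L lborel J = 1"
proof -
  define b where "b x = flat_exp 0 (1 * x + 1) * flat_exp 0 (- 1 * x + 1)" for x :: real
  have b0: "0 \<le> b x" for x by (auto simp: b_def flat_exp_def)
  have bs: "b x = 0" if "\<bar>x\<bar> \<ge> 1" for x using that by (auto simp: b_def flat_exp_def)
  have bp: "b x > 0" if "\<bar>x\<bar> < 1" for x using that by (auto simp: b_def flat_exp_def)
  have b1: "b x \<le> 1" for x
  proof -
    have "flat_exp 0 y \<le> 1" "flat_exp 0 y \<ge> 0" for y by (auto simp: flat_exp_def)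
    then show ?thesis unfolding b_def by (meson mult_le_one)
  qed
  have bk: "k_times_differentiable k b" for k
    unfolding b_def by (intro k_times_differentiable_mult k_times_differentiable_affine k_times_differentiable_flat_exp)
  have bc: "continuous_on UNIV b" using bk[of 0] by simp
  have bm: "b \<in> borel_measurable borel" using bc by (rule borel_measurable_continuous_onI)
  have bi: "integrable lborel b"
    by (rule integrable_bounded_support[OF bm, of "{-1..1}" 1]) (use b0 b1 bs in \<open>auto simp: abs_le_iff intro!: bs\<close>)
  have "integral\<^sup>L lborel b \<noteq> 0"
  proof
    assume "integral\<^sup>L lborel b = 0"
    then have ae: "AE x in lborel. b x = 0"
      using integral_nonneg_eq_0_iff_AE[OF bi] b0 by simp
    have "AE x in lborel. x \<notin> {-1<..<1::real}"
      by (rule AE_mp[OF ae]) (use bp in \<open>fastforce intro!: AE_I2 simp: abs_less_iff\<close>)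
    then have "{-1<..<1::real} \<in> null_sets lborel"
      by (subst AE_iff_null_sets) auto
    then show False by (simp add: null_sets_def)
  qed
  moreover have "0 \<le> integral\<^sup>L lborel b" using b0 by (simp add: integral_nonneg)
  ultimately have I: "integral\<^sup>L lborel b > 0" by linarith
  show thesis
  proof (rule that[of "\<lambda>x. (1 / integral\<^sup>L lborel b) * b x"])
    show "k_times_differentiable k (\<lambda>x. (1 / integral\<^sup>L lborel b) * b x)" for k
      by (intro k_times_differentiable_mult k_times_differentiable_const bk)
  qed (use I b0 bs in auto)
qed

section \<open>Continuously differentiable test functions in the plane\<close>

text \<open>
  Here \<open>\<phi>t\<close> and \<open>\<phi>x\<close> are the partial derivatives in time and space; carrying them along makes
  products of test functions and cut-offs explicit.
\<close>

definition C1_test ::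
  "(real \<times> real) set \<Rightarrow> (real \<times> real \<Rightarrow> real) \<Rightarrow> (real \<times> real \<Rightarrow> real) \<Rightarrow> (real \<times> real \<Rightarrow> real) \<Rightarrow> bool" where
  "C1_test U \<phi> \<phi>t \<phi>x \<longleftrightarrow>
     (\<forall>p. (\<phi> has_derivative (\<lambda>h. fst h * \<phi>t p + snd h * \<phi>x p)) (at p)) \<and>
     continuous_on UNIV \<phi>t \<and> continuous_on UNIV \<phi>x \<and>
     (\<exists>K. compact K \<and> K \<subseteq> U \<and> (\<forall>p. p \<notin> K \<longrightarrow> \<phi> p = 0))"

lemma C1_testD:
  assumes "C1_test U \<phi> \<phi>t \<phi>x"
  shows "(\<phi> has_derivative (\<lambda>h. fst h * \<phi>t p + snd h * \<phi>x p)) (at p)"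
    "continuous_on UNIV \<phi>" "continuous_on UNIV \<phi>t" "continuous_on UNIV \<phi>x"
    "\<phi> \<in> borel_measurable borel" "\<phi>t \<in> borel_measurable borel" "\<phi>x \<in> borel_measurable borel"
proof -
  show d: "(\<phi> has_derivative (\<lambda>h. fst h * \<phi>t p + snd h * \<phi>x p)) (at p)" for p
    using assms unfolding C1_test_def by blast
  show c: "continuous_on UNIV \<phi>"
    using has_derivative_continuous[OF d] by (simp add: continuous_at_imp_continuous_on)
  show ct: "continuous_on UNIV \<phi>t" "continuous_on UNIV \<phi>x" using assms by (auto simp: C1_test_def)
  show "\<phi> \<in> borel_measurable borel" "\<phi>t \<in> borel_measurable borel" "\<phi>x \<in> borel_measurable borel"
    using c ct by (auto intro: borel_measurable_continuous_onI)
qed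

lemma C1_test_support:
  assumes "C1_test U \<phi> \<phi>t \<phi>x"
  obtains K where "compact K" "K \<subseteq> U"
    "\<And>p. p \<notin> K \<Longrightarrow> \<phi> p = 0" "\<And>p. p \<notin> K \<Longrightarrow> \<phi>t p = 0" "\<And>p. p \<notin> K \<Longrightarrow> \<phi>x p = 0"
proof -
  obtain K where K: "compact K" "K \<subseteq> U" "\<And>p. p \<notin> K \<Longrightarrow> \<phi> p = 0"
    using assms by (auto simp: C1_test_def)
  have z: "(\<lambda>h. fst h * \<phi>t p + snd h * \<phi>x p) = (\<lambda>h. 0)" if "p \<notin> K" for p
  proof -
    have "open (- K)" using K(1) compact_imp_closed by blast
    then have "(\<phi> has_derivative (\<lambda>h. 0)) (at p)"
      using has_derivative_transform_within_open[OF has_derivative_const[of 0 "at p"], of "- K" \<phi>] that K(3)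
      by auto
    then show ?thesis using has_derivative_unique[OF C1_testD(1)[OF assms, of p]] by blast
  qed
  have "\<phi>t p = 0" "\<phi>x p = 0" if "p \<notin> K" for p
    using fun_cong[OF z[OF that], of "(1, 0)"] fun_cong[OF z[OF that], of "(0, 1)"] by auto
  with K show thesis using that by blast
qed

text \<open>
  In this form the witness can be eliminated without higher-order matching when \<open>\<phi>\<close> is composite.
\<close>

lemma C1_test_support_ex:
  assumes "C1_test U \<phi> \<phi>t \<phi>x"
  shows "\<exists>K. compact K \<and> K \<subseteq> U \<and> (\<forall>p. p \<notin> K \<longrightarrow> \<phi> p = 0 \<and> \<phi>t p = 0 \<and> \<phi>x p = 0)"
  by (rule C1_test_support[OF assms]) blast

lemma continuous_compact_support_bounded:
  fixes g :: "'a::metric_space \<Rightarrow> real"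
  assumes "continuous_on UNIV g" "compact K" "\<And>p. p \<notin> K \<Longrightarrow> g p = 0"
  obtains B where "B > 0" "\<And>p. \<bar>g p\<bar> \<le> B"
proof -
  have "bounded (g ` K)"
    using assms(1,2) compact_continuous_image[of K g] continuous_on_subset compact_imp_bounded by blast
  then obtain B where "B > 0" "\<forall>x\<in>g ` K. norm x \<le> B" by (auto simp: bounded_pos)
  then show thesis using that[of B] assms(3) by (metis abs_zero imageI less_imp_le real_norm_def)
qed

lemma continuous_compact_support_integrable:
  fixes g :: "'a::euclidean_space \<Rightarrow> real"
  assumes "continuous_on UNIV g" "compact K" "\<And>p. p \<notin> K \<Longrightarrow> g p = 0"
  shows "integrable lborel g"
proof -
  obtain B where "B > 0" "\<And>p. \<bar>g p\<bar> \<le> B"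
    using continuous_compact_support_bounded[OF assms] by blast
  then show ?thesis
    using assms by (intro integrable_bounded_support[of g K B])
      (auto intro: borel_measurable_continuous_onI compact_imp_bounded)
qed

lemma C1_test_bounded:
  assumes "C1_test U \<phi> \<phi>t \<phi>x"
  obtains B where "B > 0" "\<And>p. \<bar>\<phi> p\<bar> \<le> B" "\<And>p. \<bar>\<phi>t p\<bar> \<le> B" "\<And>p. \<bar>\<phi>x p\<bar> \<le> B"
proof -
  obtain K where K: "compact K" "K \<subseteq> U"
    "\<And>p. p \<notin> K \<Longrightarrow> \<phi> p = 0" "\<And>p. p \<notin> K \<Longrightarrow> \<phi>t p = 0" "\<And>p. p \<notin> K \<Longrightarrow> \<phi>x p = 0"
    using C1_test_support[OF assms] by blast
  obtain B1 where "B1 > 0" "\<And>p. \<bar>\<phi> p\<bar> \<le> B1"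
    using continuous_compact_support_bounded[of \<phi> K] C1_testD[OF assms] K by blast
  moreover obtain B2 where "B2 > 0" "\<And>p. \<bar>\<phi>t p\<bar> \<le> B2"
    using continuous_compact_support_bounded[of \<phi>t K] C1_testD[OF assms] K by blast
  moreover obtain B3 where "B3 > 0" "\<And>p. \<bar>\<phi>x p\<bar> \<le> B3"
    using continuous_compact_support_bounded[of \<phi>x K] C1_testD[OF assms] K by blast
  ultimately show thesis
    by (intro that[of "max B1 (max B2 B3)"]) (auto simp: le_max_iff_disj)
qed

lemma C1_test_integrable:
  assumes "C1_test U \<phi> \<phi>t \<phi>x"
  shows "integrable lborel \<phi>" "integrable lborel \<phi>t" "integrable lborel \<phi>x"
proof -
  obtain K where K: "compact K" "K \<subseteq> U"
    "\<And>p. p \<notin> K \<Longrightarrow> \<phi> p = 0" "\<And>p. p \<notin> K \<Longrightarrow> \<phi>t p = 0" "\<And>p. p \<notin> K \<Longrightarrow> \<phi>x p = 0"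
    using C1_test_support[OF assms] by blast
  show "integrable lborel \<phi>" "integrable lborel \<phi>t" "integrable lborel \<phi>x"
    using continuous_compact_support_integrable[OF _ K(1)] C1_testD[OF assms] K by blast+
qed

lemma C1_test_mult:
  assumes "C1_test V \<phi> \<phi>t \<phi>x"
    and d: "\<And>p. (g has_derivative (\<lambda>h. fst h * gt p + snd h * gx p)) (at p)"
    and c: "continuous_on UNIV gt" "continuous_on UNIV gx"
    and s: "compact K" "K \<subseteq> U" "\<And>p. p \<notin> K \<Longrightarrow> \<phi> p * g p = 0"
  shows "C1_test U (\<lambda>p. \<phi> p * g p) (\<lambda>p. \<phi>t p * g p + \<phi> p * gt p) (\<lambda>p. \<phi>x p * g p + \<phi> p * gx p)"
proof -
  note D = C1_testD[OF assms(1)]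
  have gc: "continuous_on UNIV g"
    using has_derivative_continuous[OF d] by (simp add: continuous_at_imp_continuous_on)
  have "((\<lambda>p. \<phi> p * g p) has_derivative
      (\<lambda>h. \<phi> p * (fst h * gt p + snd h * gx p) + (fst h * \<phi>t p + snd h * \<phi>x p) * g p)) (at p)" for p
    by (rule has_derivative_mult[OF D(1) d])
  moreover have "(\<lambda>h. \<phi> p * (fst h * gt p + snd h * gx p) + (fst h * \<phi>t p + snd h * \<phi>x p) * g p) =
     (\<lambda>h. fst h * (\<phi>t p * g p + \<phi> p * gt p) + snd h * (\<phi>x p * g p + \<phi> p * gx p))" for p
    by (auto simp: algebra_simps)
  ultimately show ?thesis
    using D gc c s unfolding C1_test_def by (auto intro!: continuous_intros)
qed

lemma lborel_fubini:
  fixes f :: "'a::euclidean_space \<times> 'b::euclidean_space \<Rightarrow> real"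
  assumes "integrable lborel f"
  shows "integral\<^sup>L lborel f = (LINT x|lborel. LINT y|lborel. f (x, y))"
    "integral\<^sup>L lborel f = (LINT y|lborel. LINT x|lborel. f (x, y))"
    "integrable lborel (\<lambda>x. LINT y|lborel. f (x, y))"
    "integrable lborel (\<lambda>y. LINT x|lborel. f (x, y))"
proof -
  have i: "integrable (lborel \<Otimes>\<^sub>M lborel) f" using assms by (simp add: lborel_prod)
  then have i': "integrable (lborel \<Otimes>\<^sub>M lborel) (\<lambda>(x, y). f (x, y))" by simp
  show "integral\<^sup>L lborel f = (LINT x|lborel. LINT y|lborel. f (x, y))"
    using lborel_pair.integral_fst'[OF i] by (simp add: lborel_prod)
  show "integral\<^sup>L lborel f = (LINT y|lborel. LINT x|lborel. f (x, y))"
    using lborel_pair.integral_snd[OF i'] by (simp add: lborel_prod)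
  show "integrable lborel (\<lambda>x. LINT y|lborel. f (x, y))"
    using lborel_pair.integrable_fst'[OF i] by simp
  show "integrable lborel (\<lambda>y. LINT x|lborel. f (x, y))"
    using lborel_pair.integrable_snd[OF i'] by simp
qed

lemma has_derivative_pair_partial:
  assumes "(\<phi> has_derivative (\<lambda>h. fst h * a + snd h * b)) (at (t, x))"
  shows "((\<lambda>s. \<phi> (s, x)) has_real_derivative a) (at t)"
    and "((\<lambda>y. \<phi> (t, y)) has_real_derivative b) (at x)"
proof -
  have "((\<lambda>s. (s, x)) has_derivative (\<lambda>h. (h, 0))) (at t)" by (auto intro!: derivative_eq_intros)
  from has_derivative_compose[OF this, of \<phi>, OF assms]
  show "((\<lambda>s. \<phi> (s, x)) has_real_derivative a) (at t)"
    by (simp add: has_field_derivative_def mult_commute_abs)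
  have "((\<lambda>y. (t, y)) has_derivative (\<lambda>h. (0, h))) (at x)" by (auto intro!: derivative_eq_intros)
  from has_derivative_compose[OF this, of \<phi>, OF assms]
  show "((\<lambda>y. \<phi> (t, y)) has_real_derivative b) (at x)"
    by (simp add: has_field_derivative_def mult_commute_abs)
qed

lemma integral_derivative_compact_support:
  fixes G g :: "real \<Rightarrow> real"
  assumes "\<And>t. (G has_real_derivative g t) (at t)" "continuous_on UNIV g"
    and "\<And>t. \<bar>t\<bar> \<ge> a \<Longrightarrow> G t = 0" "\<And>t. \<bar>t\<bar> \<ge> a \<Longrightarrow> g t = 0" "0 \<le> a"
  shows "integral\<^sup>L lborel g = 0"
proof -
  have "(\<integral>t. g t * indicator {-a..a} t \<partial>lborel) = G a - G (- a)"
    using assms by (intro integral_FTC_Icc_real) (auto simp: continuous_on_eq_continuous_at)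
  moreover have "(\<lambda>t. g t * indicator {-a..a} t) = g"
  proof
    show "g t * indicator {-a..a} t = g t" for t
      using assms(4)[of t] by (cases "t \<in> {-a..a}") auto
  qed
  ultimately show ?thesis using assms(3,5) by simp
qed

text \<open>
  By Fubini's theorem and the fundamental theorem of calculus. This is the entropy equality of a
  constant state, and also the integration by parts that moves derivatives off a mollifier.
\<close>

lemma C1_test_integral_derivative:
  assumes "C1_test U \<phi> \<phi>t \<phi>x"
  shows "integral\<^sup>L lborel \<phi>t = 0" "integral\<^sup>L lborel \<phi>x = 0"
proof -
  obtain K where K: "compact K" "K \<subseteq> U"
    "\<And>p. p \<notin> K \<Longrightarrow> \<phi> p = 0" "\<And>p. p \<notin> K \<Longrightarrow> \<phi>t p = 0" "\<And>p. p \<notin> K \<Longrightarrow> \<phi>x p = 0"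
    using C1_test_support[OF assms] by blast
  note D = C1_testD[OF assms]
  obtain a where a: "a > 0" "\<And>p. p \<in> K \<Longrightarrow> norm p < a"
    using compact_imp_bounded[OF K(1)] bounded_pos_less by metis
  have out: "(t, x) \<notin> K" if "\<bar>t\<bar> \<ge> a \<or> \<bar>x\<bar> \<ge> a" for t x :: real
    using a(2)[of "(t, x)"] that norm_fst_le[of t x] norm_snd_le[of x t] by auto
  have it: "integrable (lborel \<Otimes>\<^sub>M lborel) \<phi>t" and ix: "integrable (lborel \<Otimes>\<^sub>M lborel) \<phi>x"
    using continuous_compact_support_integrable[of \<phi>t K] continuous_compact_support_integrable[of \<phi>x K] D K
    by (auto simp: lborel_prod)
  have "integral\<^sup>L lborel \<phi>t = (\<integral>x. (\<integral>t. \<phi>t (t, x) \<partial>lborel) \<partial>lborel)"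
    using lborel_pair.integral_snd[of "\<lambda>t x. \<phi>t (t, x)"] it by (simp add: lborel_prod)
  also have "\<dots> = 0"
  proof -
    have "(\<integral>t. \<phi>t (t, x) \<partial>lborel) = 0" for x
      by (rule integral_derivative_compact_support[OF has_derivative_pair_partial(1)[OF D(1)], of x a])
        (use a(1) out K D in \<open>auto intro!: continuous_intros continuous_on_compose2[of UNIV \<phi>t]\<close>)
    then show ?thesis by simp
  qed
  finally show "integral\<^sup>L lborel \<phi>t = 0" .
  have "integral\<^sup>L lborel \<phi>x = (\<integral>t. (\<integral>x. \<phi>x (t, x) \<partial>lborel) \<partial>lborel)"
    using lborel_pair.integral_fst'[of "\<phi>x"] ix by (simp add: lborel_prod)
  also have "\<dots> = 0"
  proof -
    have "(\<integral>x. \<phi>x (t, x) \<partial>lborel) = 0" for t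
      by (rule integral_derivative_compact_support[OF has_derivative_pair_partial(2)[OF D(1)], of t a])
        (use a(1) out K D in \<open>auto intro!: continuous_intros continuous_on_compose2[of UNIV \<phi>x]\<close>)
    then show ?thesis by simp
  qed
  finally show "integral\<^sup>L lborel \<phi>x = 0" .
qed

text \<open>
  Uniform continuity on a ball around the support suffices: of two points at distance below 1, either
  both lie in the ball or the function vanishes at both.
\<close>

lemma continuous_compact_support_uniform:
  fixes g :: "'a::euclidean_space \<Rightarrow> real"
  assumes "continuous_on UNIV g" "compact K" "\<And>p. p \<notin> K \<Longrightarrow> g p = 0" "e > 0"
  obtains d where "d > 0" "\<And>p q. dist p q < d \<Longrightarrow> \<bar>g p - g q\<bar> < e"
proof -
  obtain R where R: "R > 0" "\<And>p. p \<in> K \<Longrightarrow> norm p \<le> R"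
    using compact_imp_bounded[OF assms(2)] bounded_pos by metis
  have "uniformly_continuous_on (cball 0 (R + 1)) g"
    using assms(1) by (intro compact_uniformly_continuous) (auto intro: continuous_on_subset)
  then obtain d where d: "d > 0"
    "\<And>p q. p \<in> cball 0 (R + 1) \<Longrightarrow> q \<in> cball 0 (R + 1) \<Longrightarrow> dist q p < d \<Longrightarrow> dist (g q) (g p) < e"
    using assms(4) unfolding uniformly_continuous_on_def by metis
  show thesis
  proof (rule that[of "min d 1"])
    fix p q :: 'a assume pq: "dist p q < min d 1"
    show "\<bar>g p - g q\<bar> < e"
    proof (cases "p \<in> K \<or> q \<in> K")
      case True
      have "norm p \<le> norm q + dist p q" "norm q \<le> norm p + dist p q"
        by (metis dist_norm norm_triangle_sub norm_minus_commute)+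
      then have "p \<in> cball 0 (R + 1)" "q \<in> cball 0 (R + 1)" using True R pq by fastforce+
      with d(2)[of q p] pq show ?thesis by (simp add: dist_real_def)
    qed (use assms(3,4) in auto)
  qed (use d in auto)
qed

section \<open>Mollification of test functions\<close>

text \<open>
  The Leibniz rule with the derivative given by its two partial derivatives instead of a bounded
  linear function.
\<close>

lemma has_derivative_integral_parameter:
  fixes g gt gx :: "real \<times> real \<Rightarrow> real \<times> real \<Rightarrow> real"
  assumes d: "\<And>p q. ((\<lambda>p. g p q) has_derivative (\<lambda>h. fst h * gt p q + snd h * gx p q)) (at p)"
    and c: "continuous_on UNIV (\<lambda>(p, q). g p q)" "continuous_on UNIV (\<lambda>(p, q). gt p q)"
      "continuous_on UNIV (\<lambda>(p, q). gx p q)"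
  shows "((\<lambda>p. integral (cbox a b) (g p)) has_derivative
    (\<lambda>h. fst h * integral (cbox a b) (gt p) + snd h * integral (cbox a b) (gx p))) (at p)"
proof -
  define F :: "real \<times> real \<Rightarrow> real \<times> real \<Rightarrow> (real \<times> real) \<Rightarrow>\<^sub>L real"
    where "F p q = gt p q *\<^sub>R Blinfun fst + gx p q *\<^sub>R Blinfun snd" for p q
  have bf: "blinfun_apply (Blinfun fst :: (real \<times> real) \<Rightarrow>\<^sub>L real) h = fst h"
    "blinfun_apply (Blinfun snd :: (real \<times> real) \<Rightarrow>\<^sub>L real) h = snd h" for h
    by (simp_all add: bounded_linear_Blinfun_apply bounded_linear_fst bounded_linear_snd)
  have Fa: "blinfun_apply (F p q) h = fst h * gt p q + snd h * gx p q" for p q h :: "real \<times> real"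
    by (simp add: F_def blinfun.add_left blinfun.scaleR_left bf)
  have sec: "continuous_on S (f p)" if "continuous_on UNIV (\<lambda>(p, q). f p q)" for f :: "real \<times> real \<Rightarrow> real \<times> real \<Rightarrow> real" and p S
  proof -
    have "continuous_on S (Pair p)" by (rule continuous_on_Pair[OF continuous_on_const continuous_on_id])
    then show ?thesis using continuous_on_compose2[OF that, of S "Pair p"] by simp
  qed
  have cF: "continuous_on UNIV (\<lambda>(p, q). F p q)"
    unfolding F_def split_beta using c[unfolded split_beta] by (intro continuous_intros)
  have iF: "F p integrable_on cbox a b" for p
    unfolding F_def using sec[OF c(2)] sec[OF c(3)] by (intro integrable_continuous continuous_intros)
  have "((\<lambda>p. integral (cbox a b) (g p)) has_derivative blinfun_apply (integral (cbox a b) (F p))) (at p within UNIV)"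
  proof (rule leibniz_rule)
    show "((\<lambda>x. g x t) has_derivative blinfun_apply (F x t)) (at x within UNIV)" for x t
      using d[of t x] by (simp add: Fa[abs_def])
    show "g x integrable_on cbox a b" for x using sec[OF c(1)] by (intro integrable_continuous)
    show "continuous_on (UNIV \<times> cbox a b) (\<lambda>(x, t). F x t)"
      using cF by (rule continuous_on_subset) auto
  qed auto
  moreover have "blinfun_apply (integral (cbox a b) (F p)) h =
      fst h * integral (cbox a b) (gt p) + snd h * integral (cbox a b) (gx p)" for h
  proof -
    have "blinfun_apply (integral (cbox a b) (F p)) h = integral (cbox a b) (\<lambda>q. blinfun_apply (F p q) h)"
      using integral_linear[OF iF, of "\<lambda>f. blinfun_apply f h"]
      by (simp add: blinfun.bounded_linear_left o_def)
    also have "\<dots> = fst h * integral (cbox a b) (gt p) + snd h * integral (cbox a b) (gx p)"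
      unfolding Fa using sec[OF c(2), of "cbox a b" p] sec[OF c(3), of "cbox a b" p]
      by (subst integral_add) (auto intro!: integrable_continuous continuous_intros)
    finally show ?thesis .
  qed
  ultimately show ?thesis by (rule has_derivative_eq_rhs[OF _ ext])
qed

definition product_kernel :: "(real \<Rightarrow> real) \<Rightarrow> (real \<Rightarrow> real) \<Rightarrow> real \<times> real \<Rightarrow> real \<times> real \<Rightarrow> real" where
  "product_kernel a b p q = a (fst p - fst q) * b (snd p - snd q)"

lemma product_kernel_continuous:
  assumes "continuous_on UNIV a" "continuous_on UNIV b" "continuous_on S f" "continuous_on S g"
  shows "continuous_on S (\<lambda>x. product_kernel a b (f x) (g x))"
  unfolding product_kernel_def
  by (intro continuous_intros continuous_on_compose2[OF assms(1)] continuous_on_compose2[OF assms(2)] assms(3,4)) auto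

lemma product_kernel_has_derivative:
  assumes a: "\<And>x. (a has_real_derivative a' x) (at x)" and b: "\<And>x. (b has_real_derivative b' x) (at x)"
  shows "((\<lambda>p. product_kernel a b p q) has_derivative
      (\<lambda>h. fst h * product_kernel a' b p q + snd h * product_kernel a b' p q)) (at p)"
    "((\<lambda>q. product_kernel a b p q) has_derivative
      (\<lambda>h. fst h * (- product_kernel a' b p q) + snd h * (- product_kernel a b' p q))) (at q)"
proof -
  have 1: "((\<lambda>p. a (fst p - fst q)) has_derivative (\<lambda>h. a' (fst p - fst q) * fst h)) (at p)"
    by (rule has_derivative_compose[of "\<lambda>p. fst p - fst q" fst p UNIV a "\<lambda>h. a' (fst p - fst q) * h"])
      (use a in \<open>auto intro!: derivative_eq_intros simp: has_field_derivative_def\<close>)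
  have 2: "((\<lambda>p. b (snd p - snd q)) has_derivative (\<lambda>h. b' (snd p - snd q) * snd h)) (at p)"
    by (rule has_derivative_compose[of "\<lambda>p. snd p - snd q" snd p UNIV b "\<lambda>h. b' (snd p - snd q) * h"])
      (use b in \<open>auto intro!: derivative_eq_intros simp: has_field_derivative_def\<close>)
  show "((\<lambda>p. product_kernel a b p q) has_derivative
      (\<lambda>h. fst h * product_kernel a' b p q + snd h * product_kernel a b' p q)) (at p)"
    unfolding product_kernel_def
    by (rule has_derivative_eq_rhs[OF has_derivative_mult[OF 1 2]]) (auto simp: algebra_simps)
  have 1: "((\<lambda>q. a (fst p - fst q)) has_derivative (\<lambda>h. a' (fst p - fst q) * (- fst h))) (at q)"
    by (rule has_derivative_compose[of "\<lambda>q. fst p - fst q" "\<lambda>h. - fst h" q UNIV a "\<lambda>h. a' (fst p - fst q) * h"])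
      (use a in \<open>auto intro!: derivative_eq_intros simp: has_field_derivative_def\<close>)
  have 2: "((\<lambda>q. b (snd p - snd q)) has_derivative (\<lambda>h. b' (snd p - snd q) * (- snd h))) (at q)"
    by (rule has_derivative_compose[of "\<lambda>q. snd p - snd q" "\<lambda>h. - snd h" q UNIV b "\<lambda>h. b' (snd p - snd q) * h"])
      (use b in \<open>auto intro!: derivative_eq_intros simp: has_field_derivative_def\<close>)
  show "((\<lambda>q. product_kernel a b p q) has_derivative
      (\<lambda>h. fst h * (- product_kernel a' b p q) + snd h * (- product_kernel a b' p q))) (at q)"
    unfolding product_kernel_def
    by (rule has_derivative_eq_rhs[OF has_derivative_mult[OF 1 2]]) (auto simp: algebra_simps)
qed

definition convolve :: "(real \<Rightarrow> real) \<Rightarrow> (real \<Rightarrow> real) \<Rightarrow> (real \<times> real \<Rightarrow> real) \<Rightarrow> real \<times> real \<Rightarrow> real" where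
  "convolve a b \<phi> p = (LINT q|lborel. \<phi> q * product_kernel a b p q)"

lemma convolve_eq_integral:
  assumes "continuous_on UNIV \<phi>" "\<And>p. p \<notin> cbox c d \<Longrightarrow> \<phi> p = 0"
    "continuous_on UNIV a" "continuous_on UNIV b"
  shows "convolve a b \<phi> p = integral (cbox c d) (\<lambda>q. \<phi> q * product_kernel a b p q)"
proof -
  let ?g = "\<lambda>q. \<phi> q * product_kernel a b p q"
  have c: "continuous_on UNIV ?g"
    by (intro continuous_on_mult product_kernel_continuous assms continuous_on_const continuous_on_id)
  have "integrable lborel ?g"
    using assms(2) by (intro continuous_compact_support_integrable[OF c, of "cbox c d"]) auto
  then have "convolve a b \<phi> p = integral UNIV ?g"
    unfolding convolve_def by (simp add: integral_lborel)
  also have "\<dots> = integral UNIV (\<lambda>q. if q \<in> cbox c d then ?g q else 0)"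
    using assms(2) by (intro Henstock_Kurzweil_Integration.integral_cong) auto
  also have "\<dots> = integral (cbox c d) ?g" by (rule integral_restrict_UNIV)
  finally show ?thesis .
qed

lemma convolve_has_derivative:
  assumes \<phi>: "continuous_on UNIV \<phi>" "compact K" "\<And>p. p \<notin> K \<Longrightarrow> \<phi> p = 0"
    and a: "\<And>x. (a has_real_derivative a' x) (at x)" "continuous_on UNIV a'"
    and b: "\<And>x. (b has_real_derivative b' x) (at x)" "continuous_on UNIV b'"
  shows "(convolve a b \<phi> has_derivative
    (\<lambda>h. fst h * convolve a' b \<phi> p + snd h * convolve a b' \<phi> p)) (at p)"
proof -
  obtain c d where "K \<subseteq> cbox c d"
    using bounded_subset_cbox_symmetric[OF compact_imp_bounded[OF \<phi>(2)]] by blast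
  then have s: "\<And>p. p \<notin> cbox c d \<Longrightarrow> \<phi> p = 0" using \<phi>(3) by blast
  have ca: "continuous_on UNIV a" and cb: "continuous_on UNIV b"
    using DERIV_isCont[OF a(1)] DERIV_isCont[OF b(1)] by (auto simp: continuous_at_imp_continuous_on)
  define g where "g f1 f2 p q = \<phi> q * product_kernel f1 f2 p q"
    for f1 f2 :: "real \<Rightarrow> real" and p q :: "real \<times> real"
  have cg: "continuous_on UNIV (\<lambda>(p, q). g f1 f2 p q)" if "continuous_on UNIV f1" "continuous_on UNIV f2" for f1 f2
    unfolding g_def split_beta using that
    by (intro continuous_on_mult product_kernel_continuous continuous_on_compose2[OF \<phi>(1)] continuous_intros) auto
  have dg: "((\<lambda>p. g a b p q) has_derivative (\<lambda>h. fst h * g a' b p q + snd h * g a b' p q)) (at p)" for p q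
    unfolding g_def
    by (rule has_derivative_eq_rhs[OF has_derivative_mult_right[OF product_kernel_has_derivative(1)[OF a(1) b(1)]]])
      (auto simp: algebra_simps)
  have eq: "convolve f1 f2 \<phi> p = integral (cbox c d) (g f1 f2 p)"
    if "continuous_on UNIV f1" "continuous_on UNIV f2" for f1 f2 p
    unfolding g_def using convolve_eq_integral[OF \<phi>(1) s that] .
  have "convolve a b \<phi> = (\<lambda>p. integral (cbox c d) (g a b p))" using eq[OF ca cb] by auto
  then show ?thesis
    using has_derivative_integral_parameter[OF dg cg[OF ca cb] cg[OF a(2) cb] cg[OF ca b(2)], of c d p]
      eq[OF a(2) cb] eq[OF ca b(2)] by simp
qed

lemma convolve_continuous:
  assumes \<phi>: "continuous_on UNIV \<phi>" "compact K" "\<And>p. p \<notin> K \<Longrightarrow> \<phi> p = 0"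
    and ab: "continuous_on UNIV a" "continuous_on UNIV b"
  shows "continuous_on UNIV (convolve a b \<phi>)"
proof -
  obtain c d where "K \<subseteq> cbox c d"
    using bounded_subset_cbox_symmetric[OF compact_imp_bounded[OF \<phi>(2)]] by blast
  then have s: "\<And>p. p \<notin> cbox c d \<Longrightarrow> \<phi> p = 0" using \<phi>(3) by blast
  have "continuous_on (UNIV \<times> cbox c d) (\<lambda>x. \<phi> (snd x) * product_kernel a b (fst x) (snd x))"
    by (intro continuous_on_mult product_kernel_continuous ab continuous_on_compose2[OF \<phi>(1)] continuous_intros) auto
  then have "continuous_on UNIV (\<lambda>p. integral (cbox c d) (\<lambda>q. \<phi> q * product_kernel a b p q))"
    by (intro integral_continuous_on_param) (simp add: split_beta)
  moreover have "convolve a b \<phi> = (\<lambda>p. integral (cbox c d) (\<lambda>q. \<phi> q * product_kernel a b p q))"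
    by (rule ext, rule convolve_eq_integral[OF \<phi>(1) s ab])
  ultimately show ?thesis by simp
qed

text \<open>
  Derivatives fall on the kernels alone, so the induction varies \<open>a\<close> and \<open>b\<close> with \<open>\<phi>\<close> fixed.
\<close>

lemma C_k_convolve:
  assumes \<phi>: "continuous_on UNIV \<phi>" "compact K" "\<And>p. p \<notin> K \<Longrightarrow> \<phi> p = 0"
  shows "k_times_differentiable k a \<Longrightarrow> k_times_differentiable k b \<Longrightarrow> C_k k (convolve a b \<phi>)"
proof (induction k arbitrary: a b)
  case 0
  then show ?case using convolve_continuous[OF \<phi>] by simp
next
  case (Suc k)
  obtain a' where a': "\<And>x. (a has_real_derivative a' x) (at x)" "k_times_differentiable k a'"
    using Suc.prems(1) by auto
  obtain b' where b': "\<And>x. (b has_real_derivative b' x) (at x)" "k_times_differentiable k b'"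
    using Suc.prems(2) by auto
  note d = convolve_has_derivative[OF \<phi> a'(1) k_times_differentiable_continuous[OF a'(2)]
      b'(1) k_times_differentiable_continuous[OF b'(2)]]
  have fd: "frechet_derivative (convolve a b \<phi>) (at p) =
      (\<lambda>h. fst h * convolve a' b \<phi> p + snd h * convolve a b' \<phi> p)" for p
    using frechet_derivative_at[OF d] by simp
  have "convolve a b \<phi> differentiable_on UNIV"
    using d by (auto simp: differentiable_on_def differentiable_def)
  moreover have "C_k k (convolve a' b \<phi>)" "C_k k (convolve a b' \<phi>)"
    using Suc.IH a'(2) b'(2) Suc.prems[THEN k_times_differentiable_SucD] by blast+
  ultimately show ?case
    by (auto simp: fd Basis_prod_def)
qed

definition mollifier :: "real \<Rightarrow> (real \<Rightarrow> real) \<Rightarrow> (real \<Rightarrow> real) \<Rightarrow> bool" where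
  "mollifier h j j' \<longleftrightarrow>
     (\<forall>k. k_times_differentiable k j) \<and> (\<forall>x. (j has_real_derivative j' x) (at x)) \<and>
     continuous_on UNIV j' \<and> (\<forall>x. 0 \<le> j x) \<and> (\<forall>x. \<bar>x\<bar> \<ge> h \<longrightarrow> j x = 0) \<and> integrable lborel j \<and>
     (\<forall>x. (LINT y|lborel. j (x - y)) = 1) \<and> (\<forall>y. (LINT x|lborel. j (x - y)) = 1)"

lemma mollifier_exists:
  assumes "h > 0"
  shows "\<exists>j j'. mollifier h j j'"
proof -
  obtain J :: "real \<Rightarrow> real" where J: "\<And>k. k_times_differentiable k J" "\<And>x. 0 \<le> J x"
    "\<And>x. \<bar>x\<bar> \<ge> 1 \<Longrightarrow> J x = 0" "integral\<^sup>L lborel J = 1"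
    using smooth_unit_bump_exists by blast
  \<comment> \<open>The normalisation keeps the integral of the unit bump under dilation by \<open>h\<close>.\<close>
  define j where "j x = (1 / h) * J ((1 / h) * x + 0)" for x
  have k: "k_times_differentiable k j" for k
    unfolding j_def by (intro k_times_differentiable_mult k_times_differentiable_const k_times_differentiable_affine J)
  obtain j' where j': "\<And>x. (j has_real_derivative j' x) (at x)" "continuous_on UNIV j'"
    using k[of "Suc 0"] by auto
  have s: "j x = 0" if "\<bar>x\<bar> \<ge> h" for x
  proof -
    have "\<bar>(1 / h) * x + 0\<bar> \<ge> 1" using that assms by (simp add: abs_mult field_simps)
    then show ?thesis using J(3) by (simp add: j_def)
  qed
  have i: "integrable lborel j"
  proof (rule continuous_compact_support_integrable[of j "{-h..h}"])
    show "j x = 0" if "x \<notin> {-h..h}" for x using that by (intro s) auto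
  qed (use k[of 0] in auto)
  have "(LINT y|lborel. j (x - y)) = 1" for x
  proof -
    have "integral\<^sup>L lborel J = \<bar>- (1 / h)\<bar> *\<^sub>R (LINT y|lborel. J (x / h + (- (1 / h)) * y))"
      using assms by (intro lborel_integral_real_affine) auto
    also have "\<dots> = (LINT y|lborel. j (x - y))"
      using assms by (simp add: j_def diff_divide_distrib)
    finally show ?thesis using J(4) by simp
  qed
  moreover have "(LINT x|lborel. j (x - y)) = 1" for y
  proof -
    have "integral\<^sup>L lborel J = \<bar>1 / h\<bar> *\<^sub>R (LINT x|lborel. J (- (y / h) + (1 / h) * x))"
      using assms by (intro lborel_integral_real_affine) auto
    also have "\<dots> = (LINT x|lborel. j (x - y))"
      using assms by (simp add: j_def diff_divide_distrib)
    finally show ?thesis using J(4) by simp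
  qed
  moreover have "0 \<le> j x" for x using J(2) assms by (simp add: j_def)
  ultimately show ?thesis unfolding mollifier_def using k j' s i by blast
qed

lemma mollifierD:
  assumes "mollifier h j j'"
  shows "\<And>k. k_times_differentiable k j" "\<And>x. (j has_real_derivative j' x) (at x)"
    "continuous_on UNIV j" "continuous_on UNIV j'" "\<And>x. 0 \<le> j x" "\<And>x. \<bar>x\<bar> \<ge> h \<Longrightarrow> j x = 0" "integrable lborel j"
    "\<And>x. (LINT y|lborel. j (x - y)) = 1" "\<And>y. (LINT x|lborel. j (x - y)) = 1"
  using assms k_times_differentiable_continuous[of 0 j] by (auto simp: mollifier_def)

lemma mollifier_derivative_support:
  assumes "mollifier h j j'" "\<bar>x\<bar> > h"
  shows "j' x = 0"
proof -
  have o: "open {x::real. h < \<bar>x\<bar>}" by (intro open_Collect_less continuous_intros)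
  have "(j has_real_derivative 0) (at x)"
    by (rule has_field_derivative_transform_within_open[OF DERIV_const[of 0] o])
      (use assms in \<open>auto simp: mollifier_def\<close>)
  then show ?thesis using mollifierD(2)[OF assms(1)] DERIV_unique by blast
qed

lemma mollifier_kernel_integral:
  assumes m: "mollifier h j j'"
  shows "integrable lborel (\<lambda>q. product_kernel j j p q)"
    "(LINT q|lborel. product_kernel j j p q) = 1" "(LINT p|lborel. product_kernel j j p q) = 1"
proof -
  note D = mollifierD[OF m]
  have far: "product_kernel j j p q = 0" if "\<bar>fst p - fst q\<bar> \<ge> h \<or> \<bar>snd p - snd q\<bar> \<ge> h" for p q
    using that D(6) by (auto simp: product_kernel_def)
  let ?Q = "\<lambda>p::real \<times> real. cbox (fst p - h, snd p - h) (fst p + h, snd p + h)"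
  have out: "\<bar>fst p - fst q\<bar> \<ge> h \<or> \<bar>snd p - snd q\<bar> \<ge> h" if "q \<notin> ?Q p" for p q
    using that by (cases q) (auto simp: cbox_Pair_eq)
  have c: "continuous_on UNIV (\<lambda>q. product_kernel j j p q)" "continuous_on UNIV (\<lambda>p. product_kernel j j p q)" for p q
    by (intro product_kernel_continuous D continuous_on_const continuous_on_id)+
  show i: "integrable lborel (\<lambda>q. product_kernel j j p q)" for p
    using far out by (intro continuous_compact_support_integrable[OF c(1), of "?Q p"]) auto
  have i': "integrable lborel (\<lambda>p. product_kernel j j p q)" for q
    using far[of _ q] out[of _ q] by (intro continuous_compact_support_integrable[OF c(2), of "?Q q"]) (auto simp: abs_minus_commute)
  show "(LINT q|lborel. product_kernel j j p q) = 1"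
    unfolding lborel_fubini(1)[OF i] by (simp add: product_kernel_def D(8))
  show "(LINT p|lborel. product_kernel j j p q) = 1"
    unfolding lborel_fubini(1)[OF i'] by (simp add: product_kernel_def D(9))
qed

lemma convolve_approximates:
  assumes \<phi>: "continuous_on UNIV \<phi>" "compact K" "\<And>p. p \<notin> K \<Longrightarrow> \<phi> p = 0" and m: "mollifier h j j'"
    and e: "\<And>q. \<bar>fst p - fst q\<bar> < h \<Longrightarrow> \<bar>snd p - snd q\<bar> < h \<Longrightarrow> \<bar>\<phi> q - \<phi> p\<bar> \<le> e"
  shows "\<bar>convolve j j \<phi> p - \<phi> p\<bar> \<le> e"
proof -
  let ?g = "product_kernel j j p"
  note P = mollifier_kernel_integral(1,2)[OF m, of p] and D = mollifierD[OF m]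
  have c: "continuous_on UNIV (\<lambda>q. \<phi> q * ?g q)"
    by (intro continuous_on_mult product_kernel_continuous \<phi>(1) D continuous_on_const continuous_on_id)
  have i: "integrable lborel (\<lambda>q. \<phi> q * ?g q)"
    using \<phi>(3) by (intro continuous_compact_support_integrable[OF c \<phi>(2)]) auto
  have i2: "integrable lborel (\<lambda>q. (\<phi> q - \<phi> p) * ?g q)"
    using Bochner_Integration.integrable_diff[OF i integrable_mult_right[OF P(1), of "\<phi> p"]] by (simp add: left_diff_distrib)
  have "convolve j j \<phi> p - \<phi> p = (LINT q|lborel. \<phi> q * ?g q) - (LINT q|lborel. \<phi> p * ?g q)"
    using P by (simp add: convolve_def)
  also have "\<dots> = (LINT q|lborel. (\<phi> q - \<phi> p) * ?g q)"
    using P i by (subst Bochner_Integration.integral_diff[symmetric]) (auto simp: algebra_simps)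
  finally have "\<bar>convolve j j \<phi> p - \<phi> p\<bar> \<le> (LINT q|lborel. \<bar>(\<phi> q - \<phi> p) * ?g q\<bar>)"
    by (simp add: integral_abs_bound)
  also have "\<dots> \<le> (LINT q|lborel. e * ?g q)"
  proof (rule integral_mono[OF integrable_abs[OF i2] integrable_mult_right[OF P(1)]])
    fix q
    show "\<bar>(\<phi> q - \<phi> p) * ?g q\<bar> \<le> e * ?g q"
    proof (cases "\<bar>fst p - fst q\<bar> < h \<and> \<bar>snd p - snd q\<bar> < h")
      case True
      then show ?thesis using e[of q] D(5) by (auto simp: abs_mult product_kernel_def intro!: mult_right_mono mult_nonneg_nonneg)
    next
      case False
      then have "?g q = 0" using D(6) by (auto simp: not_less product_kernel_def)
      then show ?thesis by simp
    qed
  qed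
  also have "\<dots> = e" using P by simp
  finally show ?thesis .
qed

text \<open>
  Integration by parts. It is what makes the derivatives of a mollified test function converge
  uniformly: they are the mollified derivatives.
\<close>

lemma convolve_derivative_shift:
  assumes \<phi>: "C1_test U \<phi> \<phi>t \<phi>x"
    and j: "\<And>x. (j has_real_derivative j' x) (at x)" "continuous_on UNIV j'"
  shows "convolve j' j \<phi> p = convolve j j \<phi>t p" "convolve j j' \<phi> p = convolve j j \<phi>x p"
proof -
  obtain K where K: "compact K" "K \<subseteq> U"
    "\<And>p. p \<notin> K \<Longrightarrow> \<phi> p = 0" "\<And>p. p \<notin> K \<Longrightarrow> \<phi>t p = 0" "\<And>p. p \<notin> K \<Longrightarrow> \<phi>x p = 0"
    using C1_test_support[OF \<phi>] by blast
  note D = C1_testD[OF \<phi>]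
  have cj: "continuous_on UNIV j"
    using DERIV_isCont[OF j(1)] by (auto simp: continuous_at_imp_continuous_on)
  let ?g = "\<lambda>f1 f2. product_kernel f1 f2 p"
  have cg: "continuous_on UNIV (?g f1 f2)" if "continuous_on UNIV f1" "continuous_on UNIV f2" for f1 f2
    by (intro product_kernel_continuous that continuous_on_const continuous_on_id)
  have T: "C1_test U (\<lambda>q. \<phi> q * ?g j j q) (\<lambda>q. \<phi>t q * ?g j j q + \<phi> q * (- ?g j' j q))
      (\<lambda>q. \<phi>x q * ?g j j q + \<phi> q * (- ?g j j' q))"
    by (rule C1_test_mult[OF \<phi> product_kernel_has_derivative(2)[OF j(1) j(1)] _ _ K(1,2)])
      (use K(3) in \<open>auto intro!: continuous_on_minus cg j(2) cj\<close>)
  have i: "integrable lborel (\<lambda>q. \<psi> q * ?g f1 f2 q)"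
    if "continuous_on UNIV f1" "continuous_on UNIV f2" "continuous_on UNIV \<psi>" "\<And>p. p \<notin> K \<Longrightarrow> \<psi> p = 0"
    for f1 f2 :: "real \<Rightarrow> real" and \<psi> :: "real \<times> real \<Rightarrow> real"
    using continuous_on_mult[OF that(3) cg[OF that(1,2)]] that(4)
    by (intro continuous_compact_support_integrable[OF _ K(1)]) auto
  have "0 = (LINT q|lborel. \<phi>t q * ?g j j q - \<phi> q * ?g j' j q)"
    using C1_test_integral_derivative(1)[OF T] by simp
  also have "\<dots> = convolve j j \<phi>t p - convolve j' j \<phi> p"
    unfolding convolve_def by (intro Bochner_Integration.integral_diff i cj j(2) D K)
  finally show "convolve j' j \<phi> p = convolve j j \<phi>t p" by simp
  have "0 = (LINT q|lborel. \<phi>x q * ?g j j q - \<phi> q * ?g j j' q)"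
    using C1_test_integral_derivative(2)[OF T] by simp
  also have "\<dots> = convolve j j \<phi>x p - convolve j j' \<phi> p"
    unfolding convolve_def by (intro Bochner_Integration.integral_diff i cj j(2) D K)
  finally show "convolve j j' \<phi> p = convolve j j \<phi>x p" by simp
qed

definition thicken :: "real \<Rightarrow> (real \<times> real) set \<Rightarrow> (real \<times> real) set" where
  "thicken h K = {x + y |x y. x \<in> K \<and> y \<in> cbox (-h, -h) (h, h)}"

lemma compact_thicken: "compact K \<Longrightarrow> compact (thicken h K)"
  unfolding thicken_def by (intro compact_sums) auto

lemma in_thicken_iff:
  "p \<in> thicken h K \<longleftrightarrow> (\<exists>q\<in>K. \<bar>fst p - fst q\<bar> \<le> h \<and> \<bar>snd p - snd q\<bar> \<le> h)"
proof
  assume "p \<in> thicken h K"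
  then obtain x y where "p = x + y" "x \<in> K" "y \<in> cbox (-h, -h) (h, h)" by (auto simp: thicken_def)
  then show "\<exists>q\<in>K. \<bar>fst p - fst q\<bar> \<le> h \<and> \<bar>snd p - snd q\<bar> \<le> h"
    by (intro bexI[of _ x]) (cases y, auto simp: cbox_Pair_eq)
next
  assume "\<exists>q\<in>K. \<bar>fst p - fst q\<bar> \<le> h \<and> \<bar>snd p - snd q\<bar> \<le> h"
  then obtain q where "q \<in> K" "\<bar>fst p - fst q\<bar> \<le> h" "\<bar>snd p - snd q\<bar> \<le> h" by blast
  then show "p \<in> thicken h K"
    unfolding thicken_def by (intro CollectI exI[of _ q] exI[of _ "p - q"]) (cases p; cases q; auto simp: cbox_Pair_eq abs_le_iff)
qed

lemma thicken_mono: "h \<le> h' \<Longrightarrow> thicken h K \<subseteq> thicken h' K"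
  unfolding subset_iff in_thicken_iff by (meson order_trans)

lemma subset_thicken: "0 \<le> h \<Longrightarrow> K \<subseteq> thicken h K"
  unfolding subset_iff in_thicken_iff by (intro allI impI bexI) auto

lemma dist_pair_le: "dist p q \<le> \<bar>fst p - fst q\<bar> + \<bar>snd p - snd q\<bar>" for p q :: "real \<times> real"
  by (simp add: dist_prod_def dist_real_def sqrt_sum_squares_le_sum_abs)

lemma thicken_subset_open:
  assumes "compact K" "open U" "K \<subseteq> U"
  obtains h where "h > 0" "thicken h K \<subseteq> U"
proof -
  obtain d where d: "d > 0" "(\<Union>x\<in>K. ball x d) \<subseteq> U"
    using compact_subset_open_imp_ball_epsilon_subset[OF assms] by blast
  have "thicken (d / 3) K \<subseteq> (\<Union>x\<in>K. ball x d)"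
  proof
    fix p assume "p \<in> thicken (d / 3) K"
    then obtain q where q: "q \<in> K" "\<bar>fst p - fst q\<bar> \<le> d / 3" "\<bar>snd p - snd q\<bar> \<le> d / 3"
      by (auto simp: in_thicken_iff)
    then have "dist q p < d" using dist_pair_le[of p q] d(1) by (simp add: dist_commute)
    then show "p \<in> (\<Union>x\<in>K. ball x d)" using q by auto
  qed
  with d show thesis by (intro that[of "d / 3"]) auto
qed

text \<open>
  One compact set \<open>K\<close> serves all \<open>e\<close>: uniform closeness of the derivatives then gives closeness of
  integrals against bounded functions.
\<close>

lemma smooth_approximation:
  assumes \<phi>: "C1_test U \<phi> \<phi>t \<phi>x" "open U" "\<And>p. 0 \<le> \<phi> p"
  obtains K where "compact K" "\<And>e. e > 0 \<Longrightarrow> \<exists>\<psi> \<psi>t \<psi>x.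
    (\<forall>k. C_k k \<psi>) \<and> compact_support_in U \<psi> \<and> (\<forall>p. 0 \<le> \<psi> p) \<and> C1_test U \<psi> \<psi>t \<psi>x \<and>
    (\<forall>p. \<bar>\<psi>t p - \<phi>t p\<bar> \<le> e \<and> \<bar>\<psi>x p - \<phi>x p\<bar> \<le> e) \<and>
    (\<forall>p. p \<notin> K \<longrightarrow> \<psi>t p = 0 \<and> \<psi>x p = 0 \<and> \<phi>t p = 0 \<and> \<phi>x p = 0)"
proof -
  obtain K where K: "compact K" "K \<subseteq> U"
    "\<And>p. p \<notin> K \<Longrightarrow> \<phi> p = 0" "\<And>p. p \<notin> K \<Longrightarrow> \<phi>t p = 0" "\<And>p. p \<notin> K \<Longrightarrow> \<phi>x p = 0"
    using C1_test_support[OF \<phi>(1)] by blast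
  note D = C1_testD[OF \<phi>(1)]
  obtain d0 where d0: "d0 > 0" "thicken d0 K \<subseteq> U" using thicken_subset_open[OF K(1) \<phi>(2) K(2)] by blast
  show thesis
  proof (rule that[OF compact_thicken[OF K(1), of d0]])
    fix e :: real assume "e > 0"
    obtain d1 where d1: "d1 > 0" "\<And>p q. dist p q < d1 \<Longrightarrow> \<bar>\<phi>t p - \<phi>t q\<bar> < e"
      using continuous_compact_support_uniform[OF D(3) K(1) K(4) \<open>e > 0\<close>] by blast
    obtain d2 where d2: "d2 > 0" "\<And>p q. dist p q < d2 \<Longrightarrow> \<bar>\<phi>x p - \<phi>x q\<bar> < e"
      using continuous_compact_support_uniform[OF D(4) K(1) K(5) \<open>e > 0\<close>] by blast
    \<comment> \<open>Points whose coordinates differ by less than \<open>h\<close> are at distance below \<open>2 * h\<close>.\<close>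
    define h where "h = min d0 (min d1 d2 / 3)"
    have h: "h > 0" "h \<le> d0" using d0 d1 d2 by (auto simp: h_def)
    have close: "dist q p < d1" "dist q p < d2" if "\<bar>fst p - fst q\<bar> < h" "\<bar>snd p - snd q\<bar> < h" for p q
      using dist_pair_le[of p q] that d1(1) d2(1) by (auto simp: h_def dist_commute)
    obtain j j' where m: "mollifier h j j'" using mollifier_exists[OF h(1)] by blast
    note J = mollifierD[OF m]
    define \<psi> where "\<psi> = convolve j j \<phi>"
    define \<psi>t where "\<psi>t = convolve j j \<phi>t"
    define \<psi>x where "\<psi>x = convolve j j \<phi>x"
    have supp: "convolve j j f p = 0" if "\<And>p. p \<notin> K \<Longrightarrow> f p = 0" "p \<notin> thicken h K" for f p
    proof -
      have "(\<lambda>q. f q * product_kernel j j p q) = (\<lambda>q. 0)"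
      proof
        fix q
        have "f q = 0 \<or> j (fst p - fst q) = 0 \<or> j (snd p - snd q) = 0"
        proof (cases "q \<in> K")
          case True
          then have "\<bar>fst p - fst q\<bar> \<ge> h \<or> \<bar>snd p - snd q\<bar> \<ge> h"
            using that(2) unfolding in_thicken_iff by force
          then show ?thesis using J(6) by blast
        qed (use that(1) in blast)
        then show "f q * product_kernel j j p q = 0" by (auto simp: product_kernel_def)
      qed
      then show ?thesis by (simp add: convolve_def)
    qed
    have der: "(\<psi> has_derivative (\<lambda>h. fst h * \<psi>t p + snd h * \<psi>x p)) (at p)" for p
      using convolve_has_derivative[OF D(2) K(1,3) J(2,4) J(2,4), of p]
      unfolding convolve_derivative_shift[OF \<phi>(1) J(2,4)] \<psi>_def \<psi>t_def \<psi>x_def .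
    have T: "C1_test U \<psi> \<psi>t \<psi>x"
      unfolding C1_test_def
    proof (intro conjI allI der exI[of _ "thicken h K"])
      show "continuous_on UNIV \<psi>t" unfolding \<psi>t_def by (rule convolve_continuous[OF D(3) K(1,4) J(3) J(3)])
      show "continuous_on UNIV \<psi>x" unfolding \<psi>x_def by (rule convolve_continuous[OF D(4) K(1,5) J(3) J(3)])
      show "compact (thicken h K)" by (rule compact_thicken[OF K(1)])
      show "thicken h K \<subseteq> U" using thicken_mono[OF h(2), of K] d0(2) by blast
      show "p \<notin> thicken h K \<longrightarrow> \<psi> p = 0" for p unfolding \<psi>_def using supp[of \<phi> p] K(3) by blast
    qed
    have cs: "compact_support_in U \<psi>"
    proof -
      have "closure {p. \<psi> p \<noteq> 0} \<subseteq> thicken h K"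
        using supp[of \<phi>] K(3) compact_imp_closed[OF compact_thicken[OF K(1), of h]]
        by (intro closure_minimal) (auto simp: \<psi>_def)
      then show ?thesis unfolding compact_support_in_def
        using compact_thicken[OF K(1), of h] thicken_mono[OF h(2), of K] d0(2)
        by (meson closed_closure compact_closure compact_imp_bounded bounded_subset bounded_closure_image order_trans closure_subset)
    qed
    have "\<forall>k. C_k k \<psi>" unfolding \<psi>_def using C_k_convolve[OF D(2) K(1,3)] J(1) by blast
    moreover have "0 \<le> \<psi> p" for p
      unfolding \<psi>_def convolve_def product_kernel_def using \<phi>(3) J(5) by (intro Bochner_Integration.integral_nonneg) auto
    moreover have "\<bar>\<psi>t p - \<phi>t p\<bar> \<le> e" for p
      unfolding \<psi>t_def
      by (rule convolve_approximates[OF D(3) K(1,4) m]) (use close d1 less_imp_le in blast)+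
    moreover have "\<bar>\<psi>x p - \<phi>x p\<bar> \<le> e" for p
      unfolding \<psi>x_def
      by (rule convolve_approximates[OF D(4) K(1,5) m]) (use close d2 less_imp_le in blast)+
    moreover have "\<psi>t p = 0 \<and> \<psi>x p = 0 \<and> \<phi>t p = 0 \<and> \<phi>x p = 0" if "p \<notin> thicken d0 K" for p
    proof -
      have "p \<notin> thicken h K" "p \<notin> K" using that thicken_mono[OF h(2), of K] subset_thicken[of d0 K] d0(1) by auto
      then show ?thesis using supp K unfolding \<psi>t_def \<psi>x_def by blast
    qed
    ultimately show "\<exists>\<psi> \<psi>t \<psi>x. (\<forall>k. C_k k \<psi>) \<and> compact_support_in U \<psi> \<and> (\<forall>p. 0 \<le> \<psi> p) \<and> C1_test U \<psi> \<psi>t \<psi>x \<and>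
      (\<forall>p. \<bar>\<psi>t p - \<phi>t p\<bar> \<le> e \<and> \<bar>\<psi>x p - \<phi>x p\<bar> \<le> e) \<and>
      (\<forall>p. p \<notin> thicken d0 K \<longrightarrow> \<psi>t p = 0 \<and> \<psi>x p = 0 \<and> \<phi>t p = 0 \<and> \<phi>x p = 0)"
      using cs T by blast
  qed
qed

section \<open>Kruzhkov's entropy inequality\<close>

definition entropy_flux :: "(real \<Rightarrow> real) \<Rightarrow> real \<Rightarrow> real \<Rightarrow> real" where
  "entropy_flux F a b = sgn (a - b) * (F a - F b)"

text \<open>
  Restricting the supports to a set \<open>U\<close> localises the notion. For \<open>U\<close> on one side of the turning
  curve the interface term of the model drops out and the sign in front of the flux is constant.
\<close>

definition kruzhkov_on ::
  "real \<Rightarrow> (real \<Rightarrow> real) \<Rightarrow> (real \<times> real) set \<Rightarrow> (real \<times> real \<Rightarrow> real) \<Rightarrow> bool" where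
  "kruzhkov_on M F U u \<longleftrightarrow>
     (\<forall>\<kappa>\<in>{0..M}. \<forall>\<phi> \<phi>t \<phi>x. C1_test U \<phi> \<phi>t \<phi>x \<and> (\<forall>p. 0 \<le> \<phi> p) \<longrightarrow>
        0 \<le> (LINT p|lborel. \<bar>u p - \<kappa>\<bar> * \<phi>t p + entropy_flux F (u p) \<kappa> * \<phi>x p))"

definition bounded_density :: "real \<Rightarrow> (real \<times> real \<Rightarrow> real) \<Rightarrow> bool" where
  "bounded_density M u \<longleftrightarrow> u \<in> borel_measurable borel \<and> (\<forall>p. 0 \<le> u p \<and> u p \<le> M)"

lemma kruzhkov_onD:
  assumes "kruzhkov_on M F U u" "0 \<le> \<kappa>" "\<kappa> \<le> M" "C1_test U \<phi> \<phi>t \<phi>x" "\<And>p. 0 \<le> \<phi> p"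
  shows "0 \<le> (LINT p|lborel. \<bar>u p - \<kappa>\<bar> * \<phi>t p + entropy_flux F (u p) \<kappa> * \<phi>x p)"
  by (rule assms(1)[unfolded kruzhkov_on_def, rule_format, of \<kappa> \<phi>]) (use assms in simp_all)

lemma bounded_densityD:
  assumes "bounded_density M u"
  shows "u \<in> borel_measurable borel" "0 \<le> u p" "u p \<le> M"
  using assms unfolding bounded_density_def by blast+

lemma entropy_flux_commute: "entropy_flux F a b = entropy_flux F b a"
  by (auto simp: entropy_flux_def sgn_if)

lemma entropy_flux_scale: "entropy_flux (\<lambda>r. c * F r) a b = c * entropy_flux F a b"
  by (simp add: entropy_flux_def algebra_simps)

lemma integrable_mult_bounded:
  fixes a g :: "'a \<Rightarrow> real"
  assumes "integrable N g" "a \<in> borel_measurable N" "\<And>p. \<bar>a p\<bar> \<le> A"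
  shows "integrable N (\<lambda>p. a p * g p)"
proof (rule Bochner_Integration.integrable_bound)
  show "integrable N (\<lambda>p. A * g p)" using assms(1) by simp
  have "0 \<le> A" using assms(3) abs_ge_zero order_trans by blast
  then show "AE p in N. norm (a p * g p) \<le> norm (A * g p)"
    using assms(3) by (intro AE_I2) (auto simp: abs_mult intro!: mult_right_mono)
  show "(\<lambda>p. a p * g p) \<in> borel_measurable N"
    using assms(1,2) by (intro borel_measurable_times) auto
qed

text \<open>
  The form in which all limits are taken below: the constant \<open>C\<close> collects bounds that do not depend
  on the regularisation.
\<close>

lemma nonneg_if_ge_neg_multiples:
  assumes "\<And>e::real. e > 0 \<Longrightarrow> - (C * e) \<le> I"
  shows "0 \<le> I"
proof (rule ccontr)
  assume n: "\<not> 0 \<le> I"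
  have "C * 1 \<ge> - I" using assms[of 1] by simp
  then have C: "C > 0" using n by simp
  have "- (C * (- I / (2 * C))) \<le> I" using C n by (intro assms) (auto simp: divide_less_0_iff)
  then show False using C n by (simp add: field_simps)
qed

text \<open>
  \<open>g\<close> is the integrand for a regularised test function, \<open>h\<close> bounds the error of the regularisation.
\<close>

lemma LINT_ge_of_error:
  fixes f g :: "'a \<Rightarrow> real"
  assumes "integrable N f" "integrable N g" "integrable N h" "\<And>p. g p - h p \<le> f p"
    and "0 \<le> integral\<^sup>L N g" "integral\<^sup>L N h \<le> c"
  shows "- c \<le> integral\<^sup>L N f"
proof -
  have "integral\<^sup>L N g - integral\<^sup>L N h = (LINT p|N. g p - h p)" using assms by simp
  also have "\<dots> \<le> integral\<^sup>L N f" using assms by (intro integral_mono) auto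
  finally show ?thesis using assms by simp
qed

locale lipschitz_flux =
  fixes M L :: real and F :: "real \<Rightarrow> real"
  assumes M_nonneg: "0 \<le> M" and L_nonneg: "0 \<le> L" and F_lip: "\<bar>F a - F b\<bar> \<le> L * \<bar>a - b\<bar>"
begin

lemma entropy_flux_bound: "\<bar>entropy_flux F a b\<bar> \<le> L * \<bar>a - b\<bar>"
  using F_lip[of a b] by (auto simp: entropy_flux_def sgn_if abs_minus_commute)

text \<open>
  The jump of the sign is harmless because the flux difference that it multiplies vanishes there.
\<close>

lemma entropy_flux_lipschitz: "\<bar>entropy_flux F a k - entropy_flux F b k\<bar> \<le> L * \<bar>a - b\<bar>"
proof -
  consider "a \<ge> k" "b \<ge> k" | "a \<le> k" "b \<le> k" | "a > k" "b < k" | "a < k" "b > k" by linarith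
  then show ?thesis
  proof cases
    case 3
    have "\<bar>F a - F k\<bar> + \<bar>F b - F k\<bar> \<le> L * (a - k) + L * (k - b)"
      using F_lip[of a k] F_lip[of b k] 3 by simp
    also have "\<dots> = L * \<bar>a - b\<bar>" using 3 by (simp add: algebra_simps)
    finally show ?thesis using 3 by (simp add: entropy_flux_def)
  next
    case 4
    have "\<bar>F a - F k\<bar> + \<bar>F b - F k\<bar> \<le> L * (k - a) + L * (b - k)"
      using F_lip[of a k] F_lip[of b k] 4 by simp
    also have "\<dots> = L * \<bar>a - b\<bar>" using 4 by (simp add: algebra_simps)
    finally show ?thesis using 4 by (simp add: entropy_flux_def)
  qed (use F_lip[of a b] in \<open>auto simp: entropy_flux_def sgn_if abs_minus_commute\<close>)
qed

lemma continuous_F: "continuous_on UNIV F"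
  unfolding continuous_on_iff
proof (intro ballI allI impI)
  fix x e :: real assume "e > 0"
  show "\<exists>d>0. \<forall>x'\<in>UNIV. dist x' x < d \<longrightarrow> dist (F x') (F x) < e"
  proof (intro exI[of _ "e / (L + 1)"] conjI ballI impI)
    fix y assume y: "dist y x < e / (L + 1)"
    have "\<bar>F y - F x\<bar> \<le> (L + 1) * \<bar>y - x\<bar>" using F_lip[of y x] by (simp add: algebra_simps)
    also have "\<dots> < e" using y L_nonneg by (simp add: dist_real_def field_simps)
    finally show "dist (F y) (F x) < e" by (simp add: dist_real_def)
  qed (use \<open>e > 0\<close> L_nonneg in simp)
qed

lemma measurable_F [measurable]: "F \<in> borel_measurable borel"
  using continuous_F by (rule borel_measurable_continuous_onI)

lemma measurable_entropy_flux [measurable (raw)]: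
  "u \<in> borel_measurable N \<Longrightarrow> w \<in> borel_measurable N \<Longrightarrow> (\<lambda>p. entropy_flux F (u p) (w p)) \<in> borel_measurable N"
proof -
  assume [measurable]: "u \<in> borel_measurable N" "w \<in> borel_measurable N"
  have [measurable]: "(\<lambda>p. F (u p)) \<in> borel_measurable N" "(\<lambda>p. F (w p)) \<in> borel_measurable N"
    by (rule measurable_compose[OF _ measurable_F], measurable)+
  show ?thesis unfolding entropy_flux_def by measurable
qed

lemma integrable_entropy_terms:
  assumes "bounded_density M u" "bounded_density M w" "integrable lborel g"
  shows "integrable lborel (\<lambda>p. \<bar>u p - w p\<bar> * g p)"
    "integrable lborel (\<lambda>p. entropy_flux F (u p) (w p) * g p)"
proof -
  have [measurable]: "u \<in> borel_measurable borel" "w \<in> borel_measurable borel"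
    using assms by (auto simp: bounded_density_def)
  have b: "\<bar>u p - w p\<bar> \<le> M" for p
    using assms(1,2) unfolding bounded_density_def by (smt (verit))
  then have "\<bar>entropy_flux F (u p) (w p)\<bar> \<le> L * M" for p
    using entropy_flux_bound order_trans mult_left_mono[OF b L_nonneg] by blast
  then show "integrable lborel (\<lambda>p. entropy_flux F (u p) (w p) * g p)"
    by (intro integrable_mult_bounded[OF assms(3), of _ "L * M"]) auto
  show "integrable lborel (\<lambda>p. \<bar>u p - w p\<bar> * g p)"
    using b by (intro integrable_mult_bounded[OF assms(3), of _ M]) auto
qed

lemma bounded_density_const: "0 \<le> c \<Longrightarrow> c \<le> M \<Longrightarrow> bounded_density M (\<lambda>_. c)"
  by (simp add: bounded_density_def)

text \<open>
  Both factors \<open>\<bar>u p - \<kappa>\<bar>\<close> and \<open>entropy_flux F (u p) \<kappa>\<close> are bounded, so uniform approximation of the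
  derivatives on a fixed compact set passes to the limit in the inequality.
\<close>

lemma kruzhkov_on_smooth_tests:
  assumes "open U" "bounded_density M u"
    and smooth: "\<And>\<kappa> \<phi> \<phi>t \<phi>x. 0 \<le> \<kappa> \<Longrightarrow> \<kappa> \<le> M \<Longrightarrow> \<forall>k. C_k k \<phi> \<Longrightarrow> compact_support_in U \<phi> \<Longrightarrow>
      \<forall>p. 0 \<le> \<phi> p \<Longrightarrow> C1_test U \<phi> \<phi>t \<phi>x \<Longrightarrow>
      0 \<le> (LINT p|lborel. \<bar>u p - \<kappa>\<bar> * \<phi>t p + entropy_flux F (u p) \<kappa> * \<phi>x p)"
  shows "kruzhkov_on M F U u"
  unfolding kruzhkov_on_def
proof (intro ballI allI impI, elim conjE)
  fix \<kappa> \<phi> \<phi>t \<phi>x assume \<kappa>: "\<kappa> \<in> {0..M}" and \<phi>: "C1_test U \<phi> \<phi>t \<phi>x" "\<forall>p. 0 \<le> \<phi> p"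
  have dk: "bounded_density M (\<lambda>_. \<kappa>)" using \<kappa> by (intro bounded_density_const) auto
  obtain K where K: "compact K" and app: "\<And>e. e > 0 \<Longrightarrow> \<exists>\<psi> \<psi>t \<psi>x.
    (\<forall>k. C_k k \<psi>) \<and> compact_support_in U \<psi> \<and> (\<forall>p. 0 \<le> \<psi> p) \<and> C1_test U \<psi> \<psi>t \<psi>x \<and>
    (\<forall>p. \<bar>\<psi>t p - \<phi>t p\<bar> \<le> e \<and> \<bar>\<psi>x p - \<phi>x p\<bar> \<le> e) \<and>
    (\<forall>p. p \<notin> K \<longrightarrow> \<psi>t p = 0 \<and> \<psi>x p = 0 \<and> \<phi>t p = 0 \<and> \<phi>x p = 0)"
    by (rule smooth_approximation[OF \<phi>(1) assms(1)]) (use \<phi>(2) in blast)+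
  have mK: "emeasure lborel K < \<infinity>" "K \<in> sets borel"
    using emeasure_bounded_finite[OF compact_imp_bounded[OF K]] compact_imp_closed[OF K] by auto
  show "0 \<le> (LINT p|lborel. \<bar>u p - \<kappa>\<bar> * \<phi>t p + entropy_flux F (u p) \<kappa> * \<phi>x p)"
  proof (rule nonneg_if_ge_neg_multiples)
    fix e :: real assume "e > 0"
    then obtain \<psi> \<psi>t \<psi>x where \<psi>: "\<forall>k. C_k k \<psi>" "compact_support_in U \<psi>" "\<forall>p. 0 \<le> \<psi> p" "C1_test U \<psi> \<psi>t \<psi>x"
      "\<And>p. \<bar>\<psi>t p - \<phi>t p\<bar> \<le> e" "\<And>p. \<bar>\<psi>x p - \<phi>x p\<bar> \<le> e"
      "\<And>p. p \<notin> K \<Longrightarrow> \<psi>t p = 0 \<and> \<psi>x p = 0 \<and> \<phi>t p = 0 \<and> \<phi>x p = 0"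
      using app by metis
    show "- ((M + L * M) * measure lborel K * e) \<le> (LINT p|lborel. \<bar>u p - \<kappa>\<bar> * \<phi>t p + entropy_flux F (u p) \<kappa> * \<phi>x p)"
    proof (rule LINT_ge_of_error)
      show "integrable lborel (\<lambda>p. \<bar>u p - \<kappa>\<bar> * \<phi>t p + entropy_flux F (u p) \<kappa> * \<phi>x p)"
        "integrable lborel (\<lambda>p. \<bar>u p - \<kappa>\<bar> * \<psi>t p + entropy_flux F (u p) \<kappa> * \<psi>x p)"
        by (intro Bochner_Integration.integrable_add integrable_entropy_terms assms(2) dk C1_test_integrable[OF \<phi>(1)]
            C1_test_integrable[OF \<psi>(4)])+
      show "0 \<le> (LINT p|lborel. \<bar>u p - \<kappa>\<bar> * \<psi>t p + entropy_flux F (u p) \<kappa> * \<psi>x p)"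
        using smooth[OF _ _ \<psi>(1-4)] \<kappa> by simp
      show "integrable lborel (\<lambda>p. (M + L * M) * e * indicator K p)"
        using mK by (intro integrable_mult_right integrable_real_indicator) auto
      show "(LINT p|lborel. (M + L * M) * e * indicator K p) \<le> (M + L * M) * measure lborel K * e"
        using mK by simp
      fix p
      have b: "\<bar>u p - \<kappa>\<bar> \<le> M"
        using assms(2) \<kappa> unfolding bounded_density_def by (smt (verit) atLeastAtMost_iff)
      then have c: "\<bar>entropy_flux F (u p) \<kappa>\<bar> \<le> L * M"
        using entropy_flux_bound order_trans mult_left_mono[OF b L_nonneg] by blast
      show "\<bar>u p - \<kappa>\<bar> * \<psi>t p + entropy_flux F (u p) \<kappa> * \<psi>x p - (M + L * M) * e * indicator K p
          \<le> \<bar>u p - \<kappa>\<bar> * \<phi>t p + entropy_flux F (u p) \<kappa> * \<phi>x p"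
      proof (cases "p \<in> K")
        case True
        have "\<bar>\<bar>u p - \<kappa>\<bar> * (\<psi>t p - \<phi>t p)\<bar> \<le> M * e"
          unfolding abs_mult using b \<psi>(5)[of p] M_nonneg by (intro mult_mono) auto
        moreover have "\<bar>entropy_flux F (u p) \<kappa> * (\<psi>x p - \<phi>x p)\<bar> \<le> L * M * e"
          unfolding abs_mult using c \<psi>(6)[of p] M_nonneg L_nonneg by (intro mult_mono) auto
        ultimately show ?thesis using True by (simp add: algebra_simps)
      qed (use \<psi>(7) in simp)
    qed
  qed
qed

end

section \<open>Cut-off functions along Lipschitz curves\<close>

text \<open>
  A cut-off that rises from 0 to 1 on the unit interval. Squares of positive parts are \<open>C\<^sup>1\<close>, which
  avoids gluing polynomial pieces; \<open>smooth_step'\<close> is the derivative, a hat of height 2.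
\<close>

definition smooth_step :: "real \<Rightarrow> real" where
  "smooth_step x = 2 * (max 0 x)\<^sup>2 - 4 * (max 0 (x - 1/2))\<^sup>2 + 2 * (max 0 (x - 1))\<^sup>2"

definition smooth_step' :: "real \<Rightarrow> real" where
  "smooth_step' x = 4 * max 0 x - 8 * max 0 (x - 1/2) + 4 * max 0 (x - 1)"

lemma has_derivative_max_square:
  "((\<lambda>x::real. (max 0 x)\<^sup>2) has_real_derivative 2 * max 0 x) (at x)"
proof -
  consider "x < 0" | "x > 0" | "x = 0" by linarith
  then show ?thesis
  proof cases
    case 1
    have "((\<lambda>_. 0) has_real_derivative 2 * max 0 x) (at x)" using 1 by simp
    then show ?thesis
      by (rule DERIV_cong_ev[THEN iffD1, rotated -1])
        (use 1 in \<open>auto intro: eventually_mono[OF eventually_nhds_in_open[of "{..<0}" x]]\<close>)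
  next
    case 2
    have "((\<lambda>x. x\<^sup>2) has_real_derivative 2 * max 0 x) (at x)" using 2 by (auto intro!: derivative_eq_intros)
    then show ?thesis
      by (rule DERIV_cong_ev[THEN iffD1, rotated -1])
        (use 2 in \<open>auto intro: eventually_mono[OF eventually_nhds_in_open[of "{0<..}" x]]\<close>)
  next
    case 3
    have "((\<lambda>h. max 0 h) \<longlongrightarrow> max 0 (0::real)) (at 0)" by (intro tendsto_intros)
    then have "((\<lambda>h. max 0 h) \<longlongrightarrow> (0::real)) (at 0)" by simp
    then have "((\<lambda>h. ((max 0 (0 + h))\<^sup>2 - (max 0 0)\<^sup>2) / h) \<longlongrightarrow> (0::real)) (at 0)"
      by (rule Lim_transform_eventually)
        (auto simp: max_def power2_eq_square intro!: eventuallyI)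
    then show ?thesis using 3 by (simp add: DERIV_def)
  qed
qed

lemma smooth_step_has_derivative: "(smooth_step has_real_derivative smooth_step' x) (at x)"
proof -
  have c: "((\<lambda>x::real. (max 0 (x - c))\<^sup>2) has_real_derivative 2 * max 0 (x - c)) (at x)" for c
  proof -
    have "((\<lambda>x. x - c) has_real_derivative 1) (at x)" by (auto intro!: derivative_eq_intros)
    then show ?thesis
      using DERIV_chain2[of "\<lambda>x. (max 0 x)\<^sup>2" "2 * max 0 (x - c)" "\<lambda>x. x - c" x 1 UNIV]
        has_derivative_max_square[of "x - c"] by simp
  qed
  note DERIV_add[OF DERIV_diff[OF DERIV_cmult[OF c[of 0], of 2] DERIV_cmult[OF c[of "1/2"], of 4]] DERIV_cmult[OF c[of 1], of 2]]
  then show ?thesis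
    unfolding smooth_step_def[abs_def] smooth_step'_def by (simp add: mult.assoc[symmetric])
qed

lemma smooth_step_continuous: "continuous_on UNIV smooth_step" "continuous_on UNIV smooth_step'"
  unfolding smooth_step_def[abs_def] smooth_step'_def[abs_def] by (intro continuous_intros)+

lemma smooth_step_low: "x \<le> 0 \<Longrightarrow> smooth_step x = 0" "x \<le> 0 \<Longrightarrow> smooth_step' x = 0"
  by (auto simp: smooth_step_def smooth_step'_def max_def)

lemma smooth_step_high: "x \<ge> 1 \<Longrightarrow> smooth_step x = 1" "x \<ge> 1 \<Longrightarrow> smooth_step' x = 0"
  by (auto simp: smooth_step_def smooth_step'_def max_def power2_eq_square algebra_simps)

lemma smooth_step'_bounds: "0 \<le> smooth_step' x" "smooth_step' x \<le> 2"
  by (auto simp: smooth_step'_def max_def)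

lemma smooth_step'_pos: "0 < x \<Longrightarrow> x < 1 \<Longrightarrow> 0 < smooth_step' x"
  by (auto simp: smooth_step'_def max_def)

lemma smooth_step_mono: "x \<le> y \<Longrightarrow> smooth_step x \<le> smooth_step y"
  using DERIV_nonneg_imp_nondecreasing[of x y smooth_step] smooth_step_has_derivative smooth_step'_bounds by blast

lemma smooth_step_bounds: "0 \<le> smooth_step x" "smooth_step x \<le> 1"
  using smooth_step_mono[of "min x 0" x] smooth_step_mono[of x "max x 1"]
  by (auto simp: smooth_step_low smooth_step_high)

definition strip :: "real \<Rightarrow> (real \<Rightarrow> real) \<Rightarrow> real \<Rightarrow> real \<Rightarrow> (real \<times> real) set" where
  "strip \<sigma> z T w = {p. 0 \<le> fst p \<and> fst p \<le> T \<and> 0 < \<sigma> * (snd p - z (fst p)) \<and> \<sigma> * (snd p - z (fst p)) < w}"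

text \<open>
  The mean of \<open>g\<close> over the strip of width \<open>w\<close> on the side \<open>\<sigma>\<close> of the curve tends to zero with \<open>w\<close>,
  up to the length of the time interval. All information used about traces has this form.
\<close>

definition vanishes_near ::
  "real \<Rightarrow> (real \<Rightarrow> real) \<Rightarrow> (real \<times> real \<Rightarrow> real) \<Rightarrow> bool" where
  "vanishes_near \<sigma> z g \<longleftrightarrow>
     (\<forall>T>0. \<forall>e>0. \<exists>d>0. \<forall>w. 0 < w \<and> w < d \<longrightarrow>
        (LINT p|lborel. indicator (strip \<sigma> z T w) p * g p) \<le> e * w)"

lemma continuous_antiderivative:
  fixes z :: "real \<Rightarrow> real"
  assumes "continuous_on UNIV z"
  obtains Z where "\<And>t. (Z has_real_derivative z t) (at t)"
proof -
  have "\<exists>Z. \<forall>x. -\<infinity> < ereal x \<longrightarrow> ereal x < \<infinity> \<longrightarrow> (Z has_vector_derivative z x) (at x)"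
    using assms by (intro einterval_antiderivative) (auto simp: continuous_on_eq_continuous_at)
  then show thesis using that by (auto simp: has_real_derivative_iff_has_vector_derivative)
qed

text \<open>
  The mean of \<open>z\<close> over the time interval of length \<open>w\<close> after \<open>t\<close> is \<open>C\<^sup>1\<close> and has the Lipschitz constant
  of \<open>z\<close>, so that cut-offs along it have gradients of the same order as along a straight line.
\<close>

lemma averaged_curve_exists:
  fixes z :: "real \<Rightarrow> real"
  assumes z: "\<And>s t. \<bar>z s - z t\<bar> \<le> k * \<bar>s - t\<bar>" and "0 \<le> k" "0 < w"
  obtains y y' where "\<And>t. (y has_real_derivative y' t) (at t)" "continuous_on UNIV y'"
    "\<And>t. \<bar>y t - z t\<bar> \<le> k * w" "\<And>t. \<bar>y' t\<bar> \<le> k"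
proof -
  have "k-lipschitz_on UNIV z" using z \<open>0 \<le> k\<close> by (auto intro!: lipschitz_onI simp: dist_real_def)
  then have cz: "continuous_on UNIV z" by (rule lipschitz_on_continuous_on)
  obtain Z where Z: "\<And>t. (Z has_real_derivative z t) (at t)" using continuous_antiderivative[OF cz] by blast
  define y where "y t = (Z (t + w) - Z t) / w" for t
  define y' where "y' t = (z (t + w) - z t) / w" for t
  show thesis
  proof
    fix t
    have "((\<lambda>t. Z (t + w)) has_real_derivative z (t + w) * 1) (at t)"
      using Z[of "t + w"] by (simp add: DERIV_shift)
    then show "(y has_real_derivative y' t) (at t)"
      unfolding y_def y'_def using Z[of t] \<open>0 < w\<close> by (auto intro!: derivative_eq_intros)
    show "\<bar>y' t\<bar> \<le> k" using z[of "t + w" t] \<open>0 < w\<close> by (simp add: y'_def field_simps)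
    obtain s where s: "t < s" "s < t + w" "Z (t + w) - Z t = (t + w - t) * z s"
      using MVT2[of t "t + w" Z z] Z \<open>0 < w\<close> by auto
    then have "y t = z s" using \<open>0 < w\<close> by (simp add: y_def)
    then have "\<bar>y t - z t\<bar> \<le> k * \<bar>s - t\<bar>" using z by simp
    also have "\<dots> \<le> k * w" using s \<open>0 \<le> k\<close> by (intro mult_left_mono) auto
    finally show "\<bar>y t - z t\<bar> \<le> k * w" .
  next
    show "continuous_on UNIV y'"
      unfolding y'_def[abs_def] using \<open>0 < w\<close>
      by (auto intro!: continuous_intros continuous_on_compose2[OF cz])
  qed
qed

lemma measurable_fst_snd_real:
  "(\<lambda>p::real \<times> real. fst p) \<in> borel_measurable borel" "(\<lambda>p::real \<times> real. snd p) \<in> borel_measurable borel"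
  by (intro borel_measurable_continuous_onI continuous_on_fst continuous_on_snd continuous_on_id)+

lemma strip_borel:
  assumes "continuous_on UNIV z"
  shows "strip \<sigma> z T w \<in> sets borel"
proof -
  have [measurable]: "z \<in> borel_measurable borel" using assms by (rule borel_measurable_continuous_onI)
  have "(\<lambda>p::real \<times> real. fst p) \<in> borel_measurable borel" "(\<lambda>p::real \<times> real. snd p) \<in> borel_measurable borel"
    by (intro borel_measurable_continuous_onI continuous_on_fst continuous_on_snd continuous_on_id)+
  note [measurable] = this measurable_compose[OF this(1), of z borel]
  have "Measurable.pred borel (\<lambda>p::real \<times> real. 0 \<le> fst p \<and> fst p \<le> T \<and> 0 < \<sigma> * (snd p - z (fst p)) \<and> \<sigma> * (snd p - z (fst p)) < w)"
    by measurable
  then show ?thesis by (simp add: strip_def pred_def)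
qed

lemma strip_bounded:
  assumes "\<And>t. \<bar>z t\<bar> \<le> B" "\<bar>\<sigma>\<bar> = 1"
  shows "bounded (strip \<sigma> z T w)"
proof -
  have "strip \<sigma> z T w \<subseteq> cbox (0, - B - \<bar>w\<bar>) (T, B + \<bar>w\<bar>)"
  proof
    fix p assume p: "p \<in> strip \<sigma> z T w"
    have "\<bar>snd p - z (fst p)\<bar> = \<bar>\<sigma> * (snd p - z (fst p))\<bar>" using assms(2) by (simp add: abs_mult)
    also have "\<dots> < w" using p by (auto simp: strip_def)
    finally show "p \<in> cbox (0, - B - \<bar>w\<bar>) (T, B + \<bar>w\<bar>)"
      using p assms(1)[of "fst p"] by (cases p) (auto simp: strip_def cbox_Pair_eq)
  qed
  then show ?thesis using bounded_cbox bounded_subset by blast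
qed

section \<open>Continuation by zero across the turning curve\<close>

context lipschitz_flux
begin

text \<open>
  Split \<open>\<phi> = \<phi>\<eta> + \<phi>(1 - \<eta>)\<close> with a cut-off \<open>\<eta>\<close> that vanishes up to the curve and equals 1 beyond a strip
  of width \<open>w\<close>. The first summand is a test function for \<open>r\<close>; the second one tests the constant state 0,
  for which the entropy inequality is an equality. The sum of the two integrands differs from the one
  for the continued density only on the strip, and there by at most a multiple of \<open>r / \<epsilon>\<close>, because the
  entropy fluxes of \<open>r\<close> and of 0 differ by a multiple of \<open>r\<close>. The strip has width of order \<open>\<epsilon>\<close> and \<open>r\<close>
  vanishes near the curve in mean, hence the error is small.
\<close>

lemma kruzhkov_extend_by_zero:
  assumes z: "\<And>s t. \<bar>z s - z t\<bar> \<le> k * \<bar>s - t\<bar>" "0 \<le> k" and zc: "\<And>t. z t \<in> corridor"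
    and r: "bounded_density M r"
    and kr: "kruzhkov_on M F {p. 0 < fst p \<and> z (fst p) < snd p \<and> snd p < 1} r"
    and van: "vanishes_near 1 z r"
  shows "kruzhkov_on M F ({0<..} \<times> corridor) (\<lambda>p. if z (fst p) < snd p then r p else 0)"
  unfolding kruzhkov_on_def
proof (intro ballI allI impI, elim conjE)
  let ?u = "\<lambda>p. if z (fst p) < snd p then r p else 0"
  let ?U = "{p. 0 < fst p \<and> z (fst p) < snd p \<and> snd p < (1::real)}"
  fix \<kappa> \<phi> \<phi>t \<phi>x assume \<kappa>: "\<kappa> \<in> {0..M}" and \<phi>: "C1_test ({0<..} \<times> corridor) \<phi> \<phi>t \<phi>x" "\<forall>p. 0 \<le> \<phi> p"
  have dk: "bounded_density M (\<lambda>_. \<kappa>)" "bounded_density M (\<lambda>_. 0)" using \<kappa> M_nonneg by (auto intro: bounded_density_const)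
  have "k-lipschitz_on UNIV z" using z by (auto intro!: lipschitz_onI simp: dist_real_def)
  then have cz: "continuous_on UNIV z" by (rule lipschitz_on_continuous_on)
  have [measurable]: "z \<in> borel_measurable borel" using cz by (rule borel_measurable_continuous_onI)
  have m2: "(\<lambda>p::real \<times> real. fst p) \<in> borel_measurable borel" "(\<lambda>p::real \<times> real. snd p) \<in> borel_measurable borel"
    by (intro borel_measurable_continuous_onI continuous_on_fst continuous_on_snd continuous_on_id)+
  note [measurable] = m2 measurable_compose[OF m2(1), of z borel]
  have [measurable]: "r \<in> borel_measurable borel" using r by (simp add: bounded_density_def)
  have du: "bounded_density M ?u" using r M_nonneg by (auto simp: bounded_density_def)
  obtain B where B: "B > 0" "\<And>p. \<bar>\<phi> p\<bar> \<le> B" "\<And>p. \<bar>\<phi>t p\<bar> \<le> B" "\<And>p. \<bar>\<phi>x p\<bar> \<le> B"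
    using C1_test_bounded[OF \<phi>(1)] by blast
  obtain K where K: "compact K" "K \<subseteq> {0<..} \<times> corridor"
    "\<And>p. p \<notin> K \<Longrightarrow> \<phi> p = 0" "\<And>p. p \<notin> K \<Longrightarrow> \<phi>t p = 0" "\<And>p. p \<notin> K \<Longrightarrow> \<phi>x p = 0"
    using C1_test_support[OF \<phi>(1)] by metis
  obtain T where T: "T > 0" "\<And>p. p \<in> K \<Longrightarrow> fst p \<le> T"
  proof -
    obtain a where a: "a > 0" "\<And>p. p \<in> K \<Longrightarrow> norm p < a"
      using compact_imp_bounded[OF K(1)] bounded_pos_less by metis
    have "fst p \<le> a" if "p \<in> K" for p
      using a(2)[OF that] norm_fst_le[of "fst p" "snd p"] by simp
    with a(1) show thesis by (intro that[of a])
  qed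
  show "0 \<le> (LINT p|lborel. \<bar>?u p - \<kappa>\<bar> * \<phi>t p + entropy_flux F (?u p) \<kappa> * \<phi>x p)"
  proof (rule nonneg_if_ge_neg_multiples)
    fix e :: real assume "e > 0"
    obtain d where d: "d > 0"
      "\<And>w. 0 < w \<Longrightarrow> w < d \<Longrightarrow> (LINT p|lborel. indicator (strip 1 z T w) p * r p) \<le> e * w"
      using van[unfolded vanishes_near_def, rule_format, OF T(1) \<open>e > 0\<close>] by auto
    \<comment> \<open>The averaged curve is off by at most \<open>k * \<epsilon>\<close>; the strip must contain this uncertainty on both
      sides and the rise of the step over a length \<open>\<epsilon>\<close>, besides a margin \<open>\<epsilon>\<close> next to the curve that
      keeps the support of the cut-off test function compact.\<close>
    define \<epsilon> where "\<epsilon> = min 1 (d / (2 * (2 * k + 2)))"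
    define w where "w = (2 * k + 2) * \<epsilon>"
    have \<epsilon>: "0 < \<epsilon>" "\<epsilon> \<le> 1" using d(1) z(2) by (auto simp: \<epsilon>_def)
    have "w \<le> (2 * k + 2) * (d / (2 * (2 * k + 2)))"
      unfolding w_def using z(2) by (intro mult_left_mono) (auto simp: \<epsilon>_def)
    also have "\<dots> = d / 2" using z(2) by (simp add: field_simps)
    finally have w: "0 < w" "w < d" using \<epsilon> z(2) d(1) by (auto simp: w_def)
    obtain y y' where y: "\<And>t. (y has_real_derivative y' t) (at t)" "continuous_on UNIV y'"
      "\<And>t. \<bar>y t - z t\<bar> \<le> k * \<epsilon>" "\<And>t. \<bar>y' t\<bar> \<le> k"
      using averaged_curve_exists[OF z \<epsilon>(1)] by metis
    define \<theta> where "\<theta> p = (snd p - y (fst p)) / \<epsilon> - k - 1" for p :: "real \<times> real"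
    define \<eta> where "\<eta> p = smooth_step (\<theta> p)" for p
    define \<eta>t where "\<eta>t p = smooth_step' (\<theta> p) * (- y' (fst p) / \<epsilon>)" for p
    define \<eta>x where "\<eta>x p = smooth_step' (\<theta> p) / \<epsilon>" for p
    have low: "\<theta> p \<le> 0" if "snd p \<le> z (fst p) + \<epsilon>" for p
      using that y(3)[of "fst p"] \<epsilon>(1) unfolding \<theta>_def by (simp add: field_simps abs_le_iff)
    have high: "\<theta> p \<ge> 1" if "snd p \<ge> z (fst p) + w" for p
      using that y(3)[of "fst p"] \<epsilon>(1) unfolding \<theta>_def w_def by (simp add: field_simps abs_le_iff)
    have d\<theta>: "(\<theta> has_derivative (\<lambda>h. (snd h - y' (fst p) * fst h) / \<epsilon>)) (at p)" for p
    proof -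
      have "((\<lambda>p. y (fst p)) has_derivative (\<lambda>h. y' (fst p) * fst h)) (at p)"
        by (rule has_derivative_compose[of fst fst p UNIV y "\<lambda>h. y' (fst p) * h"])
          (use y(1) in \<open>auto intro!: derivative_eq_intros simp: has_field_derivative_def\<close>)
      then show ?thesis unfolding \<theta>_def[abs_def] using \<epsilon>(1) by (auto intro!: derivative_eq_intros simp: fun_eq_iff)
    qed
    have d\<eta>: "(\<eta> has_derivative (\<lambda>h. fst h * \<eta>t p + snd h * \<eta>x p)) (at p)" for p
      unfolding \<eta>_def[abs_def]
      by (rule has_derivative_eq_rhs[OF has_derivative_compose[OF d\<theta>
            smooth_step_has_derivative[unfolded has_field_derivative_def]]])
        (use \<epsilon>(1) in \<open>auto simp: \<eta>t_def \<eta>x_def field_simps fun_eq_iff\<close>)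
    have cy: "continuous_on UNIV y" using DERIV_isCont[OF y(1)] by (simp add: continuous_at_imp_continuous_on)
    have c\<theta>: "continuous_on UNIV \<theta>"
      unfolding \<theta>_def[abs_def] using \<epsilon>(1) by (auto intro!: continuous_intros continuous_on_compose2[OF cy])
    have c\<eta>: "continuous_on UNIV \<eta>t" "continuous_on UNIV \<eta>x"
      unfolding \<eta>t_def[abs_def] \<eta>x_def[abs_def] using \<epsilon>(1)
      by (auto intro!: continuous_intros continuous_on_compose2[OF y(2)] continuous_on_compose2[OF smooth_step_continuous(2) c\<theta>])
    have b\<eta>: "\<bar>\<eta>t p\<bar> \<le> 2 * k / \<epsilon>" "\<bar>\<eta>x p\<bar> \<le> 2 / \<epsilon>" for p
    proof -
      have "\<bar>smooth_step' (\<theta> p) * y' (fst p)\<bar> \<le> 2 * k"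
        unfolding abs_mult using smooth_step'_bounds[of "\<theta> p"] y(4)[of "fst p"] by (intro mult_mono) auto
      then show "\<bar>\<eta>t p\<bar> \<le> 2 * k / \<epsilon>"
        using \<epsilon>(1) by (simp add: \<eta>t_def abs_mult divide_right_mono)
      show "\<bar>\<eta>x p\<bar> \<le> 2 / \<epsilon>"
        using \<epsilon>(1) smooth_step'_bounds[of "\<theta> p"] by (simp add: \<eta>x_def divide_right_mono)
    qed
    have T1: "C1_test ?U (\<lambda>p. \<phi> p * \<eta> p) (\<lambda>p. \<phi>t p * \<eta> p + \<phi> p * \<eta>t p) (\<lambda>p. \<phi>x p * \<eta> p + \<phi> p * \<eta>x p)"
    proof (rule C1_test_mult[OF \<phi>(1) d\<eta> c\<eta>])
      have "closed {p. z (fst p) + \<epsilon> \<le> snd p}"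
        by (intro closed_Collect_le continuous_intros continuous_on_compose2[OF cz]) auto
      then show "compact (K \<inter> {p. z (fst p) + \<epsilon> \<le> snd p})" using K(1) by blast
      show "K \<inter> {p. z (fst p) + \<epsilon> \<le> snd p} \<subseteq> ?U" using K(2) \<epsilon>(1) by (auto simp: subset_iff)
      show "\<phi> p * \<eta> p = 0" if "p \<notin> K \<inter> {p. z (fst p) + \<epsilon> \<le> snd p}" for p
        using that K(3)[of p] low[of p] by (auto simp: \<eta>_def smooth_step_low)
    qed
    have T2: "C1_test ({0<..} \<times> corridor) (\<lambda>p. \<phi> p * (1 - \<eta> p)) (\<lambda>p. \<phi>t p * (1 - \<eta> p) + \<phi> p * (- \<eta>t p))
       (\<lambda>p. \<phi>x p * (1 - \<eta> p) + \<phi> p * (- \<eta>x p))"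
    proof (rule C1_test_mult[OF \<phi>(1) _ _ _ K(1,2)])
      show "((\<lambda>p. 1 - \<eta> p) has_derivative (\<lambda>h. fst h * - \<eta>t p + snd h * - \<eta>x p)) (at p)" for p
        by (rule has_derivative_eq_rhs[OF has_derivative_diff[OF has_derivative_const d\<eta>]]) auto
    qed (use c\<eta> K(3) in \<open>auto intro: continuous_on_minus\<close>)
    note i1 = C1_test_integrable[OF T1] and i2 = C1_test_integrable[OF T2] and i0 = C1_test_integrable[OF \<phi>(1)]
    let ?q = "\<lambda>a. entropy_flux F a \<kappa>"
    let ?g = "\<lambda>p. (\<bar>r p - \<kappa>\<bar> * (\<phi>t p * \<eta> p + \<phi> p * \<eta>t p) + ?q (r p) * (\<phi>x p * \<eta> p + \<phi> p * \<eta>x p)) +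
        (\<bar>0 - \<kappa>\<bar> * (\<phi>t p * (1 - \<eta> p) + \<phi> p * (- \<eta>t p)) + ?q 0 * (\<phi>x p * (1 - \<eta> p) + \<phi> p * (- \<eta>x p)))"
    let ?C = "B * (1 + L) * (1 + 2 * (k + 1) / \<epsilon>)"
    let ?S = "strip 1 z T w"
    have "bounded ?S"
      by (rule strip_bounded[of z 1]) (use zc in \<open>auto simp: abs_le_iff less_imp_le\<close>)
    then have iS: "integrable lborel (\<lambda>p. indicator ?S p * r p)"
      using r strip_borel[OF cz] by (intro integrable_indicator_bounded[of r M]) (auto simp: bounded_density_def)
    have "- (?C * (e * w)) \<le> (LINT p|lborel. \<bar>?u p - \<kappa>\<bar> * \<phi>t p + ?q (?u p) * \<phi>x p)"
    proof (rule LINT_ge_of_error)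
      show "integrable lborel (\<lambda>p. \<bar>?u p - \<kappa>\<bar> * \<phi>t p + ?q (?u p) * \<phi>x p)"
        by (intro Bochner_Integration.integrable_add integrable_entropy_terms du dk i0)
      have a: "integrable lborel (\<lambda>p. \<bar>r p - \<kappa>\<bar> * (\<phi>t p * \<eta> p + \<phi> p * \<eta>t p) + ?q (r p) * (\<phi>x p * \<eta> p + \<phi> p * \<eta>x p))"
        by (intro Bochner_Integration.integrable_add integrable_entropy_terms r dk i1)
      have b: "integrable lborel (\<lambda>p. \<bar>0 - \<kappa>\<bar> * (\<phi>t p * (1 - \<eta> p) + \<phi> p * (- \<eta>t p)) + ?q 0 * (\<phi>x p * (1 - \<eta> p) + \<phi> p * (- \<eta>x p)))"
        by (intro Bochner_Integration.integrable_add integrable_mult_right i2)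
      show "integrable lborel ?g" by (rule Bochner_Integration.integrable_add[OF a b])
      have "integral\<^sup>L lborel ?g =
        (LINT p|lborel. \<bar>r p - \<kappa>\<bar> * (\<phi>t p * \<eta> p + \<phi> p * \<eta>t p) + ?q (r p) * (\<phi>x p * \<eta> p + \<phi> p * \<eta>x p)) +
        (\<bar>0 - \<kappa>\<bar> * (LINT p|lborel. \<phi>t p * (1 - \<eta> p) + \<phi> p * (- \<eta>t p)) + ?q 0 * (LINT p|lborel. \<phi>x p * (1 - \<eta> p) + \<phi> p * (- \<eta>x p)))"
        using a b i2 by (simp only: Bochner_Integration.integral_add integrable_mult_right integral_mult_right_zero)
      also have "\<dots> = (LINT p|lborel. \<bar>r p - \<kappa>\<bar> * (\<phi>t p * \<eta> p + \<phi> p * \<eta>t p) + ?q (r p) * (\<phi>x p * \<eta> p + \<phi> p * \<eta>x p))"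
        unfolding C1_test_integral_derivative[OF T2] by simp
      also have "\<dots> \<ge> 0"
        using kr[unfolded kruzhkov_on_def, rule_format, OF \<kappa>, of "\<lambda>p. \<phi> p * \<eta> p"] T1 \<phi>(2) smooth_step_bounds
        by (simp add: \<eta>_def)
      finally show "0 \<le> integral\<^sup>L lborel ?g" .
      show "integrable lborel (\<lambda>p. ?C * (indicator ?S p * r p))" by (rule integrable_mult_right[OF iS])
      have "0 \<le> ?C" using B(1) L_nonneg z(2) \<epsilon>(1) by (intro mult_nonneg_nonneg add_nonneg_nonneg) auto
      then show "(LINT p|lborel. ?C * (indicator ?S p * r p)) \<le> ?C * (e * w)"
        using d(2)[OF w] by (simp only: integral_mult_right_zero mult_left_mono)
      fix p
      \<comment> \<open>The entropy pair of \<open>r\<close> minus that of the state 0.\<close>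
      define da where "da = \<bar>r p - \<kappa>\<bar> - \<bar>0 - \<kappa>\<bar>"
      define dq where "dq = ?q (r p) - ?q 0"
      have r0: "0 \<le> r p" using r unfolding bounded_density_def by blast
      have da: "\<bar>da\<bar> \<le> r p" unfolding da_def using r0 by linarith
      have dq: "\<bar>dq\<bar> \<le> L * r p" unfolding dq_def using entropy_flux_lipschitz[of "r p" \<kappa> 0] r0 by simp
      show "?g p - ?C * (indicator ?S p * r p) \<le> \<bar>?u p - \<kappa>\<bar> * \<phi>t p + ?q (?u p) * \<phi>x p"
      proof (cases "p \<in> K")
        case False
        then show ?thesis using K(3-5) r0 \<open>0 \<le> ?C\<close> by simp
      next
        case True
        then have pt: "0 < fst p" "fst p \<le> T" using K(2) T(2) by auto
        consider "snd p \<le> z (fst p)" | "snd p \<ge> z (fst p) + w" | "z (fst p) < snd p" "snd p < z (fst p) + w"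
          by linarith
        then show ?thesis
        proof cases
          case 1
          then have "\<theta> p \<le> 0" using low[of p] \<epsilon>(1) by simp
          then have "\<eta> p = 0" "\<eta>t p = 0" "\<eta>x p = 0"
            by (auto simp: \<eta>_def \<eta>t_def \<eta>x_def smooth_step_low)
          moreover have "p \<notin> ?S" using 1 by (auto simp: strip_def)
          ultimately show ?thesis using 1 by simp
        next
          case 2
          then have "\<theta> p \<ge> 1" using high[of p] by simp
          then have "\<eta> p = 1" "\<eta>t p = 0" "\<eta>x p = 0"
            by (auto simp: \<eta>_def \<eta>t_def \<eta>x_def smooth_step_high)
          moreover have "p \<notin> ?S" "z (fst p) < snd p" using 2 w by (auto simp: strip_def)
          ultimately show ?thesis by simp
        next
          case 3
          then have pS: "p \<in> ?S" using pt by (auto simp: strip_def)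
          have s: "\<bar>1 - \<eta> p\<bar> \<le> 1" using smooth_step_bounds[of "\<theta> p"] by (auto simp: \<eta>_def)
          have et: "\<bar>\<phi>t p * (1 - \<eta> p) + \<phi> p * (- \<eta>t p)\<bar> \<le> B * 1 + B * (2 * k / \<epsilon>)"
            using mult_mono[OF B(3)[of p] s] mult_mono[OF B(2)[of p] b\<eta>(1)[of p]] B(1)
            by (intro order_trans[OF abs_triangle_ineq add_mono]) (auto simp: abs_mult)
          have ex: "\<bar>\<phi>x p * (1 - \<eta> p) + \<phi> p * (- \<eta>x p)\<bar> \<le> B * 1 + B * (2 / \<epsilon>)"
            using mult_mono[OF B(4)[of p] s] mult_mono[OF B(2)[of p] b\<eta>(2)[of p]] B(1)
            by (intro order_trans[OF abs_triangle_ineq add_mono]) (auto simp: abs_mult)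
          have bb: "B * 1 + B * (2 * k / \<epsilon>) \<le> B * (1 + 2 * (k + 1) / \<epsilon>)" "B * 1 + B * (2 / \<epsilon>) \<le> B * (1 + 2 * (k + 1) / \<epsilon>)"
            using B(1) \<epsilon>(1) z(2) by (auto simp: field_simps)
          have "\<bar>da * (\<phi>t p * (1 - \<eta> p) + \<phi> p * (- \<eta>t p))\<bar> \<le> r p * (B * (1 + 2 * (k + 1) / \<epsilon>))"
            unfolding abs_mult using da r0 by (intro mult_mono order_trans[OF et bb(1)]) auto
          moreover have "\<bar>dq * (\<phi>x p * (1 - \<eta> p) + \<phi> p * (- \<eta>x p))\<bar> \<le> L * r p * (B * (1 + 2 * (k + 1) / \<epsilon>))"
            unfolding abs_mult using dq r0 L_nonneg by (intro mult_mono order_trans[OF ex bb(2)]) auto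
          moreover have "?C * (indicator ?S p * r p) = r p * (B * (1 + 2 * (k + 1) / \<epsilon>)) + L * r p * (B * (1 + 2 * (k + 1) / \<epsilon>))"
            using pS by (simp add: algebra_simps add_divide_distrib)
          moreover have "?g p = \<bar>?u p - \<kappa>\<bar> * \<phi>t p + ?q (?u p) * \<phi>x p
              - da * (\<phi>t p * (1 - \<eta> p) + \<phi> p * (- \<eta>t p)) - dq * (\<phi>x p * (1 - \<eta> p) + \<phi> p * (- \<eta>x p))"
            using 3 unfolding da_def dq_def by (simp add: algebra_simps)
          ultimately show ?thesis by linarith
        qed
      qed
    qed
    moreover have "?C * (e * w) \<le> B * (1 + L) * (1 + 2 * (k + 1)) * (2 * k + 2) * e"
    proof -
      have "(1 + 2 * (k + 1) / \<epsilon>) * \<epsilon> \<le> 1 + 2 * (k + 1)"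
        using \<epsilon> by (simp add: field_simps)
      then have "B * (1 + L) * (2 * k + 2) * e * ((1 + 2 * (k + 1) / \<epsilon>) * \<epsilon>) \<le> B * (1 + L) * (2 * k + 2) * e * (1 + 2 * (k + 1))"
        using B(1) L_nonneg z(2) \<open>e > 0\<close> by (intro mult_left_mono) auto
      then show ?thesis unfolding w_def by (simp only: mult.assoc mult.commute mult.left_commute)
    qed
    ultimately show "- (B * (1 + L) * (1 + 2 * (k + 1)) * (2 * k + 2) * e) \<le> (LINT p|lborel. \<bar>?u p - \<kappa>\<bar> * \<phi>t p + ?q (?u p) * \<phi>x p)"
      by linarith
  qed
qed

end

section \<open>Doubling of variables\<close>

text \<open>
  Measurable functions are limits almost everywhere of continuous ones; truncated to \<open>[0, M]\<close>, these
  converge in the mean on bounded sets.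
\<close>

lemma continuous_approximation_L1:
  fixes w :: "'a::euclidean_space \<Rightarrow> real"
  assumes w: "w \<in> borel_measurable borel" "\<And>p. 0 \<le> w p \<and> w p \<le> M" and K: "compact K" and "e > 0"
  obtains g where "continuous_on UNIV g" "\<And>p. 0 \<le> g p \<and> g p \<le> M"
    "(LINT p|lborel. indicator K p * \<bar>w p - g p\<bar>) < e"
proof -
  have M: "0 \<le> M" using w(2) order_trans by blast
  have "w measurable_on UNIV"
    using w by (intro lebesgue_measurable_imp_measurable_on_nnreal_UNIV) (auto intro!: measurable_completion)
  then obtain N g where N: "negligible N" and g: "\<And>n. continuous_on UNIV (g n)"
    "\<And>x. x \<notin> N \<Longrightarrow> (\<lambda>n. g n x) \<longlonglongrightarrow> w x"
    unfolding measurable_on_def by auto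
  define h where "h n x = max 0 (min M (g n x))" for n x
  have hc: "continuous_on UNIV (h n)" for n
    unfolding h_def[abs_def] using g(1) by (intro continuous_intros)
  have hb: "0 \<le> h n p \<and> h n p \<le> M" for n p using M by (auto simp: h_def)
  have hl: "(\<lambda>n. h n x) \<longlonglongrightarrow> w x" if "x \<notin> N" for x
  proof -
    have "(\<lambda>n. h n x) \<longlonglongrightarrow> max 0 (min M (w x))"
      unfolding h_def using g(2)[OF that] by (intro tendsto_intros)
    moreover have "max 0 (min M (w x)) = w x" using w(2)[of x] by auto
    ultimately show ?thesis by simp
  qed
  have AEN: "AE x in lborel. x \<notin> N"
    using AE_not_in[OF N[unfolded negligible_iff_null_sets]] by (simp only: AE_completion_iff)
  have mK [measurable]: "K \<in> sets borel" using compact_imp_closed[OF K] by auto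
  have [measurable]: "w \<in> borel_measurable borel" "h n \<in> borel_measurable borel" for n
    using w(1) borel_measurable_continuous_onI[OF hc] by auto
  have "(\<lambda>n. LINT p|lborel. indicator K p * \<bar>w p - h n p\<bar>) \<longlonglongrightarrow> (LINT p::'a|lborel. (0::real))"
  proof (rule integral_dominated_convergence)
    show "integrable lborel (\<lambda>p. indicator K p * M)"
      using emeasure_bounded_finite[OF compact_imp_bounded[OF K]]
      by (intro integrable_mult_left integrable_real_indicator) auto
    show "AE x in lborel. (\<lambda>n. indicator K x * \<bar>w x - h n x\<bar>) \<longlonglongrightarrow> 0"
    proof (rule AE_mp[OF AEN], rule AE_I2, rule impI)
      fix x assume "x \<notin> N"
      then have "(\<lambda>n. indicator K x * \<bar>w x - h n x\<bar>) \<longlonglongrightarrow> indicator K x * \<bar>w x - w x\<bar>"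
        by (intro tendsto_intros hl)
      then show "(\<lambda>n. indicator K x * \<bar>w x - h n x\<bar>) \<longlonglongrightarrow> 0" by simp
    qed
    show "AE x in lborel. norm (indicator K x * \<bar>w x - h n x\<bar>) \<le> indicator K x * M" for n
      using w(2) hb[of n] by (intro AE_I2) (auto split: split_indicator, smt (verit))
  qed measurable
  then have "\<forall>\<^sub>F n in sequentially. (LINT p|lborel. indicator K p * \<bar>w p - h n p\<bar>) < e"
    using \<open>e > 0\<close> by (auto dest: order_tendstoD(2))
  then obtain n where "(LINT p|lborel. indicator K p * \<bar>w p - h n p\<bar>) < e"
    by (auto simp: eventually_sequentially)
  then show thesis using that[of "h n"] hc hb by blast
qed

lemma open_half_strip: "open ({0<..} \<times> corridor :: (real \<times> real) set)"
  by (intro open_Times) auto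

context lipschitz_flux
begin

lemma bounded_density_bounds:
  assumes "bounded_density M u" "bounded_density M w"
  shows "\<bar>u p - w q\<bar> \<le> M" "\<bar>entropy_flux F (u p) (w q)\<bar> \<le> L * M"
proof -
  show b: "\<bar>u p - w q\<bar> \<le> M" using assms unfolding bounded_density_def by (smt (verit))
  show "\<bar>entropy_flux F (u p) (w q)\<bar> \<le> L * M"
    using entropy_flux_bound order_trans mult_left_mono[OF b L_nonneg] by blast
qed

text \<open>
  The test function \<open>\<psi>(p) P(p, q)\<close>, with a mollifier \<open>P\<close> that depends on \<open>p - q\<close> only, carries \<open>\<psi>\<close> in
  one of the two variables. Adding the inequality for \<open>u\<close> in \<open>p\<close> with constant \<open>w(q)\<close> to the one for
  \<open>w\<close> in \<open>q\<close> with constant \<open>u(p)\<close>, the derivatives of \<open>P\<close> cancel exactly, since they are opposite in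
  \<open>p\<close> and in \<open>q\<close>. What remains contains \<open>w\<close> at \<open>q\<close> in place of \<open>p\<close>; replacing \<open>w\<close> by a continuous \<open>g\<close> that is
  close to it in \<open>L\<^sup>1\<close> shows that this difference is small in the mean.
\<close>

lemma kruzhkov_doubling:
  assumes "open U" and u: "bounded_density M u" and w: "bounded_density M w"
    and ku: "kruzhkov_on M F U u" and kw: "kruzhkov_on M F U w"
    and \<psi>: "C1_test U \<psi> \<psi>t \<psi>x" "\<And>p. 0 \<le> \<psi> p"
  shows "0 \<le> (LINT p|lborel. \<bar>u p - w p\<bar> * \<psi>t p + entropy_flux F (u p) (w p) * \<psi>x p)"
proof -
  let ?q = "entropy_flux F"
  obtain B where B: "B > 0" "\<And>p. \<bar>\<psi> p\<bar> \<le> B" "\<And>p. \<bar>\<psi>t p\<bar> \<le> B" "\<And>p. \<bar>\<psi>x p\<bar> \<le> B"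
    using C1_test_bounded[OF \<psi>(1)] by metis
  obtain K where K: "compact K" "K \<subseteq> U"
    "\<And>p. p \<notin> K \<Longrightarrow> \<psi> p = 0" "\<And>p. p \<notin> K \<Longrightarrow> \<psi>t p = 0" "\<And>p. p \<notin> K \<Longrightarrow> \<psi>x p = 0"
    using C1_test_support[OF \<psi>(1)] by metis
  note D = C1_testD[OF \<psi>(1)]
  obtain d0 where d0: "d0 > 0" "thicken d0 K \<subseteq> U" using thicken_subset_open[OF K(1) \<open>open U\<close> K(2)] by blast
  define K' where "K' = thicken d0 K"
  have K': "compact K'" "K \<subseteq> K'" using compact_thicken[OF K(1)] subset_thicken[of d0 K] d0(1) by (auto simp: K'_def)
  have [measurable]: "K \<in> sets borel" "K' \<in> sets borel"
    using compact_imp_closed[OF K(1)] compact_imp_closed[OF K'(1)] by auto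
  have [measurable]: "u \<in> borel_measurable borel" "w \<in> borel_measurable borel"
    using u w by (auto simp: bounded_density_def)
  have m2: "(\<lambda>x::(real \<times> real) \<times> (real \<times> real). fst x) \<in> borel_measurable borel"
    "(\<lambda>x::(real \<times> real) \<times> (real \<times> real). snd x) \<in> borel_measurable borel"
    by (intro borel_measurable_continuous_onI continuous_on_fst continuous_on_snd continuous_on_id)+
  have finK: "emeasure lborel K < \<infinity>" by (rule emeasure_bounded_finite[OF compact_imp_bounded[OF K(1)]])
  show ?thesis
  proof (rule nonneg_if_ge_neg_multiples)
    fix e :: real assume "e > 0"
    obtain g where g: "continuous_on UNIV g" "\<And>p. 0 \<le> g p \<and> g p \<le> M"
      "(LINT p|lborel. indicator K' p * \<bar>w p - g p\<bar>) < e"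
      using continuous_approximation_L1[of w M K' e] w K'(1) \<open>e > 0\<close> unfolding bounded_density_def by metis
    have [measurable]: "g \<in> borel_measurable borel" using g(1) by (rule borel_measurable_continuous_onI)
    have "uniformly_continuous_on K' g"
      using g(1) K'(1) by (intro compact_uniformly_continuous) (auto intro: continuous_on_subset)
    then obtain d1 where d1: "d1 > 0"
      "\<And>p q. p \<in> K' \<Longrightarrow> q \<in> K' \<Longrightarrow> dist q p < d1 \<Longrightarrow> dist (g q) (g p) < e"
      using \<open>e > 0\<close> unfolding uniformly_continuous_on_def by metis
    define h where "h = min d0 (d1 / 3)"
    have h: "0 < h" "h \<le> d0" "h \<le> d1 / 3" using d0(1) d1(1) by (auto simp: h_def)
    obtain j j' where m: "mollifier h j j'" using mollifier_exists[OF h(1)] by blast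
    note J = mollifierD[OF m]
    define P where "P = product_kernel j j"
    define Pt where "Pt = product_kernel j' j"
    define Px where "Px = product_kernel j j'"
    have P0: "0 \<le> P p q" for p q by (simp add: P_def product_kernel_def J(5))
    have Pz: "P p q = 0" "Pt p q = 0" "Px p q = 0" if "p \<in> K" "q \<notin> K'" for p q
    proof -
      have "q \<notin> thicken h K" using that(2) thicken_mono[OF h(2), of K] by (auto simp: K'_def)
      then have "\<bar>fst p - fst q\<bar> > h \<or> \<bar>snd p - snd q\<bar> > h"
        using that(1) by (force simp: in_thicken_iff abs_minus_commute not_le)
      then show "P p q = 0" "Pt p q = 0" "Px p q = 0"
        using J(6) mollifier_derivative_support[OF m]
        unfolding P_def Pt_def Px_def product_kernel_def by (auto dest: less_imp_le)
    qed
    have cP: "continuous_on UNIV (\<lambda>x::(real \<times> real) \<times> (real \<times> real). P (fst x) (snd x))"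
      "continuous_on UNIV (\<lambda>x::(real \<times> real) \<times> (real \<times> real). Pt (fst x) (snd x))"
      "continuous_on UNIV (\<lambda>x::(real \<times> real) \<times> (real \<times> real). Px (fst x) (snd x))"
      unfolding P_def Pt_def Px_def by (intro product_kernel_continuous J continuous_intros)+
    have c\<psi>: "continuous_on UNIV (\<lambda>x::(real \<times> real) \<times> (real \<times> real). \<psi> (fst x))"
      "continuous_on UNIV (\<lambda>x::(real \<times> real) \<times> (real \<times> real). \<psi>t (fst x))"
      "continuous_on UNIV (\<lambda>x::(real \<times> real) \<times> (real \<times> real). \<psi>x (fst x))"
      by (intro continuous_on_compose2[OF D(2)] continuous_on_compose2[OF D(3)] continuous_on_compose2[OF D(4)]
          continuous_intros subset_UNIV)+
    let ?du = "\<lambda>x. \<bar>u (fst x) - w (snd x)\<bar>" and ?dq = "\<lambda>x. ?q (u (fst x)) (w (snd x))"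
    have mdu: "?du \<in> borel_measurable borel" "?dq \<in> borel_measurable borel"
      using measurable_compose[OF m2(1), of u borel] measurable_compose[OF m2(2), of w borel] by measurable
    have int4: "integrable lborel (\<lambda>x. ?du x * a x)" "integrable lborel (\<lambda>x. ?dq x * a x)"
      if "continuous_on UNIV a" "\<And>p q. p \<notin> K \<or> q \<notin> K' \<Longrightarrow> a (p, q) = 0" for a
    proof -
      have "integrable lborel a"
        by (rule continuous_compact_support_integrable[OF that(1) compact_Times[OF K(1) K'(1)]])
          (use that(2) in auto)
      then show "integrable lborel (\<lambda>x. ?du x * a x)" "integrable lborel (\<lambda>x. ?dq x * a x)"
        using bounded_density_bounds[OF u w] mdu
        by (auto intro!: integrable_mult_bounded[of _ a ?du M] integrable_mult_bounded[of _ a ?dq "L * M"])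
    qed
    \<comment> \<open>\<open>?G1\<close> and \<open>?G2\<close> are the integrands of the two inequalities, \<open>?H\<close> is their sum.\<close>
    let ?a1 = "\<lambda>x. \<psi>t (fst x) * P (fst x) (snd x) + \<psi> (fst x) * Pt (fst x) (snd x)"
    let ?b1 = "\<lambda>x. \<psi>x (fst x) * P (fst x) (snd x) + \<psi> (fst x) * Px (fst x) (snd x)"
    let ?a2 = "\<lambda>x. \<psi> (fst x) * (- Pt (fst x) (snd x))"
    let ?b2 = "\<lambda>x. \<psi> (fst x) * (- Px (fst x) (snd x))"
    let ?a3 = "\<lambda>x. \<psi>t (fst x) * P (fst x) (snd x)"
    let ?b3 = "\<lambda>x. \<psi>x (fst x) * P (fst x) (snd x)"
    let ?G1 = "\<lambda>x. ?du x * ?a1 x + ?dq x * ?b1 x"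
    let ?G2 = "\<lambda>x. ?du x * ?a2 x + ?dq x * ?b2 x"
    let ?H = "\<lambda>x. ?du x * ?a3 x + ?dq x * ?b3 x"
    have off: "\<psi> p * Pt p q = 0" "\<psi> p * Px p q = 0" "\<psi>t p * P p q = 0" "\<psi>x p * P p q = 0"
      if "p \<notin> K \<or> q \<notin> K'" for p q
      using that K(3-5)[of p] Pz[of p q] by (cases "p \<in> K"; simp)+
    have iG1: "integrable lborel ?G1"
      by (intro Bochner_Integration.integrable_add int4 continuous_intros cP c\<psi>) (simp_all only: fst_conv snd_conv mult_minus_right off add_0_right minus_zero)
    have iG2: "integrable lborel ?G2"
      by (intro Bochner_Integration.integrable_add int4 continuous_intros cP c\<psi>) (simp_all only: fst_conv snd_conv mult_minus_right off add_0_right minus_zero)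
    have iH: "integrable lborel ?H"
      by (intro Bochner_Integration.integrable_add int4 continuous_intros cP c\<psi>) (simp_all only: fst_conv snd_conv mult_minus_right off add_0_right minus_zero)
    have "0 \<le> (LINT p|lborel. ?G1 (p, q))" for q
    proof -
      have T: "C1_test U (\<lambda>p. \<psi> p * P p q) (\<lambda>p. \<psi>t p * P p q + \<psi> p * Pt p q) (\<lambda>p. \<psi>x p * P p q + \<psi> p * Px p q)"
        unfolding P_def Pt_def Px_def
        by (rule C1_test_mult[OF \<psi>(1) product_kernel_has_derivative(1)[OF J(2) J(2)] _ _ K(1,2)])
          (use K(3) in \<open>auto intro!: product_kernel_continuous J continuous_intros\<close>)
      show ?thesis
        using kruzhkov_onD[OF ku bounded_densityD(2,3)[OF w] T mult_nonneg_nonneg[OF \<psi>(2) P0]] by simp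
    qed
    then have G1: "0 \<le> integral\<^sup>L lborel ?G1"
      unfolding lborel_fubini(2)[OF iG1] by (rule Bochner_Integration.integral_nonneg)
    have "0 \<le> (LINT q|lborel. ?G2 (p, q))" for p
    proof -
      have T: "C1_test U (\<lambda>q. \<psi> p * P p q) (\<lambda>q. \<psi> p * (- Pt p q)) (\<lambda>q. \<psi> p * (- Px p q))"
        unfolding C1_test_def
      proof (intro conjI allI)
        fix q
        have "((\<lambda>q. \<psi> p * P p q) has_derivative (\<lambda>h. \<psi> p * (fst h * (- Pt p q) + snd h * (- Px p q)))) (at q)"
          unfolding P_def Pt_def Px_def
          by (rule has_derivative_mult_right[OF product_kernel_has_derivative(2)[OF J(2) J(2)]])
        then show "((\<lambda>q. \<psi> p * P p q) has_derivative (\<lambda>h. fst h * (\<psi> p * (- Pt p q)) + snd h * (\<psi> p * (- Px p q)))) (at q)"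
          by (rule has_derivative_eq_rhs) (auto simp: algebra_simps)
      next
        show "continuous_on UNIV (\<lambda>q. \<psi> p * (- Pt p q))" "continuous_on UNIV (\<lambda>q. \<psi> p * (- Px p q))"
          unfolding Pt_def Px_def by (intro continuous_intros product_kernel_continuous J)+
        show "\<exists>K. compact K \<and> K \<subseteq> U \<and> (\<forall>q. q \<notin> K \<longrightarrow> \<psi> p * P p q = 0)"
          using K'(1) d0(2) K(3)[of p] Pz(1)[of p] unfolding K'_def by (intro exI[of _ "thicken d0 K"]) auto
      qed
      have "0 \<le> (LINT q|lborel. \<bar>w q - u p\<bar> * (\<psi> p * (- Pt p q)) + ?q (w q) (u p) * (\<psi> p * (- Px p q)))"
        by (rule kruzhkov_onD[OF kw bounded_densityD(2,3)[OF u] T mult_nonneg_nonneg[OF \<psi>(2) P0]])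
      then show ?thesis by (simp add: abs_minus_commute entropy_flux_commute[of F "u p"])
    qed
    then have G2: "0 \<le> integral\<^sup>L lborel ?G2"
      unfolding lborel_fubini(1)[OF iG2] by (rule Bochner_Integration.integral_nonneg)
    have "integral\<^sup>L lborel ?H = integral\<^sup>L lborel ?G1 + integral\<^sup>L lborel ?G2"
      using iG1 iG2 by (subst Bochner_Integration.integral_add[symmetric]) (auto simp: algebra_simps)
    then have H: "0 \<le> integral\<^sup>L lborel ?H" using G1 G2 by simp
    \<comment> \<open>Bounds the mean of \<open>\<bar>w q - w p\<bar>\<close> under \<open>P\<close>: go from \<open>w q\<close> to \<open>g q\<close>, to \<open>g p\<close>, to \<open>w p\<close>.\<close>
    let ?E = "\<lambda>x. P (fst x) (snd x) * (indicator K' (snd x) * \<bar>w (snd x) - g (snd x)\<bar>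
        + indicator K (fst x) * e + indicator K (fst x) * \<bar>w (fst x) - g (fst x)\<bar>)"
    have iPK: "integrable lborel (\<lambda>x. P (fst x) (snd x) * (indicator A (fst x) * a x))"
      "integrable lborel (\<lambda>x. P (fst x) (snd x) * (indicator A (snd x) * a x))"
      if [measurable]: "a \<in> borel_measurable borel" and "\<And>x. \<bar>a x\<bar> \<le> c" and A: "compact A" for a c A
    proof -
      have [measurable]: "A \<in> sets borel" using compact_imp_closed[OF A] by auto
      have cA: "compact (thicken h A)" by (rule compact_thicken[OF A])
      have [measurable]: "(\<lambda>x::(real \<times> real) \<times> (real \<times> real). indicator A (fst x) :: real) \<in> borel_measurable borel"
        "(\<lambda>x::(real \<times> real) \<times> (real \<times> real). indicator A (snd x) :: real) \<in> borel_measurable borel"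
        "(\<lambda>x::(real \<times> real) \<times> (real \<times> real). P (fst x) (snd x)) \<in> borel_measurable borel"
        using measurable_compose[OF m2(1), of "indicator A" borel] measurable_compose[OF m2(2), of "indicator A" borel]
          borel_measurable_continuous_onI[OF cP(1)] by auto
      obtain bj where bj: "bj > 0" "\<And>x. \<bar>j x\<bar> \<le> bj"
      proof (rule continuous_compact_support_bounded[OF J(3), of "{-h..h}"])
        show "j x = 0" if "x \<notin> {-h..h}" for x using that by (intro J(6)) auto
      qed auto
      have bP: "\<bar>P p q\<bar> \<le> bj * bj" for p q
        unfolding P_def product_kernel_def abs_mult using bj by (intro mult_mono) auto
      have c0: "0 \<le> c" using that(2) abs_ge_zero order_trans by blast
      have far: "P p q = 0" if "\<not> (\<bar>fst p - fst q\<bar> \<le> h \<and> \<bar>snd p - snd q\<bar> \<le> h)" for p q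
        using that J(6) by (auto simp: P_def product_kernel_def not_le dest: less_imp_le)
      have bd: "\<bar>P p q * (indicator A r * a x)\<bar> \<le> bj * bj * c" for p q r x
        unfolding abs_mult using bP[of p q] that(2)[of x] c0 bj(1)
        by (intro mult_mono) (auto split: split_indicator)
      show "integrable lborel (\<lambda>x. P (fst x) (snd x) * (indicator A (fst x) * a x))"
      proof (rule integrable_bounded_support[where K = "A \<times> thicken h A"])
        show "bounded (A \<times> thicken h A)" by (intro compact_imp_bounded compact_Times A cA)
        fix x :: "(real \<times> real) \<times> (real \<times> real)" assume "x \<notin> A \<times> thicken h A"
        then show "P (fst x) (snd x) * (indicator A (fst x) * a x) = 0"
          using far[of "fst x" "snd x"] by (cases x) (auto simp: in_thicken_iff abs_minus_commute split: split_indicator)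
      qed (use bd in auto)
      show "integrable lborel (\<lambda>x. P (fst x) (snd x) * (indicator A (snd x) * a x))"
      proof (rule integrable_bounded_support[where K = "thicken h A \<times> A"])
        show "bounded (thicken h A \<times> A)" by (intro compact_imp_bounded compact_Times A cA)
        fix x :: "(real \<times> real) \<times> (real \<times> real)" assume "x \<notin> thicken h A \<times> A"
        then show "P (fst x) (snd x) * (indicator A (snd x) * a x) = 0"
          using far[of "fst x" "snd x"] by (cases x) (auto simp: in_thicken_iff split: split_indicator)
      qed (use bd in auto)
    qed
    have wg: "\<bar>w p - g p\<bar> \<le> M" for p
      using w g(2)[of p] unfolding bounded_density_def by (smt (verit))
    have mwg: "(\<lambda>x::(real \<times> real) \<times> (real \<times> real). \<bar>w (fst x) - g (fst x)\<bar>) \<in> borel_measurable borel"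
      "(\<lambda>x::(real \<times> real) \<times> (real \<times> real). \<bar>w (snd x) - g (snd x)\<bar>) \<in> borel_measurable borel"
      using measurable_compose[OF m2(1), of "\<lambda>p. \<bar>w p - g p\<bar>" borel]
        measurable_compose[OF m2(2), of "\<lambda>p. \<bar>w p - g p\<bar>" borel] by auto
    have iE1: "integrable lborel (\<lambda>x. P (fst x) (snd x) * (indicator K' (snd x) * \<bar>w (snd x) - g (snd x)\<bar>))"
      by (rule iPK(2)[OF mwg(2) _ K'(1), of M]) (use wg in auto)
    have iE2: "integrable lborel (\<lambda>x. P (fst x) (snd x) * (indicator K (fst x) * e))"
      by (rule iPK(1)[OF _ _ K(1), of _ "\<bar>e\<bar>"]) auto
    have iE3: "integrable lborel (\<lambda>x. P (fst x) (snd x) * (indicator K (fst x) * \<bar>w (fst x) - g (fst x)\<bar>))"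
      by (rule iPK(1)[OF mwg(1) _ K(1), of M]) (use wg in auto)
    have iE: "integrable lborel ?E"
      using iE1 iE2 iE3 by (simp add: distrib_left)
    have "integral\<^sup>L lborel ?E = (LINT x|lborel. P (fst x) (snd x) * (indicator K' (snd x) * \<bar>w (snd x) - g (snd x)\<bar>)) +
        (LINT x|lborel. P (fst x) (snd x) * (indicator K (fst x) * e)) +
        (LINT x|lborel. P (fst x) (snd x) * (indicator K (fst x) * \<bar>w (fst x) - g (fst x)\<bar>))"
      using iE1 iE2 iE3 by (simp add: distrib_left)
    also have "\<dots> = (LINT q|lborel. indicator K' q * \<bar>w q - g q\<bar>) + measure lborel K * e + (LINT p|lborel. indicator K p * \<bar>w p - g p\<bar>)"
      unfolding lborel_fubini(2)[OF iE1] lborel_fubini(1)[OF iE2] lborel_fubini(1)[OF iE3]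
      using mollifier_kernel_integral(2,3)[OF m] by (simp add: P_def)
    also have "\<dots> \<le> e + measure lborel K * e + e"
    proof -
      have "(LINT p|lborel. indicator K p * \<bar>w p - g p\<bar>) \<le> (LINT p|lborel. indicator K' p * \<bar>w p - g p\<bar>)"
        using K'(2) wg compact_imp_bounded[OF K(1)] compact_imp_bounded[OF K'(1)]
        by (intro integral_mono integrable_indicator_bounded[of _ M]) (auto split: split_indicator)
      then show ?thesis using g(3) by simp
    qed
    finally have E: "integral\<^sup>L lborel ?E \<le> (2 + measure lborel K) * e" by (simp add: algebra_simps)
    let ?f = "\<lambda>p. \<bar>u p - w p\<bar> * \<psi>t p + ?q (u p) (w p) * \<psi>x p"
    have if0: "integrable lborel ?f"
      using integrable_entropy_terms[OF u w] C1_test_integrable[OF \<psi>(1)] by auto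
    \<comment> \<open>The integrand of the claim, spread over the second variable by \<open>P\<close>, which has mass 1.\<close>
    let ?If = "\<lambda>x. P (fst x) (snd x) * (indicator K (fst x) * ?f (fst x))"
    have bf: "\<bar>?f p\<bar> \<le> (M + L * M) * B" for p
    proof -
      have "\<bar>\<bar>u p - w p\<bar> * \<psi>t p\<bar> \<le> M * B" "\<bar>?q (u p) (w p) * \<psi>x p\<bar> \<le> L * M * B"
        unfolding abs_mult using bounded_density_bounds[OF u w, of p p] B(3,4)[of p] M_nonneg L_nonneg by (auto intro!: mult_mono)
      then show ?thesis by (simp add: distrib_right abs_le_iff)
    qed
    have mf: "(\<lambda>x::(real \<times> real) \<times> (real \<times> real). ?f (fst x)) \<in> borel_measurable borel"
      using measurable_compose[OF m2(1), of ?f borel] D by measurable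
    have iIf: "integrable lborel ?If"
      by (rule iPK(1)[OF mf _ K(1)]) (rule bf)
    have "integral\<^sup>L lborel ?If = (LINT p|lborel. indicator K p * ?f p)"
      unfolding lborel_fubini(1)[OF iIf] using mollifier_kernel_integral(2,3)[OF m] by (simp add: P_def)
    also have "\<dots> = integral\<^sup>L lborel ?f"
      using K(4,5) by (intro Bochner_Integration.integral_cong) (auto split: split_indicator)
    finally have If: "integral\<^sup>L lborel ?If = integral\<^sup>L lborel ?f" .
    let ?c = "B * (1 + L)"
    have "- (?c * ((2 + measure lborel K) * e)) \<le> integral\<^sup>L lborel ?If"
    proof (rule LINT_ge_of_error[OF iIf iH integrable_mult_right[OF iE, of ?c] _ H])
      have "0 \<le> ?c" using B(1) L_nonneg by simp
      then show "(LINT x|lborel. ?c * ?E x) \<le> ?c * ((2 + measure lborel K) * e)"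
        using E by (simp only: integral_mult_right_zero mult_left_mono)
      fix x :: "(real \<times> real) \<times> (real \<times> real)"
      obtain p q where x: "x = (p, q)" by (rule prod.exhaust)
      show "?H x - ?c * ?E x \<le> ?If x"
      proof (cases "p \<in> K \<and> P p q \<noteq> 0")
        case False
        have "0 \<le> ?E x" using P0 \<open>e > 0\<close> by (intro mult_nonneg_nonneg add_nonneg_nonneg) auto
        then have "0 \<le> ?c * ?E x" using \<open>0 \<le> ?c\<close> by (rule mult_nonneg_nonneg[rotated])
        moreover have "?H x = 0" "?If x = 0" using False K(4,5)[of p] by (auto simp: x)
        ultimately show ?thesis by linarith
      next
        case True
        then have qK: "q \<in> K'" "p \<in> K'" using Pz(1)[of p q] K'(2) by auto
        have "\<bar>fst p - fst q\<bar> < h" "\<bar>snd p - snd q\<bar> < h"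
          using True J(6) by (auto simp: P_def product_kernel_def not_le[symmetric])
        then have "dist q p < d1" using dist_pair_le[of p q] h(3) d1(1) by (simp add: dist_commute)
        then have "\<bar>g q - g p\<bar> < e" using d1(2)[OF qK(2,1)] by (simp add: dist_real_def)
        then have wpq: "\<bar>w q - w p\<bar> \<le> \<bar>w q - g q\<bar> + e + \<bar>w p - g p\<bar>" by linarith
        have e1: "\<bar>(\<bar>u p - w q\<bar> - \<bar>u p - w p\<bar>) * \<psi>t p\<bar> \<le> \<bar>w q - w p\<bar> * B"
          unfolding abs_mult using B(3)[of p] by (intro mult_mono) auto
        have e2: "\<bar>(?q (u p) (w q) - ?q (u p) (w p)) * \<psi>x p\<bar> \<le> L * \<bar>w q - w p\<bar> * B"
          unfolding abs_mult using B(4)[of p] L_nonneg entropy_flux_lipschitz[of "w q" "u p" "w p"]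
          by (intro mult_mono) (auto simp: entropy_flux_commute[of F "u p"])
        have "(\<bar>u p - w q\<bar> * \<psi>t p + ?q (u p) (w q) * \<psi>x p) - ?f p \<le> ?c * \<bar>w q - w p\<bar>"
          using e1 e2 by (simp add: algebra_simps abs_le_iff)
        also have "\<dots> \<le> ?c * (\<bar>w q - g q\<bar> + e + \<bar>w p - g p\<bar>)"
          using wpq \<open>0 \<le> ?c\<close> by (rule mult_left_mono)
        finally have "P p q * ((\<bar>u p - w q\<bar> * \<psi>t p + ?q (u p) (w q) * \<psi>x p) - ?f p) \<le>
            P p q * (?c * (\<bar>w q - g q\<bar> + e + \<bar>w p - g p\<bar>))" using P0 by (rule mult_left_mono)
        then show ?thesis using True qK by (simp add: x algebra_simps)
      qed
    qed
    then show "- (?c * (2 + measure lborel K) * e) \<le> integral\<^sup>L lborel ?f"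
      by (simp add: If mult.assoc)
  qed
qed

end

section \<open>Contraction for solutions that leave through the right end\<close>

definition right_part :: "(real \<Rightarrow> real) \<Rightarrow> (real \<times> real \<Rightarrow> real) \<Rightarrow> real \<times> real \<Rightarrow> real" where
  "right_part z r p = (if z (fst p) < snd p then r p else 0)"

text \<open>
  The data of the right part of a Hughes solution: the equation between the curve \<open>z\<close> and the right
  end, trace 0 at the curve, and trace at most \<open>c\<close> at the right end.
\<close>

definition outgoing_solution ::
  "real \<Rightarrow> (real \<Rightarrow> real) \<Rightarrow> real \<Rightarrow> (real \<Rightarrow> real) \<Rightarrow> (real \<times> real \<Rightarrow> real) \<Rightarrow> bool" where
  "outgoing_solution M F c z r \<longleftrightarrow>
     bounded_density M r \<and> (\<exists>k\<ge>0. \<forall>s t. \<bar>z s - z t\<bar> \<le> k * \<bar>s - t\<bar>) \<and> (\<forall>t. z t \<in> corridor) \<and>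
     kruzhkov_on M F {p. 0 < fst p \<and> z (fst p) < snd p \<and> snd p < 1} r \<and>
     vanishes_near 1 z r \<and> vanishes_near (-1) (\<lambda>_. 1) (\<lambda>p. max 0 (r p - c))"

lemma outgoing_solutionD:
  assumes "outgoing_solution M F c z r"
  shows "bounded_density M r" "continuous_on UNIV z" "z t \<in> corridor"
    "vanishes_near (-1) (\<lambda>_. 1) (\<lambda>p. max 0 (r p - c))"
proof -
  obtain k where k: "k \<ge> 0" "\<And>s t. \<bar>z s - z t\<bar> \<le> k * \<bar>s - t\<bar>"
    using assms unfolding outgoing_solution_def by blast
  have "k-lipschitz_on UNIV z" using k by (auto intro!: lipschitz_onI simp: dist_real_def)
  then show "continuous_on UNIV z" by (rule lipschitz_on_continuous_on)
qed (use assms in \<open>auto simp: outgoing_solution_def\<close>)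

lemma bounded_density_right_part:
  assumes "0 \<le> M" "bounded_density M r" "continuous_on UNIV z"
  shows "bounded_density M (right_part z r)"
proof -
  have [measurable]: "z \<in> borel_measurable borel" using assms(3) by (rule borel_measurable_continuous_onI)
  have [measurable]: "r \<in> borel_measurable borel" using assms(2) by (rule bounded_densityD)
  note [measurable] = measurable_fst_snd_real measurable_compose[OF measurable_fst_snd_real(1), of z borel]
  have "right_part z r \<in> borel_measurable borel" unfolding right_part_def[abs_def] by measurable
  then show ?thesis using assms(1,2) by (auto simp: bounded_density_def right_part_def)
qed

context lipschitz_flux
begin

lemma right_part_kruzhkov:
  assumes "outgoing_solution M F c z r"
  shows "kruzhkov_on M F ({0<..} \<times> corridor) (right_part z r)"
proof -
  obtain k where k: "k \<ge> 0" "\<And>s t. \<bar>z s - z t\<bar> \<le> k * \<bar>s - t\<bar>"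
    using assms unfolding outgoing_solution_def by blast
  have "kruzhkov_on M F ({0<..} \<times> corridor) (\<lambda>p. if z (fst p) < snd p then r p else 0)"
    by (rule kruzhkov_extend_by_zero[OF k(2,1)]) (use assms in \<open>auto simp: outgoing_solution_def\<close>)
  then show ?thesis by (simp add: right_part_def[abs_def])
qed

text \<open>
  For states at most \<open>c\<close> both factors of the entropy flux have the same sign; the Lipschitz bound
  accounts for the excess over \<open>c\<close>.
\<close>

lemma entropy_flux_outgoing:
  assumes mono: "\<And>a b. 0 \<le> a \<Longrightarrow> a \<le> b \<Longrightarrow> b \<le> c \<Longrightarrow> F a \<le> F b" and "0 \<le> c" "0 \<le> a" "0 \<le> b"
  shows "- (L * (max 0 (a - c) + max 0 (b - c))) \<le> entropy_flux F a b"
proof -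
  have q: "0 \<le> entropy_flux F (min a c) (min b c)"
    using mono[of "min a c" "min b c"] mono[of "min b c" "min a c"] assms(2-4)
    by (auto simp: entropy_flux_def sgn_if)
  have "\<bar>entropy_flux F a b - entropy_flux F (min a c) b\<bar> \<le> L * max 0 (a - c)"
    using entropy_flux_lipschitz[of a b "min a c"] by (simp add: min_def max_def split: if_splits)
  moreover have "\<bar>entropy_flux F b (min a c) - entropy_flux F (min b c) (min a c)\<bar> \<le> L * max 0 (b - c)"
    using entropy_flux_lipschitz[of b "min a c" "min b c"] by (cases "b \<le> c") (auto simp: min_absorb1 min_absorb2)
  moreover note entropy_flux_commute[of F b "min a c"] entropy_flux_commute[of F "min b c" "min a c"]
  ultimately show ?thesis using q by (simp add: distrib_left abs_le_iff)
qed

text \<open>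
  The doubling inequality is tested with a function of time times a cut-off \<open>\<beta>\<close> of the corridor.
  Where \<open>\<beta>\<close> falls near the left end both densities vanish. Near the right end \<open>\<beta>\<close> decreases, so the
  spatial term has the good sign up to the excess of the densities over \<open>c\<close>, which is small in the
  mean, while the factor \<open>2 / \<epsilon>\<close> from the slope of \<open>\<beta>\<close> is compensated by the width of the strip.
\<close>

lemma outgoing_comparison_in_time:
  assumes s1: "outgoing_solution M F c z1 r1" and s2: "outgoing_solution M F c z2 r2"
    and mono: "\<And>a b. 0 \<le> a \<Longrightarrow> a \<le> b \<Longrightarrow> b \<le> c \<Longrightarrow> F a \<le> F b" "0 \<le> c"
    and \<omega>: "\<And>t. (\<omega> has_real_derivative \<omega>' t) (at t)" "continuous_on UNIV \<omega>'" "\<And>t. 0 \<le> \<omega> t"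
      "0 < \<delta>" "\<delta> < T" "\<And>t. t \<notin> {\<delta>..T} \<Longrightarrow> \<omega> t = 0" "\<And>t. t \<notin> {\<delta>..T} \<Longrightarrow> \<omega>' t = 0"
  shows "0 \<le> (LINT p|lborel. indicator ({0..T} \<times> corridor) p * (\<bar>right_part z1 r1 p - right_part z2 r2 p\<bar> * \<omega>' (fst p)))"
proof -
  let ?u1 = "right_part z1 r1" and ?u2 = "right_part z2 r2"
  let ?q = "entropy_flux F"
  note S1 = outgoing_solutionD[OF s1] and S2 = outgoing_solutionD[OF s2]
  have du: "bounded_density M ?u1" "bounded_density M ?u2"
    using bounded_density_right_part[OF M_nonneg] S1 S2 by blast+
  have c\<omega>: "continuous_on UNIV \<omega>" using DERIV_isCont[OF \<omega>(1)] by (simp add: continuous_at_imp_continuous_on)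
  obtain B0 where B0: "B0 > 0" "\<And>t. \<bar>\<omega> t\<bar> \<le> B0"
    using continuous_compact_support_bounded[OF c\<omega> compact_Icc[of \<delta> T] \<omega>(6)] by metis
  obtain B1 where B1: "B1 > 0" "\<And>t. \<bar>\<omega>' t\<bar> \<le> B1"
    using continuous_compact_support_bounded[OF \<omega>(2) compact_Icc[of \<delta> T] \<omega>(7)] by metis
  define B where "B = max B0 B1"
  have B: "B > 0" "\<And>t. \<bar>\<omega> t\<bar> \<le> B" "\<And>t. \<bar>\<omega>' t\<bar> \<le> B"
    using B0 B1 by (auto simp: B_def le_max_iff_disj)
  have T: "0 < T" using \<omega>(4,5) by simp
  show ?thesis
  proof (rule nonneg_if_ge_neg_multiples)
    fix e :: real assume "e > 0"
    have away: "\<exists>a>0. \<forall>t\<in>{0..T}. -1 + a \<le> z t" if "continuous_on UNIV z" "\<And>t. z t \<in> corridor" for z :: "real \<Rightarrow> real"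
    proof -
      have "continuous_on {0..T} z" using that(1) continuous_on_subset by blast
      then obtain t0 where "t0 \<in> {0..T}" "\<forall>t\<in>{0..T}. z t0 \<le> z t"
        using continuous_attains_inf[of "{0..T}" z] T by auto
      then show ?thesis using that(2)[of t0] by (intro exI[of _ "z t0 + 1"]) auto
    qed
    obtain a1 where a1: "a1 > 0" "\<forall>t\<in>{0..T}. -1 + a1 \<le> z1 t" using away[OF S1(2,3)] by blast
    obtain a2 where a2: "a2 > 0" "\<forall>t\<in>{0..T}. -1 + a2 \<le> z2 t" using away[OF S2(2,3)] by blast
    let ?S = "\<lambda>w. strip (-1) (\<lambda>_. 1) T w"
    obtain d1 where d1: "d1 > 0"
      "\<And>w. 0 < w \<Longrightarrow> w < d1 \<Longrightarrow> (LINT p|lborel. indicator (?S w) p * max 0 (r1 p - c)) \<le> e * w"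
      using S1(4)[unfolded vanishes_near_def, rule_format, OF T \<open>e > 0\<close>] by auto
    obtain d2 where d2: "d2 > 0"
      "\<And>w. 0 < w \<Longrightarrow> w < d2 \<Longrightarrow> (LINT p|lborel. indicator (?S w) p * max 0 (r2 p - c)) \<le> e * w"
      using S2(4)[unfolded vanishes_near_def, rule_format, OF T \<open>e > 0\<close>] by auto
    \<comment> \<open>Small enough that the left transition zone of \<open>\<beta>\<close> lies behind both curves, that both strip
      estimates hold for the width \<open>2 * \<epsilon>\<close>, that the two transition zones do not overlap, and that
      the zone at the exit contributes an error of order \<open>e\<close>.\<close>
    define \<epsilon> where "\<epsilon> = Min {a1 / 2, a2 / 2, 1 / 4, d1 / 4, d2 / 4, e}"
    have \<epsilon>: "0 < \<epsilon>" "2 * \<epsilon> \<le> a1" "2 * \<epsilon> \<le> a2" "\<epsilon> \<le> 1 / 4" "2 * \<epsilon> < d1" "2 * \<epsilon> < d2" "\<epsilon> \<le> e"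
    proof -
      have "0 < \<epsilon>" using a1(1) a2(1) d1(1) d2(1) \<open>e > 0\<close> by (simp add: \<epsilon>_def)
      moreover have "\<epsilon> \<le> a1 / 2" "\<epsilon> \<le> a2 / 2" "\<epsilon> \<le> 1 / 4" "\<epsilon> \<le> d1 / 4" "\<epsilon> \<le> d2 / 4" "\<epsilon> \<le> e"
        unfolding \<epsilon>_def by (rule Min_le; simp)+
      ultimately show "0 < \<epsilon>" "2 * \<epsilon> \<le> a1" "2 * \<epsilon> \<le> a2" "\<epsilon> \<le> 1 / 4" "2 * \<epsilon> < d1" "2 * \<epsilon> < d2" "\<epsilon> \<le> e"
        using d1(1) d2(1) by linarith+
    qed
    define b where "b x = (1 - x) / \<epsilon> - 1" for x :: real
    define a where "a x = (1 + x) / \<epsilon> - 1" for x :: real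
    define \<beta> where "\<beta> x = smooth_step (b x) * smooth_step (a x)" for x
    define \<beta>' where "\<beta>' x = smooth_step' (b x) * (- 1 / \<epsilon>) * smooth_step (a x) + smooth_step' (a x) * (1 / \<epsilon>) * smooth_step (b x)" for x
    have d\<beta>: "(\<beta> has_real_derivative \<beta>' x) (at x)" for x
    proof -
      have "(b has_real_derivative - 1 / \<epsilon>) (at x)" "(a has_real_derivative 1 / \<epsilon>) (at x)"
        unfolding a_def[abs_def] b_def[abs_def] using \<epsilon>(1) by (auto intro!: derivative_eq_intros)
      then have "((\<lambda>x. smooth_step (b x)) has_real_derivative smooth_step' (b x) * (- 1 / \<epsilon>)) (at x)"
        "((\<lambda>x. smooth_step (a x)) has_real_derivative smooth_step' (a x) * (1 / \<epsilon>)) (at x)"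
        using DERIV_chain2[OF smooth_step_has_derivative] by blast+
      then show ?thesis unfolding \<beta>_def[abs_def] \<beta>'_def by (rule DERIV_mult)
    qed
    have cab: "continuous_on UNIV a" "continuous_on UNIV b"
      unfolding a_def[abs_def] b_def[abs_def] using \<epsilon>(1) by (auto intro!: continuous_intros)
    have c\<beta>': "continuous_on UNIV \<beta>'"
      unfolding \<beta>'_def[abs_def]
      by (intro continuous_intros continuous_on_compose2[OF smooth_step_continuous(1)]
          continuous_on_compose2[OF smooth_step_continuous(2)] cab subset_UNIV)
    have c\<beta>: "continuous_on UNIV \<beta>" using DERIV_isCont[OF d\<beta>] by (simp add: continuous_at_imp_continuous_on)
    have \<beta>0: "0 \<le> \<beta> x" "\<beta> x \<le> 1" for x
      unfolding \<beta>_def using smooth_step_bounds by (auto intro!: mult_le_one)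
    have out: "\<beta> x = 0" "\<beta>' x = 0" if "x \<notin> {-1 + \<epsilon>..1 - \<epsilon>}" for x
    proof -
      have "b x \<le> 0 \<or> a x \<le> 0" using that \<epsilon>(1) by (auto simp: a_def b_def field_simps)
      then show "\<beta> x = 0" "\<beta>' x = 0" by (auto simp: \<beta>_def \<beta>'_def smooth_step_low)
    qed
    have mid: "\<beta> x = 1" "\<beta>' x = 0" if "-1 + 2 * \<epsilon> < x" "x \<le> 1 - 2 * \<epsilon>" for x
    proof -
      have "b x \<ge> 1" "a x \<ge> 1" using that \<epsilon>(1) by (auto simp: a_def b_def field_simps)
      then show "\<beta> x = 1" "\<beta>' x = 0" by (auto simp: \<beta>_def \<beta>'_def smooth_step_high)
    qed
    have right: "\<beta>' x \<le> 0" "- (2 / \<epsilon>) \<le> \<beta>' x" if "1 - 2 * \<epsilon> < x" for x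
    proof -
      have "a x \<ge> 1" using that \<epsilon>(1,4) by (auto simp: a_def field_simps)
      then have "\<beta>' x = - (smooth_step' (b x) / \<epsilon>)" by (simp add: \<beta>'_def smooth_step_high)
      then show "\<beta>' x \<le> 0" "- (2 / \<epsilon>) \<le> \<beta>' x"
        using smooth_step'_bounds[of "b x"] \<epsilon>(1) by (auto simp: divide_right_mono)
    qed
    define \<psi> where "\<psi> p = \<omega> (fst p) * \<beta> (snd p)" for p :: "real \<times> real"
    define \<psi>t where "\<psi>t p = \<omega>' (fst p) * \<beta> (snd p)" for p :: "real \<times> real"
    define \<psi>x where "\<psi>x p = \<omega> (fst p) * \<beta>' (snd p)" for p :: "real \<times> real"
    have test: "C1_test ({0<..} \<times> corridor) \<psi> \<psi>t \<psi>x"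
      unfolding C1_test_def
    proof (intro conjI allI exI[of _ "{\<delta>..T} \<times> {-1 + \<epsilon>..1 - \<epsilon>}"])
      fix p :: "real \<times> real"
      have 1: "((\<lambda>p. \<omega> (fst p)) has_derivative (\<lambda>h. \<omega>' (fst p) * fst h)) (at p)"
        by (rule has_derivative_compose[OF has_derivative_fst[OF has_derivative_ident] \<omega>(1)[unfolded has_field_derivative_def]])
      have 2: "((\<lambda>p. \<beta> (snd p)) has_derivative (\<lambda>h. \<beta>' (snd p) * snd h)) (at p)"
        by (rule has_derivative_compose[OF has_derivative_snd[OF has_derivative_ident] d\<beta>[unfolded has_field_derivative_def]])
      show "(\<psi> has_derivative (\<lambda>h. fst h * \<psi>t p + snd h * \<psi>x p)) (at p)"
        unfolding \<psi>_def[abs_def] \<psi>t_def \<psi>x_def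
        by (rule has_derivative_eq_rhs[OF has_derivative_mult[OF 1 2]]) (auto simp: algebra_simps)
      show "compact ({\<delta>..T} \<times> {-1 + \<epsilon>..1 - \<epsilon>})" by (intro compact_Times compact_Icc)
      show "{\<delta>..T} \<times> {-1 + \<epsilon>..1 - \<epsilon>} \<subseteq> {0<..} \<times> corridor" using \<omega>(4) \<epsilon>(1) by auto
      show "p \<notin> {\<delta>..T} \<times> {-1 + \<epsilon>..1 - \<epsilon>} \<longrightarrow> \<psi> p = 0" using \<omega>(6) out by (cases p) (auto simp: \<psi>_def)
    next
      show "continuous_on UNIV \<psi>t" "continuous_on UNIV \<psi>x"
        unfolding \<psi>t_def[abs_def] \<psi>x_def[abs_def]
        by (intro continuous_intros continuous_on_compose2[OF \<omega>(2)] continuous_on_compose2[OF c\<omega>]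
            continuous_on_compose2[OF c\<beta>] continuous_on_compose2[OF c\<beta>'] subset_UNIV)+
    qed
    have D: "0 \<le> (LINT p|lborel. \<bar>?u1 p - ?u2 p\<bar> * \<psi>t p + ?q (?u1 p) (?u2 p) * \<psi>x p)"
      by (rule kruzhkov_doubling[OF open_half_strip du right_part_kruzhkov[OF s1] right_part_kruzhkov[OF s2] test])
        (simp add: \<psi>_def \<omega>(3) \<beta>0)
    let ?e1 = "\<lambda>p. max 0 (r1 p - c)" and ?e2 = "\<lambda>p. max 0 (r2 p - c)"
    let ?W = "?S (2 * \<epsilon>)"
    let ?R = "cbox (0, 1 - 2 * \<epsilon>) (T, 1)"
    \<comment> \<open>The error: the part of the corridor where \<open>\<beta>\<close> is not yet 1, and the excess over \<open>c\<close> at the exit.\<close>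
    let ?h = "\<lambda>p. M * B * indicator ?R p + (2 * B * L / \<epsilon>) * (indicator ?W p * ?e1 p + indicator ?W p * ?e2 p)"
    have bW: "bounded ?W" by (rule strip_bounded[of _ 1]) auto
    have mW: "?W \<in> sets borel" by (rule strip_borel) auto
    have mr: "r1 \<in> borel_measurable borel" "r2 \<in> borel_measurable borel" using bounded_densityD S1(1) S2(1) by blast+
    have iW: "integrable lborel (\<lambda>p. indicator ?W p * ?e1 p)" "integrable lborel (\<lambda>p. indicator ?W p * ?e2 p)"
      using mr mono(2) bounded_densityD(2,3)[OF S1(1)] bounded_densityD(2,3)[OF S2(1)] M_nonneg
      by (auto intro!: integrable_indicator_bounded[OF _ _ mW bW, of _ M] borel_measurable_max borel_measurable_diff
          simp: abs_le_iff diff_le_eq add_increasing2)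
    have iR: "integrable lborel (indicator ?R :: real \<times> real \<Rightarrow> real)"
      by (intro integrable_real_indicator) (auto simp: emeasure_lborel_cbox_eq)
    have mR: "measure lborel ?R = T * (2 * \<epsilon>)"
      using T \<epsilon>(1) by (simp add: measure_lborel_cbox_eq Basis_prod_def prod.union_disjoint)
    have "- (M * B * (T * (2 * \<epsilon>)) + (2 * B * L / \<epsilon>) * (e * (2 * \<epsilon>) + e * (2 * \<epsilon>))) \<le>
       (LINT p|lborel. indicator ({0..T} \<times> corridor) p * (\<bar>?u1 p - ?u2 p\<bar> * \<omega>' (fst p)))"
    proof (rule LINT_ge_of_error[OF _ _ _ _ D])
      have [measurable]: "?u1 \<in> borel_measurable borel" "?u2 \<in> borel_measurable borel" using bounded_densityD du by blast+
      have [measurable]: "(\<lambda>p::real \<times> real. \<omega>' (fst p)) \<in> borel_measurable borel"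
        using measurable_compose[OF measurable_fst_snd_real(1) borel_measurable_continuous_onI[OF \<omega>(2)]] .
      show "integrable lborel (\<lambda>p. indicator ({0..T} \<times> corridor) p * (\<bar>?u1 p - ?u2 p\<bar> * \<omega>' (fst p)))"
      proof (rule integrable_indicator_bounded[of _ "M * B"])
        show "\<bar>\<bar>?u1 p - ?u2 p\<bar> * \<omega>' (fst p)\<bar> \<le> M * B" for p
          unfolding abs_mult using bounded_density_bounds(1)[OF du, of p p] B(3)[of "fst p"] M_nonneg by (intro mult_mono) auto
        show "{0..T} \<times> corridor \<in> sets borel" by (intro borel_Times) auto
        show "bounded ({0..T} \<times> corridor)" by (intro bounded_Times) auto
      qed measurable
      show "integrable lborel (\<lambda>p. \<bar>?u1 p - ?u2 p\<bar> * \<psi>t p + ?q (?u1 p) (?u2 p) * \<psi>x p)"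
        by (intro Bochner_Integration.integrable_add integrable_entropy_terms du C1_test_integrable[OF test])
      show "integrable lborel ?h"
        by (intro Bochner_Integration.integrable_add integrable_mult_right iR iW)
      have "integral\<^sup>L lborel ?h = M * B * (T * (2 * \<epsilon>)) + (2 * B * L / \<epsilon>) *
          ((LINT p|lborel. indicator ?W p * ?e1 p) + (LINT p|lborel. indicator ?W p * ?e2 p))"
        using iR iW mR by (simp add: distrib_left)
      also have "\<dots> \<le> M * B * (T * (2 * \<epsilon>)) + (2 * B * L / \<epsilon>) * (e * (2 * \<epsilon>) + e * (2 * \<epsilon>))"
        using d1(2)[of "2 * \<epsilon>"] d2(2)[of "2 * \<epsilon>"] \<epsilon> B(1) L_nonneg
        by (intro add_left_mono mult_left_mono add_mono) auto
      finally show "integral\<^sup>L lborel ?h \<le> M * B * (T * (2 * \<epsilon>)) + (2 * B * L / \<epsilon>) * (e * (2 * \<epsilon>) + e * (2 * \<epsilon>))" .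
      fix p :: "real \<times> real"
      obtain t x where p: "p = (t, x)" by (rule prod.exhaust)
      have h0: "0 \<le> ?h p"
        using M_nonneg B(1) L_nonneg \<epsilon>(1) by (intro add_nonneg_nonneg mult_nonneg_nonneg) auto
      show "\<bar>?u1 p - ?u2 p\<bar> * \<psi>t p + ?q (?u1 p) (?u2 p) * \<psi>x p - ?h p \<le>
         indicator ({0..T} \<times> corridor) p * (\<bar>?u1 p - ?u2 p\<bar> * \<omega>' (fst p))"
      proof (cases "t \<in> {\<delta>..T} \<and> x \<in> corridor")
        case False
        then have "\<psi>t p = 0" "\<psi>x p = 0" using \<omega>(6,7)[of t] out[of x] \<epsilon>(1) by (auto simp: p \<psi>t_def \<psi>x_def)
        then have "\<bar>?u1 p - ?u2 p\<bar> * \<psi>t p + ?q (?u1 p) (?u2 p) * \<psi>x p = 0" by simp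
        moreover have "indicator ({0..T} \<times> corridor) p * (\<bar>?u1 p - ?u2 p\<bar> * \<omega>' (fst p)) = 0"
          using False \<omega>(7)[of t] by (auto simp: p split: split_indicator)
        ultimately show ?thesis using h0 by linarith
      next
        case True
        then have t0: "t \<in> {0..T}" and ind: "indicator ({0..T} \<times> corridor) p = (1::real)" using \<omega>(4) by (auto simp: p)
        consider "x \<le> -1 + 2 * \<epsilon>" | "-1 + 2 * \<epsilon> < x" "x \<le> 1 - 2 * \<epsilon>" | "1 - 2 * \<epsilon> < x" by linarith
        then show ?thesis
        proof cases
          case 1
          then have "?u1 p = 0" "?u2 p = 0"
            using a1(2) a2(2) t0 \<epsilon>(2,3) by (force simp: p right_part_def)+
          then show ?thesis using h0 by (simp add: entropy_flux_def)
        next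
          case 2
          then show ?thesis using mid[of x] h0 ind by (simp add: p \<psi>t_def \<psi>x_def)
        next
          case 3
          then have pW: "p \<in> ?W" "p \<in> ?R" using t0 True by (auto simp: p strip_def)
          let ?du = "\<bar>?u1 p - ?u2 p\<bar>"
          have "?du * \<omega>' t * (1 - \<beta> x) \<ge> - (M * B)"
          proof -
            have "\<bar>?du * \<omega>' t * (1 - \<beta> x)\<bar> \<le> M * B * 1"
              unfolding abs_mult[of "?du * \<omega>' t"] abs_mult[of ?du]
              using bounded_density_bounds(1)[OF du, of p p] B(3)[of t] \<beta>0[of x] M_nonneg B(1) by (intro mult_mono) auto
            then show ?thesis by (simp add: abs_le_iff)
          qed
          then have A: "?du * \<psi>t p \<le> ?du * \<omega>' t + M * B" by (simp add: p \<psi>t_def algebra_simps)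
          have le: "max 0 (?u1 p - c) \<le> ?e1 p" "max 0 (?u2 p - c) \<le> ?e2 p"
            using bounded_densityD(2)[OF S1(1), of p] bounded_densityD(2)[OF S2(1), of p] mono(2) by (auto simp: right_part_def)
          have "- (L * (max 0 (?u1 p - c) + max 0 (?u2 p - c))) \<le> ?q (?u1 p) (?u2 p)"
            by (rule entropy_flux_outgoing[OF mono]) (use bounded_densityD(2) du in blast)+
          moreover have "L * (max 0 (?u1 p - c) + max 0 (?u2 p - c)) \<le> L * (?e1 p + ?e2 p)"
            using le L_nonneg by (intro mult_left_mono add_mono) auto
          ultimately have q: "- (L * (?e1 p + ?e2 p)) \<le> ?q (?u1 p) (?u2 p)" by linarith
          define y where "y = - \<psi>x p"
          have y: "0 \<le> y" "y \<le> B * (2 / \<epsilon>)"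
          proof -
            have y': "y = \<omega> t * (- \<beta>' x)" by (simp add: y_def \<psi>x_def p)
            show "0 \<le> y" unfolding y' using right[OF 3] \<omega>(3) by (intro mult_nonneg_nonneg) auto
            show "y \<le> B * (2 / \<epsilon>)" unfolding y' using right[OF 3] \<omega>(3)[of t] B(2)[of t] B(1) by (intro mult_mono) auto
          qed
          have "- ?q (?u1 p) (?u2 p) * y \<le> L * (?e1 p + ?e2 p) * y"
            using q y(1) by (intro mult_right_mono) auto
          also have "\<dots> \<le> L * (?e1 p + ?e2 p) * (B * (2 / \<epsilon>))"
            using y(2) L_nonneg by (intro mult_left_mono mult_nonneg_nonneg) auto
          finally have "?q (?u1 p) (?u2 p) * \<psi>x p \<le> L * (?e1 p + ?e2 p) * (B * (2 / \<epsilon>))"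
            by (simp add: y_def)
          moreover have "?h p = M * B + L * (?e1 p + ?e2 p) * (B * (2 / \<epsilon>))" using pW by simp
          ultimately show ?thesis using A ind by (simp add: p)
        qed
      qed
    qed
    moreover have "M * B * (T * (2 * \<epsilon>)) + (2 * B * L / \<epsilon>) * (e * (2 * \<epsilon>) + e * (2 * \<epsilon>)) \<le> (M * B * T * 2 + 8 * B * L) * e"
    proof -
      have "M * B * T * 2 * \<epsilon> \<le> M * B * T * 2 * e"
        using \<epsilon>(7) M_nonneg B(1) T by (intro mult_left_mono) auto
      moreover have "(2 * B * L / \<epsilon>) * (e * (2 * \<epsilon>) + e * (2 * \<epsilon>)) = 8 * B * L * e"
        using \<epsilon>(1) by (simp add: field_simps)
      ultimately show ?thesis by (simp add: algebra_simps)
    qed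
    ultimately show "- ((M * B * T * 2 + 8 * B * L) * e) \<le>
        (LINT p|lborel. indicator ({0..T} \<times> corridor) p * (\<bar>?u1 p - ?u2 p\<bar> * \<omega>' (fst p)))"
      by linarith
  qed
qed

text \<open>
  If the claim failed, \<open>\<mu>\<close> would stay below a level \<open>m0\<close> right after time 0 and above it right after
  \<open>\<tau>\<close>. A function \<open>\<omega>\<close> of time that rises in the first period and falls in the second contradicts the
  comparison inequality, because the integral of \<open>\<omega>'\<close> is zero and that of \<open>\<omega>' * m\<close> is nonnegative.
\<close>

lemma outgoing_L1_contraction:
  assumes s1: "outgoing_solution M F c z1 r1" and s2: "outgoing_solution M F c z2 r2"
    and mono: "\<And>a b. 0 \<le> a \<Longrightarrow> a \<le> b \<Longrightarrow> b \<le> c \<Longrightarrow> F a \<le> F b" "0 \<le> c"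
    and \<mu>: "AE t in lborel. 0 < t \<longrightarrow>
        (LINT x|lborel. indicator corridor x * \<bar>right_part z1 r1 (t, x) - right_part z2 r2 (t, x)\<bar>) = \<mu> t"
      "(\<mu> \<longlongrightarrow> \<mu> 0) (at_right 0)" "(\<mu> \<longlongrightarrow> \<mu> \<tau>) (at_right \<tau>)" "0 < \<tau>"
  shows "\<mu> \<tau> \<le> \<mu> 0"
proof (rule ccontr)
  assume "\<not> \<mu> \<tau> \<le> \<mu> 0"
  define m0 where "m0 = (\<mu> 0 + \<mu> \<tau>) / 2"
  have m0: "\<mu> 0 < m0" "m0 < \<mu> \<tau>" using \<open>\<not> \<mu> \<tau> \<le> \<mu> 0\<close> by (auto simp: m0_def)
  obtain b1 where b1: "b1 > 0" "\<And>t. 0 < t \<Longrightarrow> t < b1 \<Longrightarrow> \<mu> t < m0"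
    using order_tendstoD(2)[OF \<mu>(2) m0(1)] unfolding eventually_at_right_field by auto
  obtain b2 where b2: "b2 > \<tau>" "\<And>t. \<tau> < t \<Longrightarrow> t < b2 \<Longrightarrow> m0 < \<mu> t"
    using order_tendstoD(1)[OF \<mu>(3) m0(2)] unfolding eventually_at_right_field by auto
  define \<delta> where "\<delta> = Min {b1 / 3, (b2 - \<tau>) / 2, \<tau> / 3}"
  have \<delta>: "0 < \<delta>" "2 * \<delta> < b1" "\<tau> + \<delta> < b2" "2 * \<delta> < \<tau>"
  proof -
    have "0 < \<delta>" using b1(1) b2(1) \<mu>(4) by (simp add: \<delta>_def)
    moreover have "\<delta> \<le> b1 / 3" "\<delta> \<le> (b2 - \<tau>) / 2" "\<delta> \<le> \<tau> / 3" unfolding \<delta>_def by (rule Min_le; simp)+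
    ultimately show "0 < \<delta>" "2 * \<delta> < b1" "\<tau> + \<delta> < b2" "2 * \<delta> < \<tau>"
      using b1(1) b2(1) \<mu>(4) by (auto simp: field_simps)
  qed
  define T where "T = \<tau> + \<delta>"
  define \<omega> where "\<omega> t = smooth_step ((t - \<delta>) / \<delta>) - smooth_step ((t - \<tau>) / \<delta>)" for t
  define \<omega>' where "\<omega>' t = smooth_step' ((t - \<delta>) / \<delta>) * (1 / \<delta>) - smooth_step' ((t - \<tau>) / \<delta>) * (1 / \<delta>)" for t
  have d\<omega>: "(\<omega> has_real_derivative \<omega>' t) (at t)" for t
  proof -
    have "((\<lambda>t. (t - s) / \<delta>) has_real_derivative 1 / \<delta>) (at t)" for s
      using \<delta>(1) by (auto intro!: derivative_eq_intros)
    then have "((\<lambda>t. smooth_step ((t - s) / \<delta>)) has_real_derivative smooth_step' ((t - s) / \<delta>) * (1 / \<delta>)) (at t)" for s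
      using DERIV_chain2[OF smooth_step_has_derivative] by blast
    then show ?thesis unfolding \<omega>_def[abs_def] \<omega>'_def by (intro DERIV_diff)
  qed
  have c\<omega>': "continuous_on UNIV \<omega>'"
    unfolding \<omega>'_def[abs_def] using \<delta>(1)
    by (auto intro!: continuous_intros continuous_on_compose2[OF smooth_step_continuous(2)])
  have \<omega>0: "0 \<le> \<omega> t" for t
    unfolding \<omega>_def using \<delta> smooth_step_mono[of "(t - \<tau>) / \<delta>" "(t - \<delta>) / \<delta>"] by (simp add: divide_right_mono)
  have out: "\<omega> t = 0" "\<omega>' t = 0" if "t \<notin> {\<delta>..T}" for t
  proof -
    have "(t - \<delta>) / \<delta> \<le> 0 \<and> (t - \<tau>) / \<delta> \<le> 0 \<or> (t - \<delta>) / \<delta> \<ge> 1 \<and> (t - \<tau>) / \<delta> \<ge> 1"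
      using that \<delta> by (auto simp: T_def field_simps)
    then show "\<omega> t = 0" "\<omega>' t = 0" by (auto simp: \<omega>_def \<omega>'_def smooth_step_low smooth_step_high)
  qed
  have T: "\<delta> < T" "0 < T" using \<delta> by (auto simp: T_def)
  let ?d = "\<lambda>p. \<bar>right_part z1 r1 p - right_part z2 r2 p\<bar>"
  define m where "m t = (LINT x|lborel. indicator corridor x * ?d (t, x))" for t
  let ?f = "\<lambda>p. indicator ({0..T} \<times> corridor) p * (?d p * \<omega>' (fst p))"
  have I: "0 \<le> integral\<^sup>L lborel ?f"
    by (rule outgoing_comparison_in_time[OF s1 s2 mono d\<omega> c\<omega>' \<omega>0 \<delta>(1) T(1) out])
  note S1 = outgoing_solutionD[OF s1] and S2 = outgoing_solutionD[OF s2]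
  have du: "bounded_density M (right_part z1 r1)" "bounded_density M (right_part z2 r2)"
    using bounded_density_right_part[OF M_nonneg] S1 S2 by blast+
  obtain B where B: "B > 0" "\<And>t. \<bar>\<omega>' t\<bar> \<le> B"
    using continuous_compact_support_bounded[OF c\<omega>' compact_Icc[of \<delta> T] out(2)] by metis
  have [measurable]: "right_part z1 r1 \<in> borel_measurable borel" "right_part z2 r2 \<in> borel_measurable borel"
    using bounded_densityD du by blast+
  have [measurable]: "(\<lambda>p::real \<times> real. \<omega>' (fst p)) \<in> borel_measurable borel"
    using measurable_compose[OF measurable_fst_snd_real(1) borel_measurable_continuous_onI[OF c\<omega>']] .
  have i: "integrable lborel ?f"
  proof (rule integrable_indicator_bounded[of _ "M * B"])
    show "\<bar>?d p * \<omega>' (fst p)\<bar> \<le> M * B" for p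
      unfolding abs_mult using bounded_density_bounds(1)[OF du, of p p] B(2)[of "fst p"] M_nonneg by (intro mult_mono) auto
    show "{0..T} \<times> corridor \<in> sets borel" by (intro borel_Times) auto
    show "bounded ({0..T} \<times> corridor)" by (intro bounded_Times) auto
  qed measurable
  have inner: "(LINT x|lborel. ?f (t, x)) = \<omega>' t * m t" for t
  proof -
    have "(\<lambda>x. ?f (t, x)) = (\<lambda>x. \<omega>' t * (indicator corridor x * ?d (t, x)))"
      using out(2)[of t] \<delta>(1) by (auto simp: fun_eq_iff split: split_indicator)
    then show ?thesis by (simp add: m_def)
  qed
  have Im: "0 \<le> (LINT t|lborel. \<omega>' t * m t)"
    using I unfolding lborel_fubini(1)[OF i] inner .
  have im: "integrable lborel (\<lambda>t. \<omega>' t * m t)"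
    using lborel_fubini(3)[OF i] unfolding inner .
  have i\<omega>: "integrable lborel \<omega>'"
    by (rule continuous_compact_support_integrable[OF c\<omega>' compact_Icc[of \<delta> T] out(2)])
  have far: "t \<notin> {\<delta>..T}" if "T + 1 \<le> \<bar>t\<bar>" for t using that T \<delta>(1) by auto
  have z: "integral\<^sup>L lborel \<omega>' = 0"
    by (rule integral_derivative_compact_support[OF d\<omega> c\<omega>' out(1)[OF far] out(2)[OF far]]) (use T in auto)
  let ?g = "\<lambda>t. \<omega>' t * (m0 - m t)"
  have ig: "integrable lborel ?g" using im i\<omega> by (simp add: right_diff_distrib)
  have "integral\<^sup>L lborel ?g = - (LINT t|lborel. \<omega>' t * m t)"
    using im i\<omega> z by (simp add: right_diff_distrib)
  then have Ig: "integral\<^sup>L lborel ?g \<le> 0" using Im by simp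
  have AEm: "AE t in lborel. 0 < t \<longrightarrow> m t = \<mu> t" using \<mu>(1) by (simp add: m_def)
  have AEne: "AE t in lborel. t \<noteq> \<tau>" by (rule AE_lborel_singleton)
  have sgn: "0 \<le> ?g t" if tt: "0 < t \<longrightarrow> m t = \<mu> t" "t \<noteq> \<tau>" for t
  proof -
    consider "t < \<delta> \<or> 2 * \<delta> \<le> t \<and> t < \<tau> \<or> \<tau> + \<delta> < t" | "\<delta> \<le> t" "t < 2 * \<delta>" | "\<tau> < t" "t \<le> \<tau> + \<delta>"
      using tt(2) \<delta> by linarith
    then show ?thesis
    proof cases
      case 1
      then have "\<omega>' t = 0"
      proof (elim disjE)
        assume t: "2 * \<delta> \<le> t \<and> t < \<tau>"
        then have "(t - \<delta>) / \<delta> \<ge> 1" "(t - \<tau>) / \<delta> \<le> 0" using \<delta> by (auto simp: field_simps)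
        then show ?thesis by (simp add: \<omega>'_def smooth_step_low smooth_step_high)
      qed (use out(2) in \<open>auto simp: T_def\<close>)
      then show ?thesis by simp
    next
      case 2
      then have "(t - \<tau>) / \<delta> \<le> 0" using \<delta> by (auto simp: field_simps)
      then have "0 \<le> \<omega>' t" using smooth_step'_bounds[of "(t - \<delta>) / \<delta>"] \<delta>(1) by (simp add: \<omega>'_def smooth_step_low)
      moreover have "m t < m0" using tt(1) 2 \<delta> b1(2)[of t] by auto
      ultimately show ?thesis by simp
    next
      case 3
      then have "(t - \<delta>) / \<delta> \<ge> 1" using \<delta> by (auto simp: field_simps)
      then have "\<omega>' t \<le> 0" using smooth_step'_bounds[of "(t - \<tau>) / \<delta>"] \<delta>(1) by (simp add: \<omega>'_def smooth_step_high)
      moreover have "m0 < m t" using tt(1) 3 \<delta> \<mu>(4) b2(2)[of t] by auto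
      ultimately show ?thesis by (simp add: mult_nonpos_nonpos)
    qed
  qed
  have AEg: "AE t in lborel. 0 \<le> ?g t" using AEm AEne by eventually_elim (rule sgn)
  have "integral\<^sup>L lborel ?g = 0" using Ig integral_nonneg_AE[OF AEg] by simp
  then have AE0: "AE t in lborel. ?g t = 0" using integral_nonneg_eq_0_iff_AE[OF ig AEg] by simp
  have "AE t in lborel. t \<notin> {\<delta><..<2 * \<delta>}"
    using AE0 AEm
  proof eventually_elim
    fix t assume t: "?g t = 0" "0 < t \<longrightarrow> m t = \<mu> t"
    show "t \<notin> {\<delta><..<2 * \<delta>}"
    proof
      assume t2: "t \<in> {\<delta><..<2 * \<delta>}"
      have a: "0 < (t - \<delta>) / \<delta>" "(t - \<delta>) / \<delta> < 1" "(t - \<tau>) / \<delta> \<le> 0" using t2 \<delta> by (auto simp: field_simps)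
      then have "0 < \<omega>' t" using smooth_step'_pos[OF a(1,2)] \<delta>(1) by (simp add: \<omega>'_def smooth_step_low)
      moreover have "m t < m0" using t(2) t2 \<delta> b1(2)[of t] by auto
      ultimately show False using t(1) by simp
    qed
  qed
  then have "{\<delta><..<2 * \<delta>} \<in> null_sets lborel" by (subst AE_iff_null_sets) auto
  then show False using \<delta>(1) by (simp add: null_sets_def)
qed

end

section \<open>Strips from strong traces\<close>

lemma AE_lborel_affine:
  fixes c :: real
  assumes "AE x in lborel. P x" "{x. P x} \<in> sets borel" "c \<noteq> 0"
  shows "AE s in lborel. P (a + c * s)"
proof -
  have "AE x in density (distr lborel borel (\<lambda>x. a + c * x)) (\<lambda>_. ennreal \<bar>c\<bar>). P x"
    by (subst lborel_real_affine[OF assms(3), of a, symmetric]) (rule assms(1))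
  then have "AE x in distr lborel borel (\<lambda>x. a + c * x). P x"
    using assms(3) by (subst (asm) AE_density) auto
  then show ?thesis using assms(2) by (subst (asm) AE_distr_iff) auto
qed

text \<open>
  A shear preserves null sets, so a property that holds almost everywhere in the plane holds almost
  everywhere on almost every translate of a curve.
\<close>

lemma AE_lborel_shear:
  fixes z :: "real \<Rightarrow> real"
  assumes "AE p in lborel. Q p" and z: "z \<in> borel_measurable borel" and "\<tau> \<noteq> 0"
  shows "AE s in lborel. AE t in lborel. Q (t, z t + \<tau> * s)"
proof -
  obtain N where N: "{p. \<not> Q p} \<subseteq> N" "N \<in> null_sets lborel"
    using assms(1) by (auto simp: eventually_ae_filter)
  have [measurable]: "N \<in> sets borel" using N(2) by (auto simp: null_sets_def)
  have "AE p in lborel \<Otimes>\<^sub>M lborel. p \<notin> N" using AE_not_in[OF N(2)] unfolding lborel_prod .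
  then have "AE t in lborel. AE x in lborel. (t, x) \<notin> N" by (rule lborel_pair.AE_pair)
  then have ts: "AE t in lborel. AE s in lborel. (t, z t + \<tau> * s) \<notin> N"
  proof eventually_elim
    case (elim t)
    have "(\<lambda>x. (t, x)) \<in> borel_measurable borel"
      by (intro borel_measurable_continuous_onI continuous_on_Pair continuous_on_const continuous_on_id)
    then have "(\<lambda>x. (t, x)) -` (- N) \<inter> space borel \<in> sets borel" by (rule measurable_sets) auto
    then have "{x. (t, x) \<notin> N} \<in> sets borel" by (simp add: vimage_def)
    from AE_lborel_affine[OF elim this \<open>\<tau> \<noteq> 0\<close>] show ?case .
  qed
  have "AE s in lborel. AE t in lborel. (t, z t + \<tau> * s) \<notin> N"
  proof (rule lborel_pair.AE_commute[THEN iffD1, OF _ ts])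
    have [measurable]: "z \<in> borel_measurable borel" by (rule z)
    note [measurable] = measurable_fst_snd_real measurable_compose[OF measurable_fst_snd_real(1), of z borel]
    have "(\<lambda>p::real \<times> real. (fst p, z (fst p) + \<tau> * snd p)) \<in> borel \<rightarrow>\<^sub>M borel \<Otimes>\<^sub>M borel" by measurable
    then have m: "(\<lambda>p::real \<times> real. (fst p, z (fst p) + \<tau> * snd p)) \<in> borel \<rightarrow>\<^sub>M borel" by (simp add: borel_prod)
    have "(\<lambda>p::real \<times> real. (fst p, z (fst p) + \<tau> * snd p)) -` (- N) \<inter> space borel \<in> sets borel"
      by (rule measurable_sets[OF m]) auto
    moreover have "sets (lborel \<Otimes>\<^sub>M lborel) = sets (borel :: (real \<times> real) measure)"
      "space (lborel \<Otimes>\<^sub>M lborel) = (UNIV :: (real \<times> real) set)"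
      unfolding lborel_prod by simp_all
    ultimately show "{p \<in> space (lborel \<Otimes>\<^sub>M lborel). (fst p, z (fst p) + \<tau> * snd p) \<notin> N} \<in> sets (lborel \<Otimes>\<^sub>M lborel)"
      by (simp add: vimage_def)
  qed
  then show ?thesis
  proof eventually_elim
    case (elim s)
    then show ?case by eventually_elim (use N(1) in blast)
  qed
qed

text \<open>
  In the coordinates \<open>(t, s)\<close> with \<open>x = z t + \<tau> * s\<close> the strip is a rectangle. For almost every
  \<open>s\<close> the integral over time of the excess over \<open>c\<close> is at most that of \<open>\<bar>\<rho> - \<gamma>\<bar>\<close>, as \<open>\<gamma>\<close> does not exceed \<open>c\<close>, and
  this is below \<open>e\<close> for small \<open>s\<close>. The reflection \<open>\<sigma>\<close> treats both sides of the corridor at once.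
\<close>

lemma vanishes_near_of_strong_trace:
  fixes r rb :: "real \<times> real \<Rightarrow> real"
  assumes r: "bounded_density M r" and "0 \<le> c" and rb: "\<And>t y. r (t, y) = rb (t, \<sigma> * y)"
    and AE: "AE p in lborel. 0 \<le> fst p \<and> snd p \<in> corridor \<longrightarrow> \<rho> (fst p) (snd p) = rb p"
    and \<sigma>: "\<bar>\<sigma>\<bar> = 1" and \<tau>: "\<tau> = 1 \<or> \<tau> = -1" and z: "continuous_on UNIV z"
    and zB: "\<And>t. \<bar>z t\<bar> \<le> 1"
    and room: "\<And>T. T > 0 \<Longrightarrow> \<exists>d>0. \<forall>t\<in>{0..T}. \<forall>s. 0 < s \<and> s < d \<longrightarrow> z t + \<tau> * s \<in> corridor"
    and \<eta>: "\<And>t s. 0 \<le> t \<Longrightarrow> \<eta> t + \<sigma>' * s = \<sigma> * (z t + \<tau> * s)"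
    and tr: "strong_trace \<rho> \<eta> \<sigma>' \<gamma>" and \<gamma>: "AE t in lebesgue. 0 < t \<longrightarrow> \<gamma> t \<le> c"
  shows "vanishes_near \<tau> z (\<lambda>p. max 0 (r p - c))"
  unfolding vanishes_near_def
proof (intro allI impI)
  fix T e :: real assume "0 < T" "0 < e"
  let ?g = "\<lambda>p. max 0 (r p - c)"
  have [measurable]: "r \<in> borel_measurable borel" by (rule bounded_densityD[OF r])
  have [measurable]: "z \<in> borel_measurable borel" using z by (rule borel_measurable_continuous_onI)
  note [measurable] = measurable_fst_snd_real measurable_compose[OF measurable_fst_snd_real(1), of z borel]
  obtain d1 where d1: "d1 > 0" "AE s in lebesgue. 0 < s \<and> s < d1 \<longrightarrow>
        set_integrable lebesgue {0..T} (\<lambda>t. \<rho> t (\<eta> t + \<sigma>' * s) - \<gamma> t) \<and>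
        (LINT t:{0..T}|lebesgue. \<bar>\<rho> t (\<eta> t + \<sigma>' * s) - \<gamma> t\<bar>) < e"
    using tr \<open>0 < T\<close> \<open>0 < e\<close> unfolding strong_trace_def by blast
  obtain d2 where d2: "d2 > 0" "\<And>t s. t \<in> {0..T} \<Longrightarrow> 0 < s \<Longrightarrow> s < d2 \<Longrightarrow> z t + \<tau> * s \<in> corridor"
    using room[OF \<open>0 < T\<close>] by blast
  have M: "0 \<le> M" using bounded_densityD(2,3)[OF r] order_trans by blast
  have g: "0 \<le> ?g p" "?g p \<le> M" for p using bounded_densityD(2,3)[OF r, of p] \<open>0 \<le> c\<close> M by auto
  have m: "(\<lambda>p::real \<times> real. (fst p, z (fst p) + \<tau> * snd p)) \<in> borel \<rightarrow>\<^sub>M borel"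
  proof -
    have "(\<lambda>p::real \<times> real. (fst p, z (fst p) + \<tau> * snd p)) \<in> borel \<rightarrow>\<^sub>M borel \<Otimes>\<^sub>M borel" by measurable
    then show ?thesis by (simp add: borel_prod)
  qed
  note [measurable] = measurable_compose[OF m, of r borel, simplified]
  have ms: "(\<lambda>t::real. (t, z t + \<tau> * s)) \<in> borel \<rightarrow>\<^sub>M borel" for s
  proof -
    have "(\<lambda>t::real. (t, z t + \<tau> * s)) \<in> borel \<rightarrow>\<^sub>M borel \<Otimes>\<^sub>M borel" by measurable
    then show ?thesis by (simp add: borel_prod)
  qed
  have AE1: "AE s in lborel. AE t in lborel. 0 \<le> t \<and> \<sigma> * (z t + \<tau> * s) \<in> corridor \<longrightarrow>
      \<rho> t (\<sigma> * (z t + \<tau> * s)) = rb (t, \<sigma> * (z t + \<tau> * s))"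
  proof -
    have "(\<lambda>t. \<sigma> * z t) \<in> borel_measurable borel" by measurable
    moreover have "\<sigma> * \<tau> \<noteq> 0" using \<sigma> \<tau> by auto
    ultimately have "AE s in lborel. AE t in lborel. 0 \<le> fst (t, \<sigma> * z t + \<sigma> * \<tau> * s) \<and> snd (t, \<sigma> * z t + \<sigma> * \<tau> * s) \<in> corridor \<longrightarrow>
      \<rho> (fst (t, \<sigma> * z t + \<sigma> * \<tau> * s)) (snd (t, \<sigma> * z t + \<sigma> * \<tau> * s)) = rb (t, \<sigma> * z t + \<sigma> * \<tau> * s)"
      by (rule AE_lborel_shear[OF AE])
    then show ?thesis by (simp add: distrib_left mult.assoc)
  qed
  have AE2: "AE s in lborel. 0 < s \<and> s < min d1 d2 \<longrightarrow> (LINT t|lborel. indicator {0..T} t * ?g (t, z t + \<tau> * s)) \<le> e"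
    using d1(2)[unfolded AE_completion_iff] AE1
  proof eventually_elim
    case (elim s)
    show ?case
    proof
      assume s: "0 < s \<and> s < min d1 d2"
      let ?f = "\<lambda>t. indicator {0..T} t * ?g (t, z t + \<tau> * s)"
      let ?h = "\<lambda>t. \<rho> t (\<eta> t + \<sigma>' * s) - \<gamma> t"
      have h: "set_integrable lebesgue {0..T} ?h" "(LINT t:{0..T}|lebesgue. \<bar>?h t\<bar>) < e" using elim(1) s by auto
      have fm: "?f \<in> borel_measurable borel" using measurable_compose[OF ms, of r borel] by measurable
      have fi: "integrable lborel ?f"
        by (rule integrable_bounded_support[OF fm, of "{0..T}" M]) (use g in \<open>auto split: split_indicator\<close>)
      have "integral\<^sup>L lborel ?f = integral\<^sup>L lebesgue ?f" using fm by (simp add: integral_completion)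
      also have "\<dots> \<le> (LINT t:{0..T}|lebesgue. \<bar>?h t\<bar>)"
        unfolding set_lebesgue_integral_def
      proof (rule integral_mono_AE)
        show "integrable lebesgue ?f" using fi fm by (simp add: integrable_completion)
        show "integrable lebesgue (\<lambda>t. indicat_real {0..T} t *\<^sub>R \<bar>?h t\<bar>)"
          using set_integrable_abs[OF h(1)] by (simp add: set_integrable_def)
        have "AE t in lebesgue. t \<noteq> (0::real)" by (simp add: AE_completion_iff AE_lborel_singleton)
        then show "AE t in lebesgue. ?f t \<le> indicat_real {0..T} t *\<^sub>R \<bar>?h t\<bar>"
          using \<gamma> elim(2)[THEN AE_completion]
        proof eventually_elim
          case (elim t)
          show ?case
          proof (cases "t \<in> {0..T}")
            case True
            then have "z t + \<tau> * s \<in> corridor" using d2(2)[of t s] s by auto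
            moreover have "\<bar>\<sigma> * (z t + \<tau> * s)\<bar> = \<bar>z t + \<tau> * s\<bar>" using \<sigma> by (simp add: abs_mult)
            ultimately have "\<sigma> * (z t + \<tau> * s) \<in> corridor"
              by (metis abs_less_iff greaterThanLessThan_iff minus_less_iff)
            then have "\<rho> t (\<eta> t + \<sigma>' * s) = r (t, z t + \<tau> * s)"
              using elim(3) True \<eta>[of t s] by (simp add: rb)
            moreover have "\<gamma> t \<le> c" using elim(1,2) True by auto
            ultimately show ?thesis using True by auto
          qed simp
        qed
      qed
      finally show "integral\<^sup>L lborel ?f \<le> e" using h(2) by simp
    qed
  qed
  show "\<exists>d>0. \<forall>w. 0 < w \<and> w < d \<longrightarrow> (LINT p|lborel. indicator (strip \<tau> z T w) p * ?g p) \<le> e * w"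
  proof (intro exI[of _ "min d1 d2"] conjI allI impI)
    show "0 < min d1 d2" using d1 d2 by simp
    fix w assume w: "0 < w \<and> w < min d1 d2"
    have t1: "\<tau> * \<tau> = 1" "\<bar>\<tau>\<bar> = 1" "\<tau> \<noteq> 0" using \<tau> by auto
    have sb: "bounded (strip \<tau> z T w)" by (rule strip_bounded[of z 1]) (use zB t1 in auto)
    have i1: "integrable lborel (\<lambda>p. indicator (strip \<tau> z T w) p * ?g p)"
      by (rule integrable_indicator_bounded[of _ M, OF _ _ strip_borel[OF z] sb]) (measurable, use g in auto)
    let ?k = "\<lambda>p::real \<times> real. indicator ({0..T} \<times> {0<..<w}) p * ?g (fst p, z (fst p) + \<tau> * snd p)"
    have i2: "integrable lborel ?k"
    proof (rule integrable_indicator_bounded[of _ M])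
      show "{0..T} \<times> {0<..<w} \<in> sets borel" by (intro borel_Times) auto
      show "bounded ({0..T} \<times> {0<..<w})" by (intro bounded_Times) auto
    qed (measurable, use g in auto)
    have "(LINT p|lborel. indicator (strip \<tau> z T w) p * ?g p) =
        (LINT t|lborel. LINT x|lborel. indicator (strip \<tau> z T w) (t, x) * ?g (t, x))"
      by (rule lborel_fubini(1)[OF i1])
    also have "\<dots> = (LINT t|lborel. LINT s|lborel. ?k (t, s))"
    proof (rule Bochner_Integration.integral_cong[OF refl])
      fix t
      have "(LINT x|lborel. indicator (strip \<tau> z T w) (t, x) * ?g (t, x)) =
          \<bar>\<tau>\<bar> *\<^sub>R (LINT s|lborel. indicator (strip \<tau> z T w) (t, z t + \<tau> * s) * ?g (t, z t + \<tau> * s))"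
        by (rule lborel_integral_real_affine[OF t1(3)])
      also have "\<dots> = (LINT s|lborel. ?k (t, s))"
      proof -
        have "indicator (strip \<tau> z T w) (t, z t + \<tau> * s) = (indicator ({0..T} \<times> {0<..<w}) (t, s) :: real)" for s
          using \<tau> by (elim disjE) (auto simp: strip_def split: split_indicator)
        then show ?thesis using t1(2) by simp
      qed
      finally show "(LINT x|lborel. indicator (strip \<tau> z T w) (t, x) * ?g (t, x)) = (LINT s|lborel. ?k (t, s))" .
    qed
    also have "\<dots> = (LINT s|lborel. LINT t|lborel. ?k (t, s))"
      using lborel_fubini(1,2)[OF i2] by simp
    also have "\<dots> \<le> (LINT s|lborel. indicator {0<..<w} s * e)"
    proof (rule integral_mono_AE)
      show "integrable lborel (\<lambda>s. LINT t|lborel. ?k (t, s))" by (rule lborel_fubini(4)[OF i2])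
      show "integrable lborel (\<lambda>s. indicator {0<..<w} s * e)"
        using w by (intro integrable_mult_left integrable_real_indicator) auto
      show "AE s in lborel. (LINT t|lborel. ?k (t, s)) \<le> indicator {0<..<w} s * e"
        using AE2
      proof eventually_elim
        case (elim s)
        have "(LINT t|lborel. ?k (t, s)) = indicator {0<..<w} s * (LINT t|lborel. indicator {0..T} t * ?g (t, z t + \<tau> * s))"
          by (subst integral_mult_right_zero[symmetric]) (auto intro!: Bochner_Integration.integral_cong split: split_indicator)
        then show ?case using elim w by (auto split: split_indicator)
      qed
    qed
    also have "\<dots> = e * w" using w by simp
    finally show "(LINT p|lborel. indicator (strip \<tau> z T w) p * ?g p) \<le> e * w" .
  qed
qed

section \<open>The two sides of a Hughes solution\<close>

lemma integral_reflect_snd: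
  fixes f :: "real \<times> real \<Rightarrow> real"
  assumes "integrable lborel f" "integrable lborel (\<lambda>p. f (fst p, \<sigma> * snd p))" "\<bar>\<sigma>\<bar> = 1"
  shows "(LINT p|lborel. f (fst p, \<sigma> * snd p)) = integral\<^sup>L lborel f"
proof -
  have "(LINT x|lborel. f (t, \<sigma> * x)) = (LINT x|lborel. f (t, x))" for t
    using lborel_integral_real_affine[of \<sigma> "\<lambda>x. f (t, x)" 0] assms(3) by auto
  then show ?thesis unfolding lborel_fubini(1)[OF assms(1)] lborel_fubini(1)[OF assms(2)] by simp
qed

lemma measurable_reflect: "(\<lambda>p::real \<times> real. (fst p, \<sigma> * snd p)) \<in> borel \<rightarrow>\<^sub>M borel"
  by (intro borel_measurable_continuous_onI continuous_intros)

lemma bounded_density_reflect: "bounded_density M r \<Longrightarrow> bounded_density M (\<lambda>p. r (fst p, \<sigma> * snd p))"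
  using measurable_compose[OF measurable_reflect, of r borel \<sigma>] by (auto simp: bounded_density_def)

text \<open>
  Reflection turns the sign of the spatial derivative of a test function, hence that of the flux.
\<close>

lemma (in lipschitz_flux) kruzhkov_reflect:
  assumes r: "bounded_density M r" and k: "kruzhkov_on M (\<lambda>s. \<sigma> * F s) V r" and \<sigma>: "\<sigma> * \<sigma> = 1" "\<bar>\<sigma>\<bar> = 1"
  shows "kruzhkov_on M F {p. (fst p, \<sigma> * snd p) \<in> V} (\<lambda>p. r (fst p, \<sigma> * snd p))"
  unfolding kruzhkov_on_def
proof (intro ballI allI impI, elim conjE)
  let ?R = "\<lambda>p::real \<times> real. (fst p, \<sigma> * snd p)"
  fix \<kappa> \<phi> \<phi>t \<phi>x assume \<kappa>: "\<kappa> \<in> {0..M}" and \<phi>: "C1_test {p. ?R p \<in> V} \<phi> \<phi>t \<phi>x" "\<forall>p. 0 \<le> \<phi> p"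
  have RR: "?R (?R p) = p" for p using \<sigma>(1) by (simp add: mult.assoc[symmetric])
  obtain K where K': "compact K \<and> K \<subseteq> {p. ?R p \<in> V} \<and> (\<forall>p. p \<notin> K \<longrightarrow> \<phi> p = 0 \<and> \<phi>t p = 0 \<and> \<phi>x p = 0)"
    using C1_test_support_ex[OF \<phi>(1)] by (rule exE)
  then have K: "compact K" "K \<subseteq> {p. ?R p \<in> V}"
    "\<And>p. p \<notin> K \<Longrightarrow> \<phi> p = 0" "\<And>p. p \<notin> K \<Longrightarrow> \<phi>t p = 0" "\<And>p. p \<notin> K \<Longrightarrow> \<phi>x p = 0"
    by blast+
  note D = C1_testD[OF \<phi>(1)]
  have cR: "continuous_on S ?R" for S by (intro continuous_intros)
  have T: "C1_test V (\<lambda>p. \<phi> (?R p)) (\<lambda>p. \<phi>t (?R p)) (\<lambda>p. \<sigma> * \<phi>x (?R p))"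
    unfolding C1_test_def
  proof (intro conjI allI exI[of _ "?R ` K"])
    fix p
    have "(?R has_derivative (\<lambda>h. (fst h, \<sigma> * snd h))) (at p)" by (auto intro!: derivative_eq_intros)
    from has_derivative_compose[OF this D(1)[of "?R p"]]
    show "((\<lambda>p. \<phi> (?R p)) has_derivative (\<lambda>h. fst h * \<phi>t (?R p) + snd h * (\<sigma> * \<phi>x (?R p)))) (at p)"
      by (rule has_derivative_eq_rhs) (auto simp: algebra_simps)
    show "p \<notin> ?R ` K \<longrightarrow> \<phi> (?R p) = 0"
    proof (intro impI K(3) notI)
      assume "p \<notin> ?R ` K" "?R p \<in> K"
      from imageI[OF this(2), of ?R] this(1) show False unfolding RR by blast
    qed
  next
    show "continuous_on UNIV (\<lambda>p. \<phi>t (?R p))" by (rule continuous_on_compose2[OF D(3) cR]) auto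
    show "continuous_on UNIV (\<lambda>p. \<sigma> * \<phi>x (?R p))"
      by (intro continuous_on_mult continuous_on_const continuous_on_compose2[OF D(4) cR]) auto
    show "compact (?R ` K)" by (rule compact_continuous_image[OF cR K(1)])
    show "?R ` K \<subseteq> V" using K(2) by auto
  qed
  let ?G = "\<lambda>p. \<bar>r p - \<kappa>\<bar> * \<phi>t (?R p) + entropy_flux F (r p) \<kappa> * \<phi>x (?R p)"
  have dk: "bounded_density M (\<lambda>_. \<kappa>)" using \<kappa> by (intro bounded_density_const) auto
  have "0 \<le> (LINT p|lborel. \<bar>r p - \<kappa>\<bar> * \<phi>t (?R p) + entropy_flux (\<lambda>s. \<sigma> * F s) (r p) \<kappa> * (\<sigma> * \<phi>x (?R p)))"
    by (rule kruzhkov_onD[OF k _ _ T]) (use \<kappa> \<phi>(2) in auto)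
  also have "\<dots> = integral\<^sup>L lborel ?G"
  proof (rule Bochner_Integration.integral_cong[OF refl])
    fix p
    have "\<sigma> * entropy_flux F (r p) \<kappa> * (\<sigma> * \<phi>x (?R p)) = (\<sigma> * \<sigma>) * (entropy_flux F (r p) \<kappa> * \<phi>x (?R p))" by (simp only: ac_simps)
    then show "\<bar>r p - \<kappa>\<bar> * \<phi>t (?R p) + entropy_flux (\<lambda>s. \<sigma> * F s) (r p) \<kappa> * (\<sigma> * \<phi>x (?R p)) = ?G p"
      by (simp add: entropy_flux_scale \<sigma>(1))
  qed
  also have "\<dots> = (LINT p|lborel. ?G (?R p))"
  proof (rule integral_reflect_snd[symmetric, OF _ _ \<sigma>(2)])
    have i: "integrable lborel (\<lambda>p. \<phi>t (?R p))" "integrable lborel (\<lambda>p. \<phi>x (?R p))"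
      using C1_test_integrable[OF T] \<sigma>(2) by auto
    show "integrable lborel ?G"
      by (intro Bochner_Integration.integrable_add integrable_entropy_terms r dk i)
    show "integrable lborel (\<lambda>p. ?G (?R p))"
      unfolding RR
      by (intro Bochner_Integration.integrable_add integrable_entropy_terms bounded_density_reflect[OF r] dk C1_test_integrable[OF \<phi>(1)])
  qed
  finally show "0 \<le> (LINT p|lborel. \<bar>r (?R p) - \<kappa>\<bar> * \<phi>t p + entropy_flux F (r (?R p)) \<kappa> * \<phi>x p)"
    unfolding RR .
qed

text \<open>
  Test functions supported on the side \<open>\<sigma>\<close> vanish on the curve, and \<open>sgn (x - \<xi> t)\<close> equals \<open>\<sigma>\<close> on their
  support.
\<close>

lemma (in lipschitz_flux) entropy_inequality_one_side:
  assumes Fv: "\<And>s. 0 \<le> s \<Longrightarrow> s \<le> M \<Longrightarrow> F s = flux v s"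
    and ei: "entropy_inequality M v \<rho> \<xi>" and r: "bounded_density M r"
    and AE: "AE p in lborel. 0 \<le> fst p \<and> snd p \<in> corridor \<longrightarrow> \<rho> (fst p) (snd p) = r p"
    and z: "continuous_on UNIV z" "\<And>t. 0 < t \<Longrightarrow> z t = \<xi> t" and \<sigma>: "\<sigma> = 1 \<or> \<sigma> = -1"
  shows "kruzhkov_on M (\<lambda>s. \<sigma> * F s) {p. 0 < fst p \<and> 0 < \<sigma> * (snd p - z (fst p)) \<and> snd p \<in> corridor} r"
    (is "kruzhkov_on M _ ?V r")
proof -
  interpret S: lipschitz_flux M L "\<lambda>s. \<sigma> * F s"
  proof
    show "\<bar>\<sigma> * F a - \<sigma> * F b\<bar> \<le> L * \<bar>a - b\<bar>" for a b
      using F_lip[of a b] \<sigma> by (auto simp: abs_minus_commute)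
  qed (use M_nonneg L_nonneg in auto)
  let ?S = "{0<..} \<times> corridor :: (real \<times> real) set"
  show ?thesis
  proof (rule S.kruzhkov_on_smooth_tests[OF _ r])
    have "?V = {p. 0 < fst p} \<inter> {p. 0 < \<sigma> * (snd p - z (fst p))} \<inter> {p. -1 < snd p} \<inter> {p. snd p < 1}" by auto
    also have "open \<dots>"
      by (intro open_Int open_Collect_less continuous_intros continuous_on_compose2[OF z(1)]) auto
    finally show "open ?V" .
    fix \<kappa> \<phi> \<phi>t \<phi>x assume \<kappa>: "0 \<le> \<kappa>" "\<kappa> \<le> M" and \<phi>: "\<forall>k. C_k k \<phi>" "compact_support_in ?V \<phi>" "\<forall>p. 0 \<le> \<phi> p"
      "C1_test ?V \<phi> \<phi>t \<phi>x"
    obtain K where K': "compact K \<and> K \<subseteq> ?V \<and> (\<forall>p. p \<notin> K \<longrightarrow> \<phi> p = 0 \<and> \<phi>t p = 0 \<and> \<phi>x p = 0)"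
      using C1_test_support_ex[OF \<phi>(4)] by (rule exE)
    then have K: "compact K" "K \<subseteq> ?V"
      "\<And>p. p \<notin> K \<Longrightarrow> \<phi> p = 0" "\<And>p. p \<notin> K \<Longrightarrow> \<phi>t p = 0" "\<And>p. p \<notin> K \<Longrightarrow> \<phi>x p = 0"
      by blast+
    note D = C1_testD[OF \<phi>(4)]
    have fd: "frechet_derivative \<phi> (at p) = (\<lambda>h. fst h * \<phi>t p + snd h * \<phi>x p)" for p
      using frechet_derivative_at[OF D(1)[of p]] by simp
    have "compact_support_in ?S \<phi>"
      using \<phi>(2) unfolding compact_support_in_def by (auto simp: subset_iff mem_Times_iff)
    then have E: "0 \<le> (LINT p:?S|lebesgue. kruzhkov_integrand v \<rho> \<xi> \<kappa> \<phi> p) +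
             2 * (LINT t:{0<..}|lebesgue. flux v \<kappa> * \<phi> (t, \<xi> t))"
      using ei[unfolded entropy_inequality_def, rule_format, of \<kappa> \<phi>] \<kappa> \<phi>(1,3) by simp
    have "flux v \<kappa> * \<phi> (t, \<xi> t) = 0" if "0 < t" for t
    proof -
      have "(t, \<xi> t) \<notin> ?V" using z(2)[OF that] by simp
      then have "(t, \<xi> t) \<notin> K" using K(2) by blast
      from K(3)[OF this] show ?thesis by simp
    qed
    then have z0: "(LINT t:{0<..}|lebesgue. flux v \<kappa> * \<phi> (t, \<xi> t)) = 0"
      by (subst set_lebesgue_integral_cong[where g = "\<lambda>_. 0"]) (auto simp: set_lebesgue_integral_def)
    then have E': "0 \<le> (LINT p:?S|lebesgue. kruzhkov_integrand v \<rho> \<xi> \<kappa> \<phi> p)"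
      using E by (simp only: z0 mult_zero_right add_0_right)
    let ?G = "\<lambda>p. \<bar>r p - \<kappa>\<bar> * \<phi>t p + entropy_flux (\<lambda>s. \<sigma> * F s) (r p) \<kappa> * \<phi>x p"
    let ?k = "\<lambda>p. indicat_real ?S p *\<^sub>R kruzhkov_integrand v \<rho> \<xi> \<kappa> \<phi> p"
    have [measurable]: "r \<in> borel_measurable borel" by (rule bounded_densityD[OF r])
    note [measurable] = D(6,7)
    have Gm: "?G \<in> borel_measurable borel" by measurable
    then have GmL: "?G \<in> borel_measurable lebesgue" by (simp add: measurable_completion)
    have ae: "AE p in lebesgue. ?G p = ?k p"
      using AE[THEN AE_completion]
    proof eventually_elim
      case (elim p)
      obtain t x where p: "p = (t, x)" by (rule prod.exhaust)
      show ?case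
      proof (cases "p \<in> K")
        case True
        then have V: "0 < t" "0 < \<sigma> * (x - z t)" "x \<in> corridor" using K(2) by (auto simp: p)
        have "sgn (x - \<xi> t) = \<sigma>" using V(2) \<sigma> z(2)[OF V(1)] by (auto simp: sgn_if)
        moreover have "\<rho> t x = r p" using elim V by (simp add: p)
        moreover have "F (r p) = flux v (r p)" "F \<kappa> = flux v \<kappa>" using Fv bounded_densityD(2,3)[OF r] \<kappa> by auto
        ultimately show ?thesis
          using V by (simp add: p kruzhkov_integrand_def fd entropy_flux_def algebra_simps)
      next
        case False
        then have z: "\<phi>t (t, x) = 0" "\<phi>x (t, x) = 0" using K(4,5)[of p] by (auto simp: p)
        then have "kruzhkov_integrand v \<rho> \<xi> \<kappa> \<phi> p = 0" by (simp add: p kruzhkov_integrand_def fd)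
        then show ?thesis using z by (simp add: p)
      qed
    qed
    have "integral\<^sup>L lborel ?G = integral\<^sup>L lebesgue ?G" using Gm by (simp add: integral_completion)
    also have "\<dots> = integral\<^sup>L lebesgue ?k"
      by (rule integral_cong_AE[OF GmL borel_measurable_AE[OF GmL ae] ae])
    finally show "0 \<le> integral\<^sup>L lborel ?G" using E' by (simp add: set_lebesgue_integral_def)
  qed
qed

text \<open>
  The hypothesis on \<open>2 v' + r v''\<close> says that the flux has negative second derivative. Hence its derivative is
  strictly decreasing, and a decrease of the flux before its maximum point would force this derivative
  to be negative first and positive later.
\<close>

lemma admissible_flux:
  assumes M: "0 < M" and adm: "admissible_velocity M v"
  shows "\<exists>L\<ge>0. \<forall>a\<in>{0..M}. \<forall>b\<in>{0..M}. \<bar>flux v a - flux v b\<bar> \<le> L * \<bar>a - b\<bar>"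
    and "critical_density M v \<in> {0..M}"
    and "\<And>a b. 0 \<le> a \<Longrightarrow> a \<le> b \<Longrightarrow> b \<le> critical_density M v \<Longrightarrow> flux v a \<le> flux v b"
proof -
  obtain v' v'' where v: "\<And>r. r \<in> {0..M} \<Longrightarrow> (v has_real_derivative v' r) (at r within {0..M})"
    "\<And>r. r \<in> {0..M} \<Longrightarrow> (v' has_real_derivative v'' r) (at r within {0..M})"
    "\<And>r. r \<in> {0..M} \<Longrightarrow> 2 * v' r + r * v'' r < 0"
    using adm unfolding admissible_velocity_def by blast
  define f' where "f' r = v r + r * v' r" for r
  define f'' where "f'' r = 2 * v' r + r * v'' r" for r
  have df: "(flux v has_real_derivative f' r) (at r within {0..M})" if "r \<in> {0..M}" for r
    unfolding flux_def[abs_def] f'_def using v(1)[OF that]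
    by (auto intro!: derivative_eq_intros)
  have df': "(f' has_real_derivative f'' r) (at r within {0..M})" if "r \<in> {0..M}" for r
    unfolding f'_def[abs_def] f''_def using v(1,2)[OF that]
    by (auto intro!: derivative_eq_intros)
  have cf: "continuous_on {0..M} (flux v)" using df by (rule DERIV_continuous_on)
  have cf': "continuous_on {0..M} f'" using df' by (rule DERIV_continuous_on)
  have "bounded (f' ` {0..M})"
    using compact_continuous_image[OF cf' compact_Icc] by (rule compact_imp_bounded)
  then obtain B where B: "B > 0" "\<forall>x\<in>f' ` {0..M}. norm x \<le> B" by (auto simp: bounded_pos)
  have "\<bar>flux v a - flux v b\<bar> \<le> B * \<bar>a - b\<bar>" if "a \<in> {0..M}" "b \<in> {0..M}" for a b
    using field_differentiable_bound[OF convex_real_interval(5) df, of B a b] B(2) that by auto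
  then show "\<exists>L\<ge>0. \<forall>a\<in>{0..M}. \<forall>b\<in>{0..M}. \<bar>flux v a - flux v b\<bar> \<le> L * \<bar>a - b\<bar>"
    using B(1) by (intro exI[of _ B]) auto
  obtain x0 where "x0 \<in> {0..M}" "\<forall>y\<in>{0..M}. flux v y \<le> flux v x0"
    using continuous_attains_sup[OF compact_Icc _ cf] M by auto
  then have "is_arg_max (flux v) (\<lambda>x. x \<in> {0..M}) x0" by (auto simp: is_arg_max_def not_less)
  then have am: "is_arg_max (flux v) (\<lambda>x. x \<in> {0..M}) (critical_density M v)"
    unfolding critical_density_def arg_max_on_def arg_max_def by (rule someI)
  let ?c = "critical_density M v"
  show c: "?c \<in> {0..M}" using am by (simp add: is_arg_max_def)
  have mx: "flux v y \<le> flux v ?c" if "y \<in> {0..M}" for y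
    using am that by (auto simp: is_arg_max_def not_less)
  have mvt: "\<exists>x\<in>{a<..<b}. g b - g a = g' x * (b - a)"
    if "\<And>r. r \<in> {0..M} \<Longrightarrow> (g has_real_derivative g' r) (at r within {0..M})" "0 \<le> a" "a < b" "b \<le> M" for g g' a b
  proof -
    have "\<exists>x\<in>{a<..<b}. g b - g a = (\<lambda>h. g' x * h) (b - a)"
    proof (rule mvt_simple[OF that(3)])
      fix x assume x: "a \<le> x" "x \<le> b"
      then have "(g has_real_derivative g' x) (at x within {a..b})"
        using that by (intro has_field_derivative_subset[OF that(1)]) auto
      then show "(g has_derivative (\<lambda>h. g' x * h)) (at x within {a..b})" by (simp add: has_field_derivative_def)
    qed
    then show ?thesis by simp
  qed
  fix a b assume ab: "0 \<le> a" "a \<le> b" "b \<le> ?c"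
  show "flux v a \<le> flux v b"
  proof (rule ccontr)
    assume n: "\<not> flux v a \<le> flux v b"
    then have "a < b" using ab(2) by (cases "a = b") auto
    have "flux v a \<le> flux v ?c" using mx[of a] ab c by auto
    then have "b < ?c" using n ab(3) by (cases "b = ?c") auto
    obtain y1 where y1: "a < y1" "y1 < b" "flux v b - flux v a = f' y1 * (b - a)"
      using mvt[OF df, of a b] ab c \<open>a < b\<close> by auto
    obtain y2 where y2: "b < y2" "y2 < ?c" "flux v ?c - flux v b = f' y2 * (?c - b)"
      using mvt[OF df, of b ?c] ab c \<open>b < ?c\<close> by auto
    have "f' y1 * (b - a) < 0" using y1(3) n by linarith
    then have 1: "f' y1 < 0" using \<open>a < b\<close> by (simp add: mult_less_0_iff)
    have "0 < f' y2 * (?c - b)" using y2(3) n \<open>flux v a \<le> flux v ?c\<close> by linarith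
    then have 2: "0 < f' y2" using \<open>b < ?c\<close> by (simp add: zero_less_mult_iff)
    obtain y3 where y3: "y1 < y3" "y3 < y2" "f' y2 - f' y1 = f'' y3 * (y2 - y1)"
      using mvt[OF df', of y1 y2] y1 y2 ab c by auto
    have "f'' y3 < 0" using v(3)[of y3] y1 y2 y3 ab c by (auto simp: f''_def)
    then have "f'' y3 * (y2 - y1) < 0" using y3 by (intro mult_neg_pos) auto
    then show False using y3(3) 1 2 by linarith
  qed
qed

text \<open>
  Outside the density interval nothing is known about \<open>v\<close>; clipping the argument gives a flux that is
  Lipschitz on the whole line.
\<close>

definition clipped_flux :: "real \<Rightarrow> (real \<Rightarrow> real) \<Rightarrow> real \<Rightarrow> real" where
  "clipped_flux M v r = flux v (max 0 (min M r))"

lemma clipped_flux_eq: "0 \<le> r \<Longrightarrow> r \<le> M \<Longrightarrow> clipped_flux M v r = flux v r"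
  by (simp add: clipped_flux_def)

lemma clipped_flux_lipschitz:
  assumes M: "0 < M" and adm: "admissible_velocity M v"
  shows "\<exists>L. lipschitz_flux M L (clipped_flux M v)"
proof -
  obtain L where L: "L \<ge> 0" "\<And>a b. a \<in> {0..M} \<Longrightarrow> b \<in> {0..M} \<Longrightarrow> \<bar>flux v a - flux v b\<bar> \<le> L * \<bar>a - b\<bar>"
    using admissible_flux(1)[OF assms] by auto
  have "lipschitz_flux M L (clipped_flux M v)"
  proof
    fix a b :: real
    have "\<bar>clipped_flux M v a - clipped_flux M v b\<bar> \<le> L * \<bar>max 0 (min M a) - max 0 (min M b)\<bar>"
      unfolding clipped_flux_def using M by (intro L(2)) auto
    also have "\<dots> \<le> L * \<bar>a - b\<bar>" using L(1) by (intro mult_left_mono) auto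
    finally show "\<bar>clipped_flux M v a - clipped_flux M v b\<bar> \<le> L * \<bar>a - b\<bar>" .
  qed (use M L in auto)
  then show ?thesis by blast
qed

lemma half_strip_sets: "{0..} \<times> corridor \<in> sets (borel :: (real \<times> real) measure)"
  by (intro borel_Times) auto

lemma AE_half_strip_iff:
  "(AE p in lebesgue_on ({0..} \<times> corridor). P p) \<longleftrightarrow> (AE p::real \<times> real in lborel. 0 \<le> fst p \<and> snd p \<in> corridor \<longrightarrow> P p)"
  using half_strip_sets by (subst AE_restrict_space_iff) (auto simp: AE_completion_iff mem_Times_iff)

text \<open>
  A representative that is Borel and takes values in \<open>[0, M]\<close> everywhere makes Fubini's theorem and
  inserting its values as Kruzhkov constants unproblematic.
\<close>

lemma borel_representative:
  assumes m: "(\<lambda>p. \<rho> (fst p) (snd p)) \<in> borel_measurable (lebesgue_on ({0..} \<times> corridor))"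
    and b: "AE p in lebesgue_on ({0..} \<times> corridor). \<rho> (fst p) (snd p) \<in> {0..M}" and M: "0 \<le> M"
  obtains r where "bounded_density M r" "AE p in lborel. 0 \<le> fst p \<and> snd p \<in> corridor \<longrightarrow> \<rho> (fst p) (snd p) = r p"
proof -
  let ?S = "{0..} \<times> corridor :: (real \<times> real) set"
  have "(\<lambda>p. indicator ?S p *\<^sub>R \<rho> (fst p) (snd p)) \<in> borel_measurable lebesgue"
    using m half_strip_sets by (subst (asm) borel_measurable_restrict_space_iff) auto
  from completion_ex_borel_measurable_real[OF this]
  obtain g where g: "g \<in> borel_measurable lborel" "AE p in lborel. indicator ?S p *\<^sub>R \<rho> (fst p) (snd p) = g p" by blast
  show thesis
  proof (rule that[of "\<lambda>p. max 0 (min M (g p))"])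
    show "bounded_density M (\<lambda>p. max 0 (min M (g p)))" using g(1) M by (auto simp: bounded_density_def)
    show "AE p in lborel. 0 \<le> fst p \<and> snd p \<in> corridor \<longrightarrow> \<rho> (fst p) (snd p) = max 0 (min M (g p))"
      using g(2) b[unfolded AE_half_strip_iff]
    proof eventually_elim
      case (elim p)
      show ?case
      proof
        assume p: "0 \<le> fst p \<and> snd p \<in> corridor"
        then have "\<rho> (fst p) (snd p) = g p" using elim(1) by (simp add: mem_Times_iff)
        then show "\<rho> (fst p) (snd p) = max 0 (min M (g p))" using elim(2) p by simp
      qed
    qed
  qed
qed

text \<open>
  The curve is continued to negative times by its initial value, to be Lipschitz on the line.
\<close>

lemma entropy_solution_outgoing:
  assumes M: "0 < M" and adm: "admissible_velocity M v"
    and es: "entropy_solution M v \<alpha> \<rho>0 \<rho> \<xi>" and ws: "well_separated \<rho> \<xi>"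
    and r: "bounded_density M r"
    and AE: "AE p in lborel. 0 \<le> fst p \<and> snd p \<in> corridor \<longrightarrow> \<rho> (fst p) (snd p) = r p"
    and \<sigma>: "\<sigma> = 1 \<or> \<sigma> = -1"
  shows "outgoing_solution M (clipped_flux M v) (critical_density M v)
    (\<lambda>t. \<sigma> * \<xi> (max 0 t)) (\<lambda>p. r (fst p, \<sigma> * snd p))"
proof -
  obtain L where "lipschitz_flux M L (clipped_flux M v)" using clipped_flux_lipschitz[OF M adm] by blast
  then interpret lipschitz_flux M L "clipped_flux M v" .
  let ?c = "critical_density M v"
  have c: "0 \<le> ?c" using admissible_flux(2)[OF M adm] by simp
  obtain k where k: "k-lipschitz_on {0..} \<xi>" using es unfolding entropy_solution_def by blast
  have k0: "0 \<le> k" using k lipschitz_on_nonneg by blast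
  have \<xi>: "\<xi> t \<in> corridor" if "0 \<le> t" for t using es that unfolding entropy_solution_def by auto
  have kz: "\<bar>\<xi> (max 0 s) - \<xi> (max 0 t)\<bar> \<le> k * \<bar>s - t\<bar>" for s t
  proof -
    have "\<bar>\<xi> (max 0 s) - \<xi> (max 0 t)\<bar> \<le> k * \<bar>max 0 s - max 0 t\<bar>"
      using lipschitz_onD[OF k, of "max 0 s" "max 0 t"] by (simp add: dist_real_def)
    also have "\<dots> \<le> k * \<bar>s - t\<bar>" using k0 by (intro mult_left_mono) auto
    finally show ?thesis .
  qed
  have "k-lipschitz_on UNIV (\<lambda>t. \<xi> (max 0 t))" using kz k0 by (auto intro!: lipschitz_onI simp: dist_real_def)
  then have c\<xi>: "continuous_on UNIV (\<lambda>t. \<xi> (max 0 t))" by (rule lipschitz_on_continuous_on)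
  let ?z = "\<lambda>t. \<sigma> * \<xi> (max 0 t)" and ?r = "\<lambda>p. r (fst p, \<sigma> * snd p)"
  have \<sigma>1: "\<sigma> * \<sigma> = 1" "\<bar>\<sigma>\<bar> = 1" using \<sigma> by auto
  have \<sigma>\<sigma>: "\<sigma> * (\<sigma> * x) = x" for x using \<sigma> by auto
  have cz: "continuous_on UNIV ?z" by (intro continuous_intros c\<xi>)
  have zc: "?z t \<in> corridor" for t using \<xi>[of "max 0 t"] \<sigma> by auto
  have dr: "bounded_density M ?r" by (rule bounded_density_reflect[OF r])
  have "kruzhkov_on M (\<lambda>s. \<sigma> * clipped_flux M v s)
      {p. 0 < fst p \<and> 0 < \<sigma> * (snd p - \<xi> (max 0 (fst p))) \<and> snd p \<in> corridor} r" (is "kruzhkov_on M _ ?V r")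
    by (rule entropy_inequality_one_side[OF clipped_flux_eq _ r AE c\<xi> _ \<sigma>])
      (use es in \<open>auto simp: entropy_solution_def\<close>)
  then have "kruzhkov_on M (clipped_flux M v) {p. (fst p, \<sigma> * snd p) \<in> ?V} ?r"
    by (rule kruzhkov_reflect[OF r _ \<sigma>1])
  moreover have "{p. (fst p, \<sigma> * snd p) \<in> ?V} = {p. 0 < fst p \<and> ?z (fst p) < snd p \<and> snd p < 1}"
  proof -
    have "(0 < \<sigma> * (\<sigma> * x - y) \<and> \<sigma> * x \<in> corridor) = (\<sigma> * y < x \<and> x < 1)" if "\<sigma> * y \<in> corridor" for x y
      using that \<sigma> by auto
    then show ?thesis using zc by auto
  qed
  ultimately have kr: "kruzhkov_on M (clipped_flux M v) {p. 0 < fst p \<and> ?z (fst p) < snd p \<and> snd p < 1} ?r" by simp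
  obtain \<gamma> where \<gamma>: "strong_trace \<rho> \<xi> \<sigma> \<gamma>" "AE t in lebesgue. 0 < t \<longrightarrow> \<gamma> t = 0"
    using ws \<sigma> unfolding well_separated_def by blast
  have "vanishes_near 1 ?z (\<lambda>p. max 0 (?r p - 0))"
  proof (rule vanishes_near_of_strong_trace[OF dr order_refl _ AE \<sigma>1(2) _ cz _ _ _ \<gamma>(1)])
    show "\<bar>?z t\<bar> \<le> 1" for t using zc[of t] by auto
    show "\<xi> t + \<sigma> * s = \<sigma> * (?z t + 1 * s)" if "0 \<le> t" for t s
      using that by (simp add: distrib_left \<sigma>\<sigma> max_def)
    show "AE t in lebesgue. 0 < t \<longrightarrow> \<gamma> t \<le> 0" using \<gamma>(2) by eventually_elim auto
    fix T :: real assume "T > 0"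
    then obtain t0 where t0: "t0 \<in> {0..T}" "\<forall>t\<in>{0..T}. ?z t \<le> ?z t0"
      using continuous_attains_sup[of "{0..T}" ?z] continuous_on_subset[OF cz] by auto
    show "\<exists>d>0. \<forall>t\<in>{0..T}. \<forall>s. 0 < s \<and> s < d \<longrightarrow> ?z t + 1 * s \<in> corridor"
    proof (intro exI[of _ "1 - ?z t0"] conjI ballI allI impI)
      show "0 < 1 - ?z t0" using zc[of t0] by simp
      fix t s assume "t \<in> {0..T}" "0 < s \<and> s < 1 - ?z t0"
      then show "?z t + 1 * s \<in> corridor" using t0(2) zc[of t] by fastforce
    qed
  qed auto
  then have v1: "vanishes_near 1 ?z ?r" using bounded_densityD(2)[OF dr] by (simp add: max_absorb2)
  obtain \<gamma>' where \<gamma>': "strong_trace \<rho> (\<lambda>_. \<sigma>) (- \<sigma>) \<gamma>'" "AE t in lebesgue. 0 < t \<longrightarrow> \<gamma>' t \<in> {0..?c}"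
    using es \<sigma> unfolding entropy_solution_def by fastforce
  have v2: "vanishes_near (-1) (\<lambda>_. 1) (\<lambda>p. max 0 (?r p - ?c))"
  proof (rule vanishes_near_of_strong_trace[OF dr c _ AE \<sigma>1(2) _ _ _ _ _ \<gamma>'(1)])
    show "\<sigma> + - \<sigma> * s = \<sigma> * (1 + - 1 * s)" for s by (simp add: right_diff_distrib)
    show "AE t in lebesgue. 0 < t \<longrightarrow> \<gamma>' t \<le> ?c" using \<gamma>'(2) by eventually_elim auto
    show "\<exists>d>0. \<forall>t\<in>{0..T}. \<forall>s. 0 < s \<and> s < d \<longrightarrow> 1 + - 1 * s \<in> corridor" for T :: real
      by (intro exI[of _ 1]) auto
  qed auto
  have "\<bar>?z s - ?z t\<bar> \<le> k * \<bar>s - t\<bar>" for s t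
  proof -
    have "\<bar>?z s - ?z t\<bar> = \<bar>\<xi> (max 0 s) - \<xi> (max 0 t)\<bar>"
      using \<sigma>1(2) by (simp add: right_diff_distrib[symmetric] abs_mult)
    then show ?thesis using kz[of s t] by simp
  qed
  then show ?thesis unfolding outgoing_solution_def using dr k0 zc kr v1 v2 by blast
qed

section \<open>Cutting a profile at the turning point\<close>

text \<open>
  The part of a profile on the side \<open>\<sigma>\<close> of the point \<open>s\<close>, at a fixed time.
\<close>

definition side :: "real \<Rightarrow> real \<Rightarrow> (real \<Rightarrow> real) \<Rightarrow> real \<Rightarrow> real" where
  "side \<sigma> s a x = (if 0 < \<sigma> * (x - s) then a x else 0)"

definition profile :: "real \<Rightarrow> (real \<Rightarrow> real) \<Rightarrow> bool" where
  "profile M a \<longleftrightarrow> set_integrable lebesgue corridor a \<and>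
     (AE x in lebesgue. x \<in> corridor \<longrightarrow> 0 \<le> a x \<and> a x \<le> M)"

lemma AE_lebesgue_neq: "AE x in lebesgue. x \<noteq> (s::real)"
  unfolding AE_completion_iff by (rule AE_lborel_singleton)

lemma set_integrable_corridor_const: "set_integrable lebesgue corridor (\<lambda>_. c :: real)"
  unfolding set_integrable_def
  by (intro integrable_scaleR_left integrable_real_indicator) auto

lemma set_lebesgue_mono_AE:
  fixes u w :: "real \<Rightarrow> real"
  assumes "set_integrable lebesgue corridor u" "set_integrable lebesgue corridor w"
    "AE x in lebesgue. x \<in> corridor \<longrightarrow> u x \<le> w x"
  shows "(LINT x:corridor|lebesgue. u x) \<le> (LINT x:corridor|lebesgue. w x)"
  unfolding set_lebesgue_integral_def
proof (rule integral_mono_AE)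
  show "AE x in lebesgue. indicat_real corridor x *\<^sub>R u x \<le> indicat_real corridor x *\<^sub>R w x"
    using assms(3) by eventually_elim (auto split: split_indicator)
qed (use assms in \<open>auto simp: set_integrable_def\<close>)

lemma L1_norm_le:
  assumes "set_integrable lebesgue corridor u" "set_integrable lebesgue corridor w"
    "AE x in lebesgue. x \<in> corridor \<longrightarrow> \<bar>u x\<bar> \<le> w x"
  shows "L1_norm u \<le> (LINT x:corridor|lebesgue. w x)"
  unfolding L1_norm_def by (rule set_lebesgue_mono_AE[OF set_integrable_abs[OF assms(1)] assms(2,3)])

lemma L1_norm_nonneg: "0 \<le> L1_norm u"
  unfolding L1_norm_def set_lebesgue_integral_def by (rule Bochner_Integration.integral_nonneg) auto

lemma L1_norm_minus: "L1_norm (\<lambda>x. a x - b x) = L1_norm (\<lambda>x. b x - a x)"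
  by (simp add: L1_norm_def abs_minus_commute)

lemma AE_lebesgue_exists_between:
  assumes "AE t in lebesgue. P t" "a < (b::real)"
  shows "\<exists>t. a < t \<and> t < b \<and> P t"
proof (rule ccontr)
  assume n: "\<not> ?thesis"
  have "AE t in lborel. P t" using assms(1) by (simp only: AE_completion_iff)
  then have "AE t in lborel. t \<notin> {a<..<b}" by eventually_elim (use n in auto)
  then have "{a<..<b} \<in> null_sets lborel" by (subst AE_iff_null_sets) auto
  then show False using assms(2) by (simp add: null_sets_def)
qed

lemma L1_norm_cong_AE:
  assumes "set_integrable lebesgue corridor u" "AE x in lebesgue. x \<in> corridor \<longrightarrow> u x = w x"
  shows "L1_norm u = L1_norm w" "set_integrable lebesgue corridor w"
proof -
  let ?u = "\<lambda>x. indicat_real corridor x *\<^sub>R u x" and ?w = "\<lambda>x. indicat_real corridor x *\<^sub>R w x"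
  have i: "integrable lebesgue ?u" using assms(1) by (simp add: set_integrable_def)
  have ae: "AE x in lebesgue. ?u x = ?w x" using assms(2) by eventually_elim (auto split: split_indicator)
  have m: "?w \<in> borel_measurable lebesgue"
    by (rule borel_measurable_AE[OF borel_measurable_integrable[OF i] ae])
  show "set_integrable lebesgue corridor w"
    unfolding set_integrable_def by (rule integrable_cong_AE_imp[OF i m ae])
  then have iw: "set_integrable lebesgue corridor w" .
  show "L1_norm u = L1_norm w"
  proof (rule antisym)
    show "L1_norm u \<le> L1_norm w"
      unfolding L1_norm_def[of w] using assms by (intro L1_norm_le set_integrable_abs iw) auto
    have "AE x in lebesgue. x \<in> corridor \<longrightarrow> \<bar>w x\<bar> \<le> \<bar>u x\<bar>" using assms(2) by eventually_elim auto
    then show "L1_norm w \<le> L1_norm u"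
      unfolding L1_norm_def[of u] using assms by (intro L1_norm_le set_integrable_abs iw) auto
  qed
qed

lemma L1_norm_triangle:
  assumes "set_integrable lebesgue corridor u" "set_integrable lebesgue corridor w"
  shows "L1_norm (\<lambda>x. u x + w x) \<le> L1_norm u + L1_norm w"
proof -
  have "L1_norm (\<lambda>x. u x + w x) \<le> (LINT x:corridor|lebesgue. \<bar>u x\<bar> + \<bar>w x\<bar>)"
    using assms by (intro L1_norm_le set_integral_add set_integrable_abs) auto
  also have "\<dots> = L1_norm u + L1_norm w"
    unfolding L1_norm_def using assms by (intro set_integral_add set_integrable_abs)
  finally show ?thesis .
qed

lemma L1_norm_dist_triangle:
  assumes "set_integrable lebesgue corridor u" "set_integrable lebesgue corridor y" "set_integrable lebesgue corridor w"
  shows "L1_norm (\<lambda>x. u x - w x) \<le> L1_norm (\<lambda>x. u x - y x) + L1_norm (\<lambda>x. y x - w x)"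
  using L1_norm_triangle[of "\<lambda>x. u x - y x" "\<lambda>x. y x - w x"] assms by (simp add: set_integral_diff)

lemma L1_norm_zero_AE:
  assumes "set_integrable lebesgue corridor u" "L1_norm u \<le> 0"
  shows "AE x in lebesgue. x \<in> corridor \<longrightarrow> u x = 0"
proof -
  have i: "integrable lebesgue (\<lambda>x. indicat_real corridor x *\<^sub>R \<bar>u x\<bar>)"
    using set_integrable_abs[OF assms(1)] by (simp add: set_integrable_def)
  have "integral\<^sup>L lebesgue (\<lambda>x. indicat_real corridor x *\<^sub>R \<bar>u x\<bar>) = 0"
    using antisym[OF assms(2) L1_norm_nonneg] by (simp only: L1_norm_def set_lebesgue_integral_def)
  then have "AE x in lebesgue. indicat_real corridor x *\<^sub>R \<bar>u x\<bar> = 0"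
    using integral_nonneg_eq_0_iff_AE[OF i] by simp
  then show ?thesis by eventually_elim auto
qed

lemma set_integrable_side:
  assumes "set_integrable lebesgue corridor a"
  shows "set_integrable lebesgue corridor (side \<sigma> s a)"
proof -
  have "open {x::real. 0 < \<sigma> * (x - s)}" by (intro open_Collect_less continuous_intros)
  then have "{x::real. 0 < \<sigma> * (x - s)} \<in> sets lebesgue" by (auto intro: borel_open)
  from integrable_mult_indicator[OF this assms[unfolded set_integrable_def]]
  have "integrable lebesgue (\<lambda>x. indicat_real {x. 0 < \<sigma> * (x - s)} x *\<^sub>R indicat_real corridor x *\<^sub>R a x)" .
  moreover have "(\<lambda>x. indicat_real {x. 0 < \<sigma> * (x - s)} x *\<^sub>R indicat_real corridor x *\<^sub>R a x) =
      (\<lambda>x. indicat_real corridor x *\<^sub>R side \<sigma> s a x)"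
    by (auto simp: fun_eq_iff side_def split: split_indicator)
  ultimately show ?thesis by (simp add: set_integrable_def)
qed

lemma LINT_corridor_interval:
  "(LINT x:corridor|lebesgue. c * indicator {min s s'..max s s'} x) \<le> c * \<bar>s - s'\<bar>"
  "set_integrable lebesgue corridor (\<lambda>x. c * indicator {min s s'..max s s'} x :: real)" if "0 \<le> c"
proof -
  let ?I = "{min s s'..max s s'}"
  have i0: "integrable lebesgue (\<lambda>x. c * indicat_real ?I x)"
    by (intro integrable_mult_right integrable_real_indicator) auto
  show i: "set_integrable lebesgue corridor (\<lambda>x. c * indicator ?I x :: real)"
    unfolding set_integrable_def by (rule integrable_mult_indicator[OF _ i0]) auto
  have "(LINT x:corridor|lebesgue. c * indicator ?I x) \<le> (LINT x|lebesgue. c * indicator ?I x)"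
    unfolding set_lebesgue_integral_def using that i i0
    by (intro integral_mono) (auto simp: set_integrable_def split: split_indicator)
  also have "\<dots> = c * \<bar>s - s'\<bar>" by (auto simp: min_def max_def)
  finally show "(LINT x:corridor|lebesgue. c * indicator ?I x) \<le> c * \<bar>s - s'\<bar>" .
qed

text \<open>
  Between the two cutting points one of the parts is missing; there \<open>\<bar>b\<bar> \<le> \<bar>a - b\<bar> + \<bar>a\<bar>\<close>, so a bound on
  one of the two profiles suffices.
\<close>

lemma side_difference:
  assumes "0 \<le> M" and a: "profile M a" and b: "set_integrable lebesgue corridor b"
  shows "L1_norm (\<lambda>x. side \<sigma> s a x - side \<sigma> s' b x) \<le> L1_norm (\<lambda>x. a x - b x) + M * \<bar>s - s'\<bar>"
proof -
  have ia: "set_integrable lebesgue corridor a" using a by (simp add: profile_def)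
  let ?I = "\<lambda>x. M * indicat_real {min s s'..max s s'} x"
  have i: "set_integrable lebesgue corridor (\<lambda>x. \<bar>a x - b x\<bar>)"
    by (intro set_integrable_abs set_integral_diff ia b)
  have "L1_norm (\<lambda>x. side \<sigma> s a x - side \<sigma> s' b x) \<le> (LINT x:corridor|lebesgue. \<bar>a x - b x\<bar> + ?I x)"
  proof (rule L1_norm_le)
    show "set_integrable lebesgue corridor (\<lambda>x. side \<sigma> s a x - side \<sigma> s' b x)"
      by (intro set_integral_diff set_integrable_side ia b)
    show "set_integrable lebesgue corridor (\<lambda>x. \<bar>a x - b x\<bar> + ?I x)"
      by (intro set_integral_add i LINT_corridor_interval(2) assms(1))
    have "AE x in lebesgue. x \<in> corridor \<longrightarrow> 0 \<le> a x \<and> a x \<le> M" using a by (simp add: profile_def)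
    then show "AE x in lebesgue. x \<in> corridor \<longrightarrow> \<bar>side \<sigma> s a x - side \<sigma> s' b x\<bar> \<le> \<bar>a x - b x\<bar> + ?I x"
    proof eventually_elim
      case (elim x)
      show ?case
      proof
        assume x: "x \<in> corridor"
        show "\<bar>side \<sigma> s a x - side \<sigma> s' b x\<bar> \<le> \<bar>a x - b x\<bar> + ?I x"
        proof (cases "(0 < \<sigma> * (x - s)) = (0 < \<sigma> * (x - s'))")
          case True
          then show ?thesis using assms(1) by (auto simp: side_def split: split_indicator)
        next
          case False
          then have "x \<in> {min s s'..max s s'}" by (auto simp: zero_less_mult_iff)
          then have "?I x = M" by simp
          then show ?thesis using False elim x by (auto simp: side_def)
        qed
      qed
    qed
  qed
  also have "\<dots> = L1_norm (\<lambda>x. a x - b x) + (LINT x:corridor|lebesgue. ?I x)"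
    unfolding L1_norm_def by (intro set_integral_add i LINT_corridor_interval(2) assms(1))
  also have "\<dots> \<le> L1_norm (\<lambda>x. a x - b x) + M * \<bar>s - s'\<bar>"
    using LINT_corridor_interval(1)[OF assms(1)] by simp
  finally show ?thesis .
qed

lemma L1_norm_le_sides:
  assumes "set_integrable lebesgue corridor a" "set_integrable lebesgue corridor b"
  shows "L1_norm (\<lambda>x. a x - b x) \<le> L1_norm (\<lambda>x. side 1 s a x - side 1 s' b x) + L1_norm (\<lambda>x. side (-1) s a x - side (-1) s' b x)"
proof -
  let ?d = "\<lambda>\<sigma> x. side \<sigma> s a x - side \<sigma> s' b x"
  have i: "set_integrable lebesgue corridor (?d \<sigma>)" for \<sigma> by (intro set_integral_diff set_integrable_side assms)
  have "AE x in lebesgue. x \<in> corridor \<longrightarrow> a x - b x = ?d 1 x + ?d (-1) x"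
    using AE_lebesgue_neq[of s] AE_lebesgue_neq[of s'] by eventually_elim (auto simp: side_def)
  then have "L1_norm (\<lambda>x. a x - b x) = L1_norm (\<lambda>x. ?d 1 x + ?d (-1) x)"
    by (rule L1_norm_cong_AE(1)[OF set_integral_diff(1)[OF assms]])
  also have "\<dots> \<le> L1_norm (?d 1) + L1_norm (?d (-1))" by (rule L1_norm_triangle[OF i i])
  finally show ?thesis .
qed

section \<open>Stability of the turning point\<close>

text \<open>
  The cost on the left of \<open>s\<close> minus the cost on its right, as one integral over the corridor.
\<close>

definition imbalance :: "real \<Rightarrow> (real \<Rightarrow> real) \<Rightarrow> real \<Rightarrow> real" where
  "imbalance \<alpha> a s = (LINT y:corridor|lebesgue. cost \<alpha> (a y) * sgn (s - y))"

lemma set_integrable_cost: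
  assumes "set_integrable lebesgue corridor a"
  shows "set_integrable lebesgue corridor (\<lambda>y. cost \<alpha> (a y))"
    "set_integrable lebesgue corridor (\<lambda>y. cost \<alpha> (a y) * sgn (s - y))"
proof -
  show c: "set_integrable lebesgue corridor (\<lambda>y. cost \<alpha> (a y))"
    unfolding cost_def using assms by (intro set_integral_add set_integrable_corridor_const set_integrable_mult_right) auto
  have m: "(\<lambda>y. sgn (s - y)) \<in> borel_measurable lebesgue"
    by (rule measurable_completion) measurable
  have "integrable lebesgue (\<lambda>y. sgn (s - y) * (indicat_real corridor y *\<^sub>R cost \<alpha> (a y)))"
    by (rule integrable_mult_bounded[OF c[unfolded set_integrable_def] m, of 1]) (auto simp: sgn_if)
  then show "set_integrable lebesgue corridor (\<lambda>y. cost \<alpha> (a y) * sgn (s - y))"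
    unfolding set_integrable_def by (simp add: ac_simps)
qed

lemma imbalance_eq:
  assumes a: "set_integrable lebesgue corridor a" and s: "s \<in> corridor"
  shows "(LINT y:{-1..s}|lebesgue. cost \<alpha> (a y)) - (LINT y:{s..1}|lebesgue. cost \<alpha> (a y)) = imbalance \<alpha> a s"
proof -
  let ?k = "\<lambda>y. indicat_real corridor y *\<^sub>R cost \<alpha> (a y)"
  have i: "integrable lebesgue ?k" using set_integrable_cost(1)[OF a] by (simp add: set_integrable_def)
  have part: "integrable lebesgue (\<lambda>y. indicat_real A y *\<^sub>R cost \<alpha> (a y))"
    "(LINT y:A|lebesgue. cost \<alpha> (a y)) = (LINT y|lebesgue. indicat_real A y *\<^sub>R ?k y)"
    "integrable lebesgue (\<lambda>y. indicat_real A y *\<^sub>R ?k y)"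
    if A: "A \<in> sets lebesgue" "A \<subseteq> {-1..1}" for A
  proof -
    show iA: "integrable lebesgue (\<lambda>y. indicat_real A y *\<^sub>R ?k y)"
      by (rule integrable_mult_indicator[OF A(1) i])
    have ae: "AE y in lebesgue. indicat_real A y *\<^sub>R ?k y = indicat_real A y *\<^sub>R cost \<alpha> (a y)"
      using AE_lebesgue_neq[of 1] AE_lebesgue_neq[of "-1"]
      by eventually_elim (use A(2) in \<open>force split: split_indicator\<close>)
    have m: "(\<lambda>y. indicat_real A y *\<^sub>R cost \<alpha> (a y)) \<in> borel_measurable lebesgue"
      by (rule borel_measurable_AE[OF borel_measurable_integrable[OF iA] ae])
    show "integrable lebesgue (\<lambda>y. indicat_real A y *\<^sub>R cost \<alpha> (a y))"
      by (rule integrable_cong_AE_imp[OF iA m ae])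
    show "(LINT y:A|lebesgue. cost \<alpha> (a y)) = (LINT y|lebesgue. indicat_real A y *\<^sub>R ?k y)"
      unfolding set_lebesgue_integral_def
      by (rule integral_cong_AE[symmetric, OF borel_measurable_integrable[OF iA] m ae])
  qed
  have s1: "{-1..s} \<in> sets lebesgue" "{-1..s} \<subseteq> {-1..1}" "{s..1} \<in> sets lebesgue" "{s..1} \<subseteq> {-1..1}"
    using s by auto
  have "(LINT y:{-1..s}|lebesgue. cost \<alpha> (a y)) - (LINT y:{s..1}|lebesgue. cost \<alpha> (a y)) =
     (LINT y|lebesgue. indicat_real {-1..s} y *\<^sub>R ?k y - indicat_real {s..1} y *\<^sub>R ?k y)"
    unfolding part(2)[OF s1(1,2)] part(2)[OF s1(3,4)]
    by (rule Bochner_Integration.integral_diff[symmetric, OF part(3)[OF s1(1,2)] part(3)[OF s1(3,4)]])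
  also have "\<dots> = (LINT y|lebesgue. indicat_real corridor y *\<^sub>R (cost \<alpha> (a y) * sgn (s - y)))"
  proof (rule integral_cong_AE)
    show "(\<lambda>y. indicat_real {-1..s} y *\<^sub>R ?k y - indicat_real {s..1} y *\<^sub>R ?k y) \<in> borel_measurable lebesgue"
      by (rule borel_measurable_integrable[OF Bochner_Integration.integrable_diff[OF part(3)[OF s1(1,2)] part(3)[OF s1(3,4)]]])
    show "(\<lambda>y. indicat_real corridor y *\<^sub>R (cost \<alpha> (a y) * sgn (s - y))) \<in> borel_measurable lebesgue"
      using set_integrable_cost(2)[OF a, of \<alpha> s] by (auto simp: set_integrable_def)
    show "AE y in lebesgue. indicat_real {-1..s} y *\<^sub>R ?k y - indicat_real {s..1} y *\<^sub>R ?k y =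
        indicat_real corridor y *\<^sub>R (cost \<alpha> (a y) * sgn (s - y))"
      using AE_lebesgue_neq[of s] by eventually_elim (auto split: split_indicator)
  qed
  finally show ?thesis by (simp add: imbalance_def set_lebesgue_integral_def)
qed

lemma imbalance_cong_AE:
  assumes "set_integrable lebesgue corridor a" "AE x in lebesgue. x \<in> corridor \<longrightarrow> a x = b x"
  shows "imbalance \<alpha> a s = imbalance \<alpha> b s"
proof -
  note b = L1_norm_cong_AE(2)[OF assms]
  have 1: "(\<lambda>y. indicat_real corridor y *\<^sub>R (cost \<alpha> (a y) * sgn (s - y))) \<in> borel_measurable lebesgue"
    using set_integrable_cost(2)[OF assms(1), of \<alpha> s] by (auto simp: set_integrable_def)
  have 2: "(\<lambda>y. indicat_real corridor y *\<^sub>R (cost \<alpha> (b y) * sgn (s - y))) \<in> borel_measurable lebesgue"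
    using set_integrable_cost(2)[OF b, of \<alpha> s] by (auto simp: set_integrable_def)
  show ?thesis
    unfolding imbalance_def set_lebesgue_integral_def
    by (rule integral_cong_AE[OF 1 2]) (use assms(2) in \<open>eventually_elim, auto split: split_indicator\<close>)
qed

lemma imbalance_profile_change:
  assumes "0 \<le> M" "0 \<le> \<alpha>'" and a: "profile M a" and b: "set_integrable lebesgue corridor b"
  shows "\<bar>imbalance \<alpha> a s - imbalance \<alpha>' b s\<bar> \<le> 2 * M * \<bar>\<alpha> - \<alpha>'\<bar> + \<alpha>' * L1_norm (\<lambda>x. a x - b x)"
proof -
  have ia: "set_integrable lebesgue corridor a" using a by (simp add: profile_def)
  let ?h = "\<lambda>y. cost \<alpha> (a y) * sgn (s - y) - cost \<alpha>' (b y) * sgn (s - y)"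
  have ih: "set_integrable lebesgue corridor ?h" by (intro set_integral_diff set_integrable_cost ia b)
  have id: "set_integrable lebesgue corridor (\<lambda>x. \<bar>a x - b x\<bar>)" by (intro set_integrable_abs set_integral_diff ia b)
  have "\<bar>imbalance \<alpha> a s - imbalance \<alpha>' b s\<bar> = \<bar>LINT y:corridor|lebesgue. ?h y\<bar>"
    unfolding imbalance_def by (subst set_integral_diff(2)) (auto intro: set_integrable_cost ia b)
  also have "\<dots> \<le> L1_norm ?h"
    unfolding L1_norm_def set_lebesgue_integral_def
    using integral_abs_bound[of lebesgue "\<lambda>y. indicat_real corridor y *\<^sub>R ?h y"] by (simp add: abs_mult)
  also have "\<dots> \<le> (LINT x:corridor|lebesgue. \<bar>\<alpha> - \<alpha>'\<bar> * M + \<alpha>' * \<bar>a x - b x\<bar>)"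
  proof (rule L1_norm_le[OF ih])
    show "set_integrable lebesgue corridor (\<lambda>x. \<bar>\<alpha> - \<alpha>'\<bar> * M + \<alpha>' * \<bar>a x - b x\<bar>)"
      using id by (intro set_integral_add set_integrable_corridor_const set_integrable_mult_right) auto
    have "AE x in lebesgue. x \<in> corridor \<longrightarrow> 0 \<le> a x \<and> a x \<le> M" using a by (simp add: profile_def)
    then show "AE x in lebesgue. x \<in> corridor \<longrightarrow> \<bar>?h x\<bar> \<le> \<bar>\<alpha> - \<alpha>'\<bar> * M + \<alpha>' * \<bar>a x - b x\<bar>"
    proof eventually_elim
      case (elim x)
      show ?case
      proof
        assume "x \<in> corridor"
        then have ax: "\<bar>a x\<bar> \<le> M" using elim by auto
        have "?h x = ((\<alpha> - \<alpha>') * a x + \<alpha>' * (a x - b x)) * sgn (s - x)" by (simp add: cost_def algebra_simps)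
        then have "\<bar>?h x\<bar> = \<bar>(\<alpha> - \<alpha>') * a x + \<alpha>' * (a x - b x)\<bar> * \<bar>sgn (s - x)\<bar>" by (simp add: abs_mult)
        also have "\<dots> \<le> \<bar>(\<alpha> - \<alpha>') * a x + \<alpha>' * (a x - b x)\<bar> * 1" by (intro mult_left_mono) (auto simp: sgn_if)
        also have "\<dots> \<le> \<bar>\<alpha> - \<alpha>'\<bar> * \<bar>a x\<bar> + \<alpha>' * \<bar>a x - b x\<bar>"
          using abs_triangle_ineq[of "(\<alpha> - \<alpha>') * a x" "\<alpha>' * (a x - b x)"] assms(2) by (simp add: abs_mult)
        also have "\<dots> \<le> \<bar>\<alpha> - \<alpha>'\<bar> * M + \<alpha>' * \<bar>a x - b x\<bar>"
          using ax by (intro add_right_mono mult_left_mono) auto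
        finally show "\<bar>?h x\<bar> \<le> \<bar>\<alpha> - \<alpha>'\<bar> * M + \<alpha>' * \<bar>a x - b x\<bar>" .
      qed
    qed
  qed
  also have "\<dots> = (LINT x:corridor|lebesgue. \<bar>\<alpha> - \<alpha>'\<bar> * M) + (LINT x:corridor|lebesgue. \<alpha>' * \<bar>a x - b x\<bar>)"
    using id by (intro set_integral_add set_integrable_corridor_const set_integrable_mult_right) auto
  also have "\<dots> = 2 * M * \<bar>\<alpha> - \<alpha>'\<bar> + \<alpha>' * L1_norm (\<lambda>x. a x - b x)"
    by (simp add: L1_norm_def set_lebesgue_integral_def)
  finally show ?thesis .
qed

text \<open>
  Moving \<open>s\<close> to the right moves cost from one side to the other, hence the factor 2; the cost lies
  between 1 and \<open>1 + \<alpha> * M\<close>.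
\<close>

lemma imbalance_increment:
  assumes "0 \<le> M" "0 \<le> \<alpha>" and a: "profile M a" and s: "s \<in> corridor" "s' \<in> corridor" "s \<le> s'"
  shows "2 * (s' - s) \<le> imbalance \<alpha> a s' - imbalance \<alpha> a s"
    "imbalance \<alpha> a s' - imbalance \<alpha> a s \<le> 2 * (1 + \<alpha> * M) * (s' - s)"
proof -
  have ia: "set_integrable lebesgue corridor a" using a by (simp add: profile_def)
  let ?h = "\<lambda>y. cost \<alpha> (a y) * sgn (s' - y) - cost \<alpha> (a y) * sgn (s - y)"
  have ih: "set_integrable lebesgue corridor ?h" by (intro set_integral_diff set_integrable_cost ia)
  have h: "imbalance \<alpha> a s' - imbalance \<alpha> a s = (LINT y:corridor|lebesgue. ?h y)"
    unfolding imbalance_def by (subst set_integral_diff(2)) (auto intro: set_integrable_cost ia)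
  have sub: "corridor \<inter> {s..s'} = {s..s'}" using s by auto
  have iI: "set_integrable lebesgue corridor (\<lambda>y. c * indicat_real {s..s'} y)" for c
    unfolding set_integrable_def using s(3)
    by (intro integrable_mult_indicator integrable_mult_right integrable_real_indicator) auto
  have I: "(LINT y:corridor|lebesgue. c * indicat_real {s..s'} y) = c * (s' - s)" for c
  proof -
    have "(\<lambda>y. indicat_real corridor y *\<^sub>R (c * indicat_real {s..s'} y)) = (\<lambda>y. c * indicat_real {s..s'} y)"
      using s by (auto simp: fun_eq_iff split: split_indicator)
    then show ?thesis unfolding set_lebesgue_integral_def using s by (simp only:) simp
  qed
  have ae: "AE x in lebesgue. x \<in> corridor \<longrightarrow> 2 * indicat_real {s..s'} x \<le> ?h x \<and> ?h x \<le> 2 * (1 + \<alpha> * M) * indicat_real {s..s'} x"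
    using a[unfolded profile_def, THEN conjunct2] AE_lebesgue_neq[of s] AE_lebesgue_neq[of s']
  proof eventually_elim
    case (elim x)
    show ?case
    proof
      assume "x \<in> corridor"
      then have "0 \<le> \<alpha> * a x" "\<alpha> * a x \<le> \<alpha> * M" using elim(1) assms(2) by (auto intro: mult_left_mono)
      then have c: "1 \<le> cost \<alpha> (a x)" "cost \<alpha> (a x) \<le> 1 + \<alpha> * M" by (auto simp: cost_def)
      have "?h x = 2 * cost \<alpha> (a x) * indicat_real {s..s'} x"
        using elim(2,3) s(3) by (auto simp: sgn_if split: split_indicator)
      then show "2 * indicat_real {s..s'} x \<le> ?h x \<and> ?h x \<le> 2 * (1 + \<alpha> * M) * indicat_real {s..s'} x"
        using c by (auto split: split_indicator)
    qed
  qed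
  have "(LINT y:corridor|lebesgue. 2 * indicat_real {s..s'} y) \<le> (LINT y:corridor|lebesgue. ?h y)"
    by (rule set_lebesgue_mono_AE[OF iI ih]) (use ae in \<open>eventually_elim, auto\<close>)
  then show "2 * (s' - s) \<le> imbalance \<alpha> a s' - imbalance \<alpha> a s" by (simp only: h I)
  have "(LINT y:corridor|lebesgue. ?h y) \<le> (LINT y:corridor|lebesgue. 2 * (1 + \<alpha> * M) * indicat_real {s..s'} y)"
    by (rule set_lebesgue_mono_AE[OF ih iI]) (use ae in \<open>eventually_elim, auto\<close>)
  then show "imbalance \<alpha> a s' - imbalance \<alpha> a s \<le> 2 * (1 + \<alpha> * M) * (s' - s)" by (simp only: h I)
qed

text \<open>
  The imbalance of \<open>b\<close> vanishes at \<open>s'\<close> and grows with slope at least 2, so its value at \<open>s\<close> bounds the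
  distance of \<open>s\<close> and \<open>s'\<close>. As the imbalance of \<open>a\<close> vanishes at \<open>s\<close>, that value is the effect of changing
  the profile and the parameter.
\<close>

lemma turning_point_stability:
  assumes "0 \<le> M" "0 \<le> \<alpha>'" and a: "profile M a" and b: "profile M b"
    and s: "s \<in> corridor" "s' \<in> corridor"
    and "imbalance \<alpha> a s = 0" "imbalance \<alpha>' b s' = 0"
  shows "2 * \<bar>s - s'\<bar> \<le> 2 * M * \<bar>\<alpha> - \<alpha>'\<bar> + \<alpha>' * L1_norm (\<lambda>x. a x - b x)"
proof -
  have "2 * \<bar>s - s'\<bar> \<le> \<bar>imbalance \<alpha>' b s' - imbalance \<alpha>' b s\<bar>"
    using imbalance_increment(1)[OF assms(1,2) b s] imbalance_increment(1)[OF assms(1,2) b s(2,1)]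
    by (cases "s \<le> s'") auto
  also have "\<dots> = \<bar>imbalance \<alpha> a s - imbalance \<alpha>' b s\<bar>" using assms(7,8) by simp
  also have "\<dots> \<le> 2 * M * \<bar>\<alpha> - \<alpha>'\<bar> + \<alpha>' * L1_norm (\<lambda>x. a x - b x)"
    using b by (intro imbalance_profile_change assms(1,2) a) (simp add: profile_def)
  finally show ?thesis .
qed

section \<open>The stability estimate and uniqueness\<close>

lemma AE_half_strip_sections:
  assumes "AE p::real \<times> real in lborel. 0 \<le> fst p \<and> snd p \<in> corridor \<longrightarrow> P p"
  shows "AE t in lebesgue. 0 \<le> t \<longrightarrow> (AE x in lebesgue. x \<in> corridor \<longrightarrow> P (t, x))"
proof -
  have "AE p in lborel \<Otimes>\<^sub>M lborel. 0 \<le> fst p \<and> snd p \<in> corridor \<longrightarrow> P p" using assms unfolding lborel_prod .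
  then have "AE t in lborel. AE x in lborel. 0 \<le> t \<and> x \<in> corridor \<longrightarrow> P (t, x)"
    using lborel_pair.AE_pair by fastforce
  then have "AE t in lborel. 0 \<le> t \<longrightarrow> (AE x in lebesgue. x \<in> corridor \<longrightarrow> P (t, x))"
  proof eventually_elim
    case (elim t)
    show ?case unfolding AE_completion_iff using elim by (auto elim: eventually_mono)
  qed
  then show ?thesis by (rule AE_completion)
qed

text \<open>
  What remains of a Hughes solution for the comparison at fixed times: \<open>g\<close> is the representative that
  is continuous in time with values in \<open>L\<^sup>1\<close>, \<open>r\<close> a Borel representative.
\<close>

definition time_slices ::
  "real \<Rightarrow> real \<Rightarrow> (real \<Rightarrow> real) \<Rightarrow> (real \<times> real \<Rightarrow> real) \<Rightarrow> (real \<Rightarrow> real) \<Rightarrow> (real \<Rightarrow> real \<Rightarrow> real) \<Rightarrow> bool" where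
  "time_slices M \<alpha> \<rho>0 r \<xi> g \<longleftrightarrow>
     (\<forall>t\<ge>0. set_integrable lebesgue corridor (g t)) \<and>
     (\<forall>t\<^sub>0\<ge>0. ((\<lambda>t. L1_norm (\<lambda>x. g t x - g t\<^sub>0 x)) \<longlongrightarrow> 0) (at t\<^sub>0 within {0..})) \<and>
     (AE x in lebesgue. x \<in> corridor \<longrightarrow> g 0 x = \<rho>0 x) \<and> profile M (g 0) \<and> imbalance \<alpha> (g 0) (\<xi> 0) = 0 \<and>
     (AE t in lebesgue. 0 < t \<longrightarrow> profile M (g t) \<and> imbalance \<alpha> (g t) (\<xi> t) = 0 \<and>
        (AE x in lebesgue. x \<in> corridor \<longrightarrow> g t x = r (t, x)))"

lemma time_slicesD:
  assumes "time_slices M \<alpha> \<rho>0 r \<xi> g"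
  shows "0 \<le> t \<Longrightarrow> set_integrable lebesgue corridor (g t)"
    "0 \<le> t \<Longrightarrow> ((\<lambda>s. L1_norm (\<lambda>x. g s x - g t x)) \<longlongrightarrow> 0) (at_right t)"
    "AE x in lebesgue. x \<in> corridor \<longrightarrow> g 0 x = \<rho>0 x" "profile M (g 0)" "imbalance \<alpha> (g 0) (\<xi> 0) = 0"
    "AE t in lebesgue. 0 < t \<longrightarrow> profile M (g t) \<and> imbalance \<alpha> (g t) (\<xi> t) = 0 \<and>
        (AE x in lebesgue. x \<in> corridor \<longrightarrow> g t x = r (t, x))"
proof -
  assume "0 \<le> t"
  then have "((\<lambda>s. L1_norm (\<lambda>x. g s x - g t x)) \<longlongrightarrow> 0) (at t within {0..})"
    using assms unfolding time_slices_def by blast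
  then show "((\<lambda>s. L1_norm (\<lambda>x. g s x - g t x)) \<longlongrightarrow> 0) (at_right t)"
    by (rule tendsto_within_subset) (use \<open>0 \<le> t\<close> in auto)
qed (use assms in \<open>unfold time_slices_def, blast+\<close>)

text \<open>
  The balance of costs holds at almost every positive time only. Since profile and turning point are
  continuous in time, it extends to time 0, which is where the estimate needs it.
\<close>

lemma entropy_solution_time_slices:
  assumes M: "0 \<le> M" "0 \<le> \<alpha>" and id: "initial_datum M \<rho>0" and es: "entropy_solution M v \<alpha> \<rho>0 \<rho> \<xi>"
    and r: "bounded_density M r"
    and AE: "AE p in lborel. 0 \<le> fst p \<and> snd p \<in> corridor \<longrightarrow> \<rho> (fst p) (snd p) = r p"
  obtains g where "time_slices M \<alpha> \<rho>0 r \<xi> g"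
proof -
  have \<xi>: "\<xi> t \<in> corridor" if "0 \<le> t" for t using es that unfolding entropy_solution_def by auto
  obtain k where k: "k-lipschitz_on {0..} \<xi>" using es unfolding entropy_solution_def by blast
  obtain g where g: "AE p in lebesgue_on ({0..} \<times> corridor). g (fst p) (snd p) = \<rho> (fst p) (snd p)"
      "\<forall>t\<ge>0. set_integrable lebesgue corridor (g t)"
      "\<forall>t\<^sub>0\<ge>0. ((\<lambda>t. L1_norm (\<lambda>x. g t x - g t\<^sub>0 x)) \<longlongrightarrow> 0) (at t\<^sub>0 within {0..})"
      "AE x in lebesgue_on corridor. g 0 x = \<rho>0 x"
    using es unfolding entropy_solution_def continuous_L1_with_initial_def by blast
  have g0: "AE x in lebesgue. x \<in> corridor \<longrightarrow> g 0 x = \<rho>0 x"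
    using g(4) by (subst (asm) AE_restrict_space_iff) auto
  have "AE x in lebesgue. x \<in> corridor \<longrightarrow> 0 \<le> g 0 x \<and> g 0 x \<le> M"
    using g0 by eventually_elim (use id in \<open>auto simp: initial_datum_def image_subset_iff\<close>)
  then have p0: "profile M (g 0)" using g(2) by (simp add: profile_def)
  have "AE p in lborel. 0 \<le> fst p \<and> snd p \<in> corridor \<longrightarrow> g (fst p) (snd p) = r p \<and> \<rho> (fst p) (snd p) = r p"
    using g(1)[unfolded AE_half_strip_iff] AE by eventually_elim auto
  from AE_half_strip_sections[OF this]
  have sl: "AE t in lebesgue. 0 \<le> t \<longrightarrow> (AE x in lebesgue. x \<in> corridor \<longrightarrow> g t x = r (t, x) \<and> \<rho> t x = r (t, x))" by simp
  have bal: "AE t in lebesgue. 0 < t \<longrightarrow>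
        (LINT y:{-1..\<xi> t}|lebesgue. cost \<alpha> (\<rho> t y)) = (LINT y:{\<xi> t..1}|lebesgue. cost \<alpha> (\<rho> t y))"
    using es unfolding entropy_solution_def by blast
  have good: "AE t in lebesgue. 0 < t \<longrightarrow> profile M (g t) \<and> imbalance \<alpha> (g t) (\<xi> t) = 0 \<and>
        (AE x in lebesgue. x \<in> corridor \<longrightarrow> g t x = r (t, x))"
    using sl bal
  proof eventually_elim
    case (elim t)
    show ?case
    proof (intro impI conjI)
      assume t: "0 < t"
      have ae: "AE x in lebesgue. x \<in> corridor \<longrightarrow> g t x = r (t, x) \<and> \<rho> t x = r (t, x)" using elim(1) t by simp
      show "AE x in lebesgue. x \<in> corridor \<longrightarrow> g t x = r (t, x)" using ae by eventually_elim auto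
      then have "AE x in lebesgue. x \<in> corridor \<longrightarrow> 0 \<le> g t x \<and> g t x \<le> M"
        by eventually_elim (use bounded_densityD(2,3)[OF r] in auto)
      then show "profile M (g t)" using g(2) t by (simp add: profile_def)
      have ig: "set_integrable lebesgue corridor (g t)" using g(2) t by simp
      have ae': "AE x in lebesgue. x \<in> corridor \<longrightarrow> g t x = \<rho> t x" using ae by eventually_elim auto
      have "imbalance \<alpha> (\<rho> t) (\<xi> t) = 0"
        using imbalance_eq[OF L1_norm_cong_AE(2)[OF ig ae'] \<xi>[of t], of \<alpha>] elim(2) t by simp
      then show "imbalance \<alpha> (g t) (\<xi> t) = 0" using imbalance_cong_AE[OF ig ae'] by simp
    qed
  qed
  have "imbalance \<alpha> (g 0) (\<xi> 0) = 0"
  proof (rule ccontr)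
    assume n: "imbalance \<alpha> (g 0) (\<xi> 0) \<noteq> 0"
    let ?h = "\<lambda>t. 2 * (1 + \<alpha> * M) * \<bar>\<xi> 0 - \<xi> t\<bar> + \<alpha> * L1_norm (\<lambda>x. g t x - g 0 x)"
    have sub: "at_right (0::real) \<le> at 0 within {0..}" by (rule at_le) auto
    have "(\<xi> \<longlongrightarrow> \<xi> 0) (at 0 within {0..})"
      using lipschitz_on_continuous_on[OF k] by (simp add: continuous_on_def)
    then have 1: "(\<xi> \<longlongrightarrow> \<xi> 0) (at_right 0)" using sub by (rule tendsto_mono[rotated])
    have "((\<lambda>t. L1_norm (\<lambda>x. g t x - g 0 x)) \<longlongrightarrow> 0) (at_right 0)"
      using g(3) sub by (auto intro: tendsto_mono)
    then have "(?h \<longlongrightarrow> 2 * (1 + \<alpha> * M) * \<bar>\<xi> 0 - \<xi> 0\<bar> + \<alpha> * 0) (at_right 0)"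
      using 1 by (intro tendsto_intros)
    then have "\<forall>\<^sub>F t in at_right 0. ?h t < \<bar>imbalance \<alpha> (g 0) (\<xi> 0)\<bar>"
      using n by (intro order_tendstoD(2)) auto
    then obtain b where b: "b > 0" "\<And>t. 0 < t \<Longrightarrow> t < b \<Longrightarrow> ?h t < \<bar>imbalance \<alpha> (g 0) (\<xi> 0)\<bar>"
      unfolding eventually_at_right_field by auto
    obtain t where t: "0 < t" "t < b" "profile M (g t)" "imbalance \<alpha> (g t) (\<xi> t) = 0"
      using AE_lebesgue_exists_between[OF good b(1)] by auto
    have "\<bar>imbalance \<alpha> (g 0) (\<xi> 0) - imbalance \<alpha> (g 0) (\<xi> t)\<bar> \<le> 2 * (1 + \<alpha> * M) * \<bar>\<xi> 0 - \<xi> t\<bar>"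
      using imbalance_increment[OF M p0 \<xi>[of 0] \<xi>[of t]] imbalance_increment[OF M p0 \<xi>[of t] \<xi>[of 0]] t(1)
      by (cases "\<xi> 0 \<le> \<xi> t") (auto simp: abs_le_iff)
    moreover have "\<bar>imbalance \<alpha> (g t) (\<xi> t) - imbalance \<alpha> (g 0) (\<xi> t)\<bar> \<le> 2 * M * \<bar>\<alpha> - \<alpha>\<bar> + \<alpha> * L1_norm (\<lambda>x. g t x - g 0 x)"
      using g(2) by (intro imbalance_profile_change M t(3)) auto
    ultimately have "\<bar>imbalance \<alpha> (g 0) (\<xi> 0)\<bar> \<le> ?h t" using t(4) by simp
    then show False using b(2)[OF t(1,2)] by simp
  qed
  then show thesis using that[of g] g(2,3) g0 p0 good unfolding time_slices_def by blast
qed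

text \<open>
  The distance of the cut profiles inherits continuity from the profiles and the turning points by
  \<open>side_difference\<close>, applied with the bounded profile at the limit time.
\<close>

lemma side_mass_tendsto:
  assumes M: "0 \<le> M" and g1: "time_slices M \<alpha>1 \<rho>01 r1 \<xi>1 g1" and g2: "time_slices M \<alpha>2 \<rho>02 r2 \<xi>2 g2"
    and c: "continuous_on {0..} \<xi>1" "continuous_on {0..} \<xi>2" and t0: "0 \<le> t0"
    and p: "profile M (g1 t0)" "profile M (g2 t0)"
  shows "((\<lambda>t. L1_norm (\<lambda>x. side \<sigma> (\<xi>1 t) (g1 t) x - side \<sigma> (\<xi>2 t) (g2 t) x)) \<longlongrightarrow>
     L1_norm (\<lambda>x. side \<sigma> (\<xi>1 t0) (g1 t0) x - side \<sigma> (\<xi>2 t0) (g2 t0) x)) (at_right t0)"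
    (is "(?\<mu> \<longlongrightarrow> ?\<mu> t0) _")
proof (rule LIM_zero_cancel, rule Lim_null_comparison)
  let ?B = "\<lambda>g \<xi> t. L1_norm (\<lambda>x. g t x - g t0 x) + M * \<bar>\<xi> t0 - \<xi> t\<bar>"
  have lim: "(?B g \<xi> \<longlongrightarrow> 0) (at_right t0)"
    if g: "time_slices M \<alpha> \<rho>0 r \<xi> g" and c: "continuous_on {0..} \<xi>" for \<alpha> \<rho>0 r \<xi> g
  proof -
    have "(\<xi> \<longlongrightarrow> \<xi> t0) (at t0 within {0..})" using c t0 by (simp add: continuous_on_def)
    then have "(\<xi> \<longlongrightarrow> \<xi> t0) (at_right t0)" by (rule tendsto_within_subset) (use t0 in auto)
    then have "(?B g \<xi> \<longlongrightarrow> 0 + M * \<bar>\<xi> t0 - \<xi> t0\<bar>) (at_right t0)"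
      by (intro tendsto_intros time_slicesD(2)[OF g t0])
    then show ?thesis by simp
  qed
  show "((\<lambda>t. ?B g1 \<xi>1 t + ?B g2 \<xi>2 t) \<longlongrightarrow> 0) (at_right t0)"
    using tendsto_add[OF lim[OF g1 c(1)] lim[OF g2 c(2)]] by simp
  show "\<forall>\<^sub>F t in at_right t0. norm (?\<mu> t - ?\<mu> t0) \<le> ?B g1 \<xi>1 t + ?B g2 \<xi>2 t"
    unfolding eventually_at_right_field
  proof (intro exI[of _ "t0 + 1"] conjI allI impI)
    fix t assume "t0 < t"
    then have t: "0 \<le> t" using t0 by simp
    let ?A1 = "side \<sigma> (\<xi>1 t) (g1 t)" and ?A2 = "side \<sigma> (\<xi>2 t) (g2 t)"
    let ?B1 = "side \<sigma> (\<xi>1 t0) (g1 t0)" and ?B2 = "side \<sigma> (\<xi>2 t0) (g2 t0)"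
    have i: "set_integrable lebesgue corridor ?A1" "set_integrable lebesgue corridor ?A2"
      "set_integrable lebesgue corridor ?B1" "set_integrable lebesgue corridor ?B2"
      using time_slicesD(1)[OF g1] time_slicesD(1)[OF g2] t t0 by (auto intro: set_integrable_side)
    have d: "L1_norm (\<lambda>x. ?B1 x - ?A1 x) \<le> ?B g1 \<xi>1 t" "L1_norm (\<lambda>x. ?B2 x - ?A2 x) \<le> ?B g2 \<xi>2 t"
      using side_difference[OF M p(1) time_slicesD(1)[OF g1 t], of \<sigma> "\<xi>1 t0" "\<xi>1 t"]
        side_difference[OF M p(2) time_slicesD(1)[OF g2 t], of \<sigma> "\<xi>2 t0" "\<xi>2 t"]
      by (auto simp: L1_norm_minus[of "g1 t0"] L1_norm_minus[of "g2 t0"])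
    have "?\<mu> t \<le> L1_norm (\<lambda>x. ?B1 x - ?A1 x) + ?\<mu> t0 + L1_norm (\<lambda>x. ?B2 x - ?A2 x)"
      using L1_norm_dist_triangle[OF i(1,3,2)] L1_norm_dist_triangle[OF i(3,4,2)] L1_norm_minus[of ?A1 ?B1] by linarith
    moreover have "?\<mu> t0 \<le> L1_norm (\<lambda>x. ?B1 x - ?A1 x) + ?\<mu> t + L1_norm (\<lambda>x. ?B2 x - ?A2 x)"
      using L1_norm_dist_triangle[OF i(3,1,4)] L1_norm_dist_triangle[OF i(1,2,4)] L1_norm_minus[of ?A2 ?B2] by linarith
    ultimately show "norm (?\<mu> t - ?\<mu> t0) \<le> ?B g1 \<xi>1 t + ?B g2 \<xi>2 t" using d by (simp add: abs_le_iff)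
  qed simp
qed

text \<open>
  The side \<open>\<sigma>\<close> of a density, reflected for \<open>\<sigma> = -1\<close> so that it always leaves to the right.
\<close>

definition oriented_part :: "real \<Rightarrow> (real \<Rightarrow> real) \<Rightarrow> (real \<times> real \<Rightarrow> real) \<Rightarrow> real \<times> real \<Rightarrow> real" where
  "oriented_part \<sigma> \<xi> r = right_part (\<lambda>t. \<sigma> * \<xi> (max 0 t)) (\<lambda>p. r (fst p, \<sigma> * snd p))"

lemma side_mass_eq:
  assumes r: "bounded_density M r1" "bounded_density M r2" and \<sigma>: "\<sigma> = 1 \<or> \<sigma> = -1" and t: "0 \<le> t"
    and i: "set_integrable lebesgue corridor a1" "set_integrable lebesgue corridor a2"
    and ae: "AE x in lebesgue. x \<in> corridor \<longrightarrow> a1 x = r1 (t, x)" "AE x in lebesgue. x \<in> corridor \<longrightarrow> a2 x = r2 (t, x)"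
  shows "(LINT x|lborel. indicator corridor x * \<bar>oriented_part \<sigma> \<xi>1 r1 (t, x) -
        oriented_part \<sigma> \<xi>2 r2 (t, x)\<bar>) =
     L1_norm (\<lambda>x. side \<sigma> (\<xi>1 t) a1 x - side \<sigma> (\<xi>2 t) a2 x)"
proof -
  let ?s = "\<lambda>x. side \<sigma> (\<xi>1 t) (\<lambda>y. r1 (t, y)) x - side \<sigma> (\<xi>2 t) (\<lambda>y. r2 (t, y)) x"
  let ?h = "\<lambda>x. indicat_real corridor x * \<bar>?s x\<bar>"
  have "(\<lambda>x. (t, x)) \<in> borel \<rightarrow>\<^sub>M borel"
    by (intro borel_measurable_continuous_onI continuous_on_Pair continuous_on_const continuous_on_id)
  note [measurable] = measurable_compose[OF this bounded_densityD(1)[OF r(1)]] measurable_compose[OF this bounded_densityD(1)[OF r(2)]]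
  have hm: "?h \<in> borel_measurable borel" unfolding side_def by measurable
  have "(LINT x|lborel. indicator corridor x * \<bar>oriented_part \<sigma> \<xi>1 r1 (t, x) -
        oriented_part \<sigma> \<xi>2 r2 (t, x)\<bar>) = \<bar>\<sigma>\<bar> *\<^sub>R (LINT x|lborel. ?h (0 + \<sigma> * x))"
    using \<sigma> t by (elim disjE) (auto simp: oriented_part_def right_part_def side_def max_def intro!: Bochner_Integration.integral_cong split: split_indicator)
  also have "\<dots> = integral\<^sup>L lborel ?h" by (rule lborel_integral_real_affine[symmetric]) (use \<sigma> in auto)
  also have "\<dots> = integral\<^sup>L lebesgue ?h" using hm by (simp add: integral_completion)
  also have "\<dots> = L1_norm ?s" by (simp add: L1_norm_def set_lebesgue_integral_def)
  also have "\<dots> = L1_norm (\<lambda>x. side \<sigma> (\<xi>1 t) a1 x - side \<sigma> (\<xi>2 t) a2 x)"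
  proof (rule L1_norm_cong_AE(1)[symmetric])
    show "set_integrable lebesgue corridor (\<lambda>x. side \<sigma> (\<xi>1 t) a1 x - side \<sigma> (\<xi>2 t) a2 x)"
      by (intro set_integral_diff set_integrable_side i)
    show "AE x in lebesgue. x \<in> corridor \<longrightarrow> side \<sigma> (\<xi>1 t) a1 x - side \<sigma> (\<xi>2 t) a2 x = ?s x"
      using ae by eventually_elim (auto simp: side_def)
  qed
  finally show ?thesis .
qed

lemma hughes_solution_data:
  assumes M: "0 < M" and adm: "admissible_velocity M v" and "0 \<le> \<alpha>" and id: "initial_datum M \<rho>0"
    and es: "entropy_solution M v \<alpha> \<rho>0 \<rho> \<xi>" and ws: "well_separated \<rho> \<xi>"
  obtains r g where "bounded_density M r" "AE p in lborel. 0 \<le> fst p \<and> snd p \<in> corridor \<longrightarrow> \<rho> (fst p) (snd p) = r p"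
    "time_slices M \<alpha> \<rho>0 r \<xi> g" "continuous_on {0..} \<xi>" "\<And>t. 0 \<le> t \<Longrightarrow> \<xi> t \<in> corridor"
    "\<And>\<sigma>. \<sigma> = 1 \<or> \<sigma> = -1 \<Longrightarrow> outgoing_solution M (clipped_flux M v) (critical_density M v)
       (\<lambda>t. \<sigma> * \<xi> (max 0 t)) (\<lambda>p. r (fst p, \<sigma> * snd p))"
proof -
  obtain r where r: "bounded_density M r" "AE p in lborel. 0 \<le> fst p \<and> snd p \<in> corridor \<longrightarrow> \<rho> (fst p) (snd p) = r p"
    by (rule borel_representative[of \<rho> M]) (use es M in \<open>auto simp: entropy_solution_def\<close>)
  obtain g where g: "time_slices M \<alpha> \<rho>0 r \<xi> g"
    by (rule entropy_solution_time_slices[OF less_imp_le[OF M] \<open>0 \<le> \<alpha>\<close> id es r])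
  obtain k where k: "k-lipschitz_on {0..} \<xi>" using es unfolding entropy_solution_def by blast
  have "\<xi> t \<in> corridor" if "0 \<le> t" for t using es that unfolding entropy_solution_def by auto
  then show thesis
    using that[OF r g lipschitz_on_continuous_on[OF k] _ entropy_solution_outgoing[OF M adm es ws r]] by blast
qed

text \<open>
  The two sides are cut apart, each side contracts, and the cost at time 0 of cutting at different
  points is controlled by the stability of the turning point. The turning points at time \<open>t\<close> are
  compared by the same balance argument.
\<close>

lemma hughes_stability:
  assumes M: "0 < M" and adm: "admissible_velocity M v"
    and \<alpha>: "0 \<le> \<alpha>1" "0 \<le> \<alpha>2" and id: "initial_datum M \<rho>01" "initial_datum M \<rho>02"
    and s1: "entropy_solution M v \<alpha>1 \<rho>01 \<rho>1 \<xi>1" "well_separated \<rho>1 \<xi>1"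
    and s2: "entropy_solution M v \<alpha>2 \<rho>02 \<rho>2 \<xi>2" "well_separated \<rho>2 \<xi>2"
  shows "AE t in lebesgue. 0 < t \<longrightarrow>
      set_integrable lebesgue corridor (\<lambda>x. \<rho>1 t x - \<rho>2 t x) \<and>
      L1_norm (\<lambda>x. \<rho>1 t x - \<rho>2 t x) \<le>
        (2 + M * max \<alpha>1 \<alpha>2 + 2 * M\<^sup>2) * (\<bar>\<alpha>1 - \<alpha>2\<bar> + L1_norm (\<lambda>x. \<rho>01 x - \<rho>02 x)) \<and>
      2 * \<bar>\<xi>1 t - \<xi>2 t\<bar> \<le> 2 * M * \<bar>\<alpha>1 - \<alpha>2\<bar> + \<alpha>2 * L1_norm (\<lambda>x. \<rho>1 t x - \<rho>2 t x)"
proof -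
  have M0: "0 \<le> M" using M by simp
  obtain r1 g1 where r1: "bounded_density M r1" "AE p in lborel. 0 \<le> fst p \<and> snd p \<in> corridor \<longrightarrow> \<rho>1 (fst p) (snd p) = r1 p"
    and g1: "time_slices M \<alpha>1 \<rho>01 r1 \<xi>1 g1" and c1: "continuous_on {0..} \<xi>1" and \<xi>1: "\<And>t. 0 \<le> t \<Longrightarrow> \<xi>1 t \<in> corridor"
    and o1: "\<And>\<sigma>. \<sigma> = 1 \<or> \<sigma> = -1 \<Longrightarrow> outgoing_solution M (clipped_flux M v) (critical_density M v)
       (\<lambda>t. \<sigma> * \<xi>1 (max 0 t)) (\<lambda>p. r1 (fst p, \<sigma> * snd p))"
    by (rule hughes_solution_data[OF M adm \<alpha>(1) id(1) s1]) blast
  obtain r2 g2 where r2: "bounded_density M r2" "AE p in lborel. 0 \<le> fst p \<and> snd p \<in> corridor \<longrightarrow> \<rho>2 (fst p) (snd p) = r2 p"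
    and g2: "time_slices M \<alpha>2 \<rho>02 r2 \<xi>2 g2" and c2: "continuous_on {0..} \<xi>2" and \<xi>2: "\<And>t. 0 \<le> t \<Longrightarrow> \<xi>2 t \<in> corridor"
    and o2: "\<And>\<sigma>. \<sigma> = 1 \<or> \<sigma> = -1 \<Longrightarrow> outgoing_solution M (clipped_flux M v) (critical_density M v)
       (\<lambda>t. \<sigma> * \<xi>2 (max 0 t)) (\<lambda>p. r2 (fst p, \<sigma> * snd p))"
    by (rule hughes_solution_data[OF M adm \<alpha>(2) id(2) s2]) blast
  note G1 = time_slicesD[OF g1] and G2 = time_slicesD[OF g2]
  obtain L where "lipschitz_flux M L (clipped_flux M v)" using clipped_flux_lipschitz[OF M adm] by blast
  then interpret lipschitz_flux M L "clipped_flux M v" .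
  let ?c = "critical_density M v"
  have c: "0 \<le> ?c" "?c \<le> M" using admissible_flux(2)[OF M adm] by auto
  have mono: "clipped_flux M v a \<le> clipped_flux M v b" if "0 \<le> a" "a \<le> b" "b \<le> ?c" for a b
    using admissible_flux(3)[OF M adm that] that c by (simp add: clipped_flux_eq)
  define \<mu> where "\<mu> \<sigma> t = L1_norm (\<lambda>x. side \<sigma> (\<xi>1 t) (g1 t) x - side \<sigma> (\<xi>2 t) (g2 t) x)" for \<sigma> t
  have lim: "(\<mu> \<sigma> \<longlongrightarrow> \<mu> \<sigma> t) (at_right t)" if "0 \<le> t" "profile M (g1 t)" "profile M (g2 t)" for \<sigma> t
    unfolding \<mu>_def by (rule side_mass_tendsto[OF M0 g1 g2 c1 c2 that])
  have decr: "\<mu> \<sigma> t \<le> \<mu> \<sigma> 0"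
    if \<sigma>: "\<sigma> = 1 \<or> \<sigma> = -1" and t: "0 < t" "profile M (g1 t)" "profile M (g2 t)" for \<sigma> t
  proof (rule outgoing_L1_contraction[OF o1[OF \<sigma>] o2[OF \<sigma>] mono c(1) _ _ _ t(1)])
    show "AE t in lborel. 0 < t \<longrightarrow>
        (LINT x|lborel. indicator corridor x * \<bar>right_part (\<lambda>t. \<sigma> * \<xi>1 (max 0 t)) (\<lambda>p. r1 (fst p, \<sigma> * snd p)) (t, x) -
        right_part (\<lambda>t. \<sigma> * \<xi>2 (max 0 t)) (\<lambda>p. r2 (fst p, \<sigma> * snd p)) (t, x)\<bar>) = \<mu> \<sigma> t"
      unfolding oriented_part_def[symmetric] using G1(6)[unfolded AE_completion_iff[of _ lborel]] G2(6)[unfolded AE_completion_iff[of _ lborel]]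
    proof eventually_elim
      case (elim t)
      show ?case
      proof
        assume "0 < t"
        then show "(LINT x|lborel. indicator corridor x * \<bar>oriented_part \<sigma> \<xi>1 r1 (t, x) -
          oriented_part \<sigma> \<xi>2 r2 (t, x)\<bar>) = \<mu> \<sigma> t"
          unfolding \<mu>_def using elim G1(1)[of t] G2(1)[of t]
          by (intro side_mass_eq[OF r1(1) r2(1) \<sigma>]) (auto simp: AE_completion_iff)
      qed
    qed
    show "(\<mu> \<sigma> \<longlongrightarrow> \<mu> \<sigma> 0) (at_right 0)" by (rule lim[OF order_refl G1(4) G2(4)])
    show "(\<mu> \<sigma> \<longlongrightarrow> \<mu> \<sigma> t) (at_right t)" using lim[of t] t by simp
  qed
  let ?D = "L1_norm (\<lambda>x. \<rho>01 x - \<rho>02 x)"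
  let ?C = "2 + M * max \<alpha>1 \<alpha>2 + 2 * M\<^sup>2"
  have D0: "L1_norm (\<lambda>x. g1 0 x - g2 0 x) = ?D"
  proof (rule L1_norm_cong_AE(1))
    show "set_integrable lebesgue corridor (\<lambda>x. g1 0 x - g2 0 x)" using G1(1) G2(1) by (intro set_integral_diff) auto
    show "AE x in lebesgue. x \<in> corridor \<longrightarrow> g1 0 x - g2 0 x = \<rho>01 x - \<rho>02 x"
      using G1(3) G2(3) by eventually_elim auto
  qed
  have turn0: "2 * \<bar>\<xi>1 0 - \<xi>2 0\<bar> \<le> 2 * M * \<bar>\<alpha>1 - \<alpha>2\<bar> + \<alpha>2 * ?D"
    using turning_point_stability[OF M0 \<alpha>(2) G1(4) G2(4) \<xi>1[of 0] \<xi>2[of 0] G1(5) G2(5)] by (simp add: D0)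
  have \<mu>0: "\<mu> \<sigma> 0 \<le> ?D + M * \<bar>\<xi>1 0 - \<xi>2 0\<bar>" for \<sigma>
    unfolding \<mu>_def D0[symmetric] by (rule side_difference[OF M0 G1(4) G2(1)]) simp
  have final: "2 * ?D + 2 * M * \<bar>\<xi>1 0 - \<xi>2 0\<bar> \<le> ?C * (\<bar>\<alpha>1 - \<alpha>2\<bar> + ?D)"
  proof -
    have "M * (2 * \<bar>\<xi>1 0 - \<xi>2 0\<bar>) \<le> M * (2 * M * \<bar>\<alpha>1 - \<alpha>2\<bar> + \<alpha>2 * ?D)" using turn0 M0 by (rule mult_left_mono)
    moreover have "M * \<alpha>2 * ?D \<le> M * max \<alpha>1 \<alpha>2 * ?D"
      using M0 L1_norm_nonneg by (intro mult_right_mono mult_left_mono) auto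
    moreover have "0 \<le> (2 + M * max \<alpha>1 \<alpha>2) * \<bar>\<alpha>1 - \<alpha>2\<bar>" "0 \<le> 2 * M\<^sup>2 * ?D"
      using M0 \<alpha> L1_norm_nonneg by (auto intro!: mult_nonneg_nonneg add_nonneg_nonneg simp: le_max_iff_disj)
    ultimately show ?thesis by (simp add: algebra_simps power2_eq_square)
  qed
  show ?thesis
    using G1(6) G2(6) AE_half_strip_sections[OF r1(2)] AE_half_strip_sections[OF r2(2)]
  proof eventually_elim
    case (elim t)
    show ?case
    proof
      assume t: "0 < t"
      then have p: "profile M (g1 t)" "profile M (g2 t)" using elim(1,2) by auto
      have i: "set_integrable lebesgue corridor (g1 t)" "set_integrable lebesgue corridor (g2 t)"
        using G1(1) G2(1) t by auto
      have ae: "AE x in lebesgue. x \<in> corridor \<longrightarrow> g1 t x - g2 t x = \<rho>1 t x - \<rho>2 t x"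
      proof -
        have "AE x in lebesgue. x \<in> corridor \<longrightarrow> g1 t x = r1 (t, x)" "AE x in lebesgue. x \<in> corridor \<longrightarrow> g2 t x = r2 (t, x)"
          "AE x in lebesgue. x \<in> corridor \<longrightarrow> \<rho>1 t x = r1 (t, x)" "AE x in lebesgue. x \<in> corridor \<longrightarrow> \<rho>2 t x = r2 (t, x)"
          using elim t by auto
        then show ?thesis by eventually_elim auto
      qed
      note eq = L1_norm_cong_AE[OF set_integral_diff(1)[OF i] ae]
      have "L1_norm (\<lambda>x. g1 t x - g2 t x) \<le> \<mu> 1 t + \<mu> (-1) t"
        unfolding \<mu>_def by (rule L1_norm_le_sides[OF i])
      also have "\<dots> \<le> \<mu> 1 0 + \<mu> (-1) 0" using decr[of 1 t] decr[of "-1" t] t p by simp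
      also have "\<dots> \<le> 2 * ?D + 2 * M * \<bar>\<xi>1 0 - \<xi>2 0\<bar>" using \<mu>0[of 1] \<mu>0[of "-1"] by simp
      also note final
      finally have "L1_norm (\<lambda>x. \<rho>1 t x - \<rho>2 t x) \<le> ?C * (\<bar>\<alpha>1 - \<alpha>2\<bar> + ?D)" by (simp only: eq(1))
      moreover have "2 * \<bar>\<xi>1 t - \<xi>2 t\<bar> \<le> 2 * M * \<bar>\<alpha>1 - \<alpha>2\<bar> + \<alpha>2 * L1_norm (\<lambda>x. \<rho>1 t x - \<rho>2 t x)"
        using turning_point_stability[OF M0 \<alpha>(2) p \<xi>1[of t] \<xi>2[of t]] elim(1,2) t by (simp add: eq(1))
      ultimately show "set_integrable lebesgue corridor (\<lambda>x. \<rho>1 t x - \<rho>2 t x) \<and>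
        L1_norm (\<lambda>x. \<rho>1 t x - \<rho>2 t x) \<le> ?C * (\<bar>\<alpha>1 - \<alpha>2\<bar> + ?D) \<and>
        2 * \<bar>\<xi>1 t - \<xi>2 t\<bar> \<le> 2 * M * \<bar>\<alpha>1 - \<alpha>2\<bar> + \<alpha>2 * L1_norm (\<lambda>x. \<rho>1 t x - \<rho>2 t x)"
        using eq(2) by blast
    qed
  qed
qed

text \<open>
  Stability with equal data gives equality at almost every time; for the curves continuity then gives
  it at every time.
\<close>

lemma hughes_uniqueness:
  assumes M: "0 < M" and adm: "admissible_velocity M v" and \<alpha>: "0 \<le> \<alpha>" and id: "initial_datum M \<rho>0"
    and s1: "entropy_solution M v \<alpha> \<rho>0 \<rho>1 \<xi>1" "well_separated \<rho>1 \<xi>1"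
    and s2: "entropy_solution M v \<alpha> \<rho>0 \<rho>2 \<xi>2" "well_separated \<rho>2 \<xi>2"
  shows "AE p in lebesgue_on ({0..} \<times> corridor). \<rho>1 (fst p) (snd p) = \<rho>2 (fst p) (snd p)"
    "\<forall>t\<ge>0. \<xi>1 t = \<xi>2 t"
proof -
  have z: "L1_norm (\<lambda>x. 0) = 0" by (simp add: L1_norm_def)
  have st: "AE t in lebesgue. 0 < t \<longrightarrow> (AE x in lebesgue. x \<in> corridor \<longrightarrow> \<rho>1 t x - \<rho>2 t x = 0) \<and> \<xi>1 t = \<xi>2 t"
    using hughes_stability[OF M adm \<alpha> \<alpha> id id s1 s2]
  proof eventually_elim
    case (elim t)
    show ?case
    proof
      assume "0 < t"
      then have a: "set_integrable lebesgue corridor (\<lambda>x. \<rho>1 t x - \<rho>2 t x)" "L1_norm (\<lambda>x. \<rho>1 t x - \<rho>2 t x) \<le> 0"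
        "2 * \<bar>\<xi>1 t - \<xi>2 t\<bar> \<le> \<alpha> * L1_norm (\<lambda>x. \<rho>1 t x - \<rho>2 t x)" using elim by (auto simp: z)
      have "\<alpha> * L1_norm (\<lambda>x. \<rho>1 t x - \<rho>2 t x) \<le> 0" using a(2) \<alpha> by (simp add: mult_nonneg_nonpos)
      from order_trans[OF a(3) this] have "\<xi>1 t = \<xi>2 t" by simp
      with L1_norm_zero_AE[OF a(1,2)]
      show "(AE x in lebesgue. x \<in> corridor \<longrightarrow> \<rho>1 t x - \<rho>2 t x = 0) \<and> \<xi>1 t = \<xi>2 t" by blast
    qed
  qed
  obtain r1 where r1: "bounded_density M r1" "AE p in lborel. 0 \<le> fst p \<and> snd p \<in> corridor \<longrightarrow> \<rho>1 (fst p) (snd p) = r1 p"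
    by (rule borel_representative[of \<rho>1 M]) (use s1 M in \<open>auto simp: entropy_solution_def\<close>)
  obtain r2 where r2: "bounded_density M r2" "AE p in lborel. 0 \<le> fst p \<and> snd p \<in> corridor \<longrightarrow> \<rho>2 (fst p) (snd p) = r2 p"
    by (rule borel_representative[of \<rho>2 M]) (use s2 M in \<open>auto simp: entropy_solution_def\<close>)
  have "AE t in lebesgue. AE x in lebesgue. 0 \<le> t \<and> x \<in> corridor \<longrightarrow> r1 (t, x) = r2 (t, x)"
    using st AE_half_strip_sections[OF r1(2)] AE_half_strip_sections[OF r2(2)] AE_lebesgue_neq[of 0]
  proof eventually_elim
    case (elim t)
    show ?case
    proof (cases "0 < t")
      case True
      then have "AE x in lebesgue. x \<in> corridor \<longrightarrow> \<rho>1 t x - \<rho>2 t x = 0"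
        "AE x in lebesgue. x \<in> corridor \<longrightarrow> \<rho>1 t x = r1 (t, x)" "AE x in lebesgue. x \<in> corridor \<longrightarrow> \<rho>2 t x = r2 (t, x)"
        using elim by auto
      then show ?thesis by eventually_elim auto
    qed (use elim(4) in auto)
  qed
  then have ae: "AE t in lborel. AE x in lborel. (\<lambda>p. 0 \<le> fst p \<and> snd p \<in> corridor \<longrightarrow> r1 p = r2 p) (t, x)"
    unfolding AE_completion_iff by simp
  have "AE p in lborel \<Otimes>\<^sub>M lborel. 0 \<le> fst p \<and> snd p \<in> corridor \<longrightarrow> r1 p = r2 p"
  proof (rule lborel_pair.AE_pair_measure[OF _ ae])
    have [measurable]: "r1 \<in> borel_measurable borel" "r2 \<in> borel_measurable borel" using bounded_densityD r1(1) r2(1) by blast+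
    note [measurable] = measurable_fst_snd_real
    have "{p::real \<times> real. 0 \<le> fst p \<and> snd p \<in> corridor \<longrightarrow> r1 p = r2 p} \<in> sets borel"
      using half_strip_sets by measurable
    then show "{p \<in> space (lborel \<Otimes>\<^sub>M lborel). 0 \<le> fst p \<and> snd p \<in> corridor \<longrightarrow> r1 p = r2 p} \<in> sets (lborel \<Otimes>\<^sub>M lborel)"
      unfolding lborel_prod by simp
  qed
  then have "AE p in lborel. 0 \<le> fst p \<and> snd p \<in> corridor \<longrightarrow> r1 p = r2 p" unfolding lborel_prod .
  then show "AE p in lebesgue_on ({0..} \<times> corridor). \<rho>1 (fst p) (snd p) = \<rho>2 (fst p) (snd p)"
    unfolding AE_half_strip_iff using r1(2) r2(2) by eventually_elim auto
  obtain k1 k2 where k: "k1-lipschitz_on {0..} \<xi>1" "k2-lipschitz_on {0..} \<xi>2"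
    using s1 s2 unfolding entropy_solution_def by blast
  show "\<forall>t\<ge>0. \<xi>1 t = \<xi>2 t"
  proof (intro allI impI, rule ccontr)
    fix t :: real assume t: "0 \<le> t" and n: "\<xi>1 t \<noteq> \<xi>2 t"
    have "((\<lambda>s. \<bar>\<xi>1 s - \<xi>2 s\<bar>) \<longlongrightarrow> \<bar>\<xi>1 t - \<xi>2 t\<bar>) (at t within {0..})"
      using lipschitz_on_continuous_on[OF k(1)] lipschitz_on_continuous_on[OF k(2)] t
      by (intro tendsto_intros) (auto simp: continuous_on_def)
    then have "((\<lambda>s. \<bar>\<xi>1 s - \<xi>2 s\<bar>) \<longlongrightarrow> \<bar>\<xi>1 t - \<xi>2 t\<bar>) (at_right t)"
      by (rule tendsto_within_subset) (use t in auto)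
    then have "\<forall>\<^sub>F s in at_right t. 0 < \<bar>\<xi>1 s - \<xi>2 s\<bar>" using n by (intro order_tendstoD(1)) auto
    then obtain b where b: "b > t" "\<And>s. t < s \<Longrightarrow> s < b \<Longrightarrow> 0 < \<bar>\<xi>1 s - \<xi>2 s\<bar>"
      unfolding eventually_at_right_field by auto
    obtain s where "t < s" "s < b" "\<xi>1 s = \<xi>2 s"
      using AE_lebesgue_exists_between[OF st b(1)] t by auto
    then show False using b(2)[of s] by simp
  qed
qed

theorem theorem1:
  fixes \<rho>max :: real and v :: "real \<Rightarrow> real"
  assumes "\<rho>max > 0" and "admissible_velocity \<rho>max v"
  shows "(\<exists>C :: real \<Rightarrow> real \<Rightarrow> real.
      (\<forall>s t a b. 0 < s \<and> s \<le> t \<and> 0 \<le> a \<and> a \<le> b \<longrightarrow> C s a \<le> C t b) \<and>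
      (\<forall>\<alpha>1 \<alpha>2 \<rho>01 \<rho>02 \<rho>1 \<rho>2 \<xi>1 \<xi>2.
         0 \<le> \<alpha>1 \<and> 0 \<le> \<alpha>2 \<and>
         initial_datum \<rho>max \<rho>01 \<and> initial_datum \<rho>max \<rho>02 \<and>
         entropy_solution \<rho>max v \<alpha>1 \<rho>01 \<rho>1 \<xi>1 \<and> well_separated \<rho>1 \<xi>1 \<and>
         entropy_solution \<rho>max v \<alpha>2 \<rho>02 \<rho>2 \<xi>2 \<and> well_separated \<rho>2 \<xi>2 \<and>
         BV_regular \<rho>1 \<longrightarrow>
         (AE t in lebesgue. 0 < t \<longrightarrow>
            L1_norm (\<lambda>x. \<rho>1 t x - \<rho>2 t x) \<le>
            C t (max \<alpha>1 \<alpha>2) * (\<bar>\<alpha>1 - \<alpha>2\<bar> + L1_norm (\<lambda>x. \<rho>01 x - \<rho>02 x))))) \<and>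
    (\<forall>\<alpha> \<rho>0 \<rho>1 \<rho>2 \<xi>1 \<xi>2.
       0 \<le> \<alpha> \<and> initial_datum \<rho>max \<rho>0 \<and>
       entropy_solution \<rho>max v \<alpha> \<rho>0 \<rho>1 \<xi>1 \<and> well_separated \<rho>1 \<xi>1 \<and> BV_regular \<rho>1 \<and>
       entropy_solution \<rho>max v \<alpha> \<rho>0 \<rho>2 \<xi>2 \<and> well_separated \<rho>2 \<xi>2 \<and> BV_regular \<rho>2 \<longrightarrow>
       (AE p in lebesgue_on ({0..} \<times> corridor). \<rho>1 (fst p) (snd p) = \<rho>2 (fst p) (snd p)) \<and>
       (\<forall>t\<ge>0. \<xi>1 t = \<xi>2 t))"
proof (intro conjI exI[of _ "\<lambda>t a. 2 + \<rho>max * a + 2 * \<rho>max\<^sup>2"] allI impI; (elim conjE)?)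
  show "2 + \<rho>max * a + 2 * \<rho>max\<^sup>2 \<le> 2 + \<rho>max * b + 2 * \<rho>max\<^sup>2" if "a \<le> b" for a b
    using that assms(1) by simp
next
  fix \<alpha>1 \<alpha>2 \<rho>01 \<rho>02 \<rho>1 \<rho>2 \<xi>1 \<xi>2
  assume "0 \<le> \<alpha>1" "0 \<le> \<alpha>2" "initial_datum \<rho>max \<rho>01" "initial_datum \<rho>max \<rho>02"
    "entropy_solution \<rho>max v \<alpha>1 \<rho>01 \<rho>1 \<xi>1" "well_separated \<rho>1 \<xi>1"
    "entropy_solution \<rho>max v \<alpha>2 \<rho>02 \<rho>2 \<xi>2" "well_separated \<rho>2 \<xi>2"
  from hughes_stability[OF assms this]
  show "AE t in lebesgue. 0 < t \<longrightarrow> L1_norm (\<lambda>x. \<rho>1 t x - \<rho>2 t x) \<le>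
      (2 + \<rho>max * max \<alpha>1 \<alpha>2 + 2 * \<rho>max\<^sup>2) * (\<bar>\<alpha>1 - \<alpha>2\<bar> + L1_norm (\<lambda>x. \<rho>01 x - \<rho>02 x))"
    by eventually_elim auto
next
  fix \<alpha> \<rho>0 \<rho>1 \<rho>2 \<xi>1 \<xi>2
  assume "0 \<le> \<alpha>" "initial_datum \<rho>max \<rho>0"
    "entropy_solution \<rho>max v \<alpha> \<rho>0 \<rho>1 \<xi>1" "well_separated \<rho>1 \<xi>1"
    "entropy_solution \<rho>max v \<alpha> \<rho>0 \<rho>2 \<xi>2" "well_separated \<rho>2 \<xi>2"
  note u = hughes_uniqueness[OF assms this]
  show "AE p in lebesgue_on ({0..} \<times> corridor). \<rho>1 (fst p) (snd p) = \<rho>2 (fst p) (snd p)" by (rule u(1))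
  show "\<xi>1 t = \<xi>2 t" if "0 \<le> t" for t using u(2) that by blast
qed

end
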